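(* Let $\mathcal{H}$ be a Hilbert space and let $T=(T_1,\dots,T_n)\in\mathfrak{B}^{q,n}(\mathcal{H})$. Then, for each $G\subset\{1,\dots,n\}$, there exist a Hilbert space $\mathcal{H}_G$ and doubly $q$-commuting isometries $V_{G,1},\dots,V_{G,n}$ on $H^2_{\mathcal{H}_G}(\mathbb{D}^{|G|})$, and there exists an isometry $\Pi:\mathcal{H}\to\bigoplus_{G}H^2_{\mathcal{H}_G}(\mathbb{D}^{|G|})$ (the direct sum being over all subsets $G$ of $\{1,\dots,n\}$), such that $$\Pi T_j^*=\Big(\bigoplus_{G}V_{G,j}^*\Big)\Pi\qquad(1\le j\le n),$$ where, by convention, $H^2_{\mathcal{H}_\emptyset}(\mathbb{D}^{|\emptyset|}):=\mathcal{H}_\emptyset$. Moreover, for $i\in G$ the operators $V_{G,i}$ are the rotational shifts $V_{G,i}=M_{z_i}R_{[q]_i}$ on $H^2_{\mathcal{H}_G}(\mathbb{D}^{|G|})$, and for $j\in\{1,\dots,n\}\setminus G$ the operators $V_{G,j}$ are unitaries on $H^2_{\mathcal{H}_G}(\mathbb{D}^{|G|})$.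
   Context: All Hilbert spaces are complex; $\mathbb{Z}_+$ is the set of non-negative integers; $\mathbb{T}$ is the unit circle. Fix $n$ and a function $q:\{1,\dots,n\}\times\{1,\dots,n\}\to\mathbb{T}$ with $q(i,i)=1$ and $q(i,j)=\overline{q(j,i)}$ for all $i,j$. A tuple $(T_1,\dots,T_n)$ of bounded operators is $q$-commuting if $T_iT_j=q(i,j)T_jT_i$ for all $i,j$; it is doubly $q$-commuting if moreover $T_iT_j^*=\overline{q(i,j)}\,T_j^*T_i$ for all $i\neq j$. $\mathcal{T}^{q,n}(\mathcal{H})$ is the set of all $q$-commuting $n$-tuples of contractions on $\mathcal{H}$. For $F=\{k_1<\dots<k_r\}\subset\{1,\dots,n\}$ put $T_F=T_{k_1}\cdots T_{k_r}$ and $T_F^*=T_{k_r}^*\cdots T_{k_1}^*$, with $T_\emptyset=I$. The class $\mathfrak{B}^{q,n}(\mathcal{H})$ (tuples satisfying Brehmer positivity) is $$\mathfrak{B}^{q,n}(\mathcal{H})=\Big\{T\in\mathcal{T}^{q,n}(\mathcal{H}):\ \sum_{F\subset G}(-1)^{|F|}T_FT_F^*\ge 0\ \text{ for all } G\subset\{1,\dots,n\}\Big\}.$$ For a Hilbert space $\mathcal{E}$ and $G=\{m_1<\dots<m_r\}\subset\{1,\dots,n\}$, $H^2_{\mathcal{E}}(\mathbb{D}^{|G|})$ is the $\mathcal{E}$-valued Hardy space over the unit polydisc in the variables $\boldsymbol{z}=(z_{m_1},\dots,z_{m_r})$, i.e. the space of power series $\sum_{\boldsymbol{k}\in\mathbb{Z}_+^r}a_{\boldsymbol{k}}\boldsymbol{z}^{\boldsymbol{k}}$,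 $a_{\boldsymbol{k}}\in\mathcal{E}$, with norm squared $\sum\|a_{\boldsymbol{k}}\|^2<\infty$. For $i\in G$, $M_{z_i}$ is multiplication by $z_i$. For $m\in\{1,\dots,n\}$ the rotation operator $R_{[q]_m}$ on $H^2_{\mathcal{E}}(\mathbb{D}^{|G|})$ is $$R_{[q]_m}\Big(\sum_{\boldsymbol{k}}a_{\boldsymbol{k}}\boldsymbol{z}^{\boldsymbol{k}}\Big)=\sum_{\boldsymbol{k}}a_{\boldsymbol{k}}\Big(\prod_{t=1}^r \big(q(m,m_t)^{1/2}\big)^{k_{m_t}}\Big)\boldsymbol{z}^{\boldsymbol{k}},\qquad \boldsymbol{k}=(k_{m_1},\dots,k_{m_r}).$$ The square roots $q(i,j)^{1/2}$ are fixed so that $q(i,i)^{1/2}=1$ and $q(j,i)^{1/2}=\overline{q(i,j)^{1/2}}$ for all $i,j$. For $i\in G$ the operators $M_{z_i}R_{[q]_i}$ are called rotational shifts. *)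

theory Defs
  imports "HOL-Analysis.Analysis"
begin

section \<open>Complex Hilbert spaces\<close>

text \<open>
  The inner product is linear in the first argument. Positive definiteness of \<open>cinner\<close> is contained
  in \<open>cinner_same\<close> together with the norm axioms.
\<close>

class complex_inner = real_normed_vector +
  fixes scaleC :: "complex \<Rightarrow> 'a \<Rightarrow> 'a"  (infixr "*\<^sub>C" 75)
    and cinner :: "'a \<Rightarrow> 'a \<Rightarrow> complex"
  assumes scaleR_scaleC: "r *\<^sub>R x = complex_of_real r *\<^sub>C x"
    and scaleC_add_right: "c *\<^sub>C (x + y) = c *\<^sub>C x + c *\<^sub>C y"
    and scaleC_add_left: "(c + d) *\<^sub>C x = c *\<^sub>C x + d *\<^sub>C x"
    and scaleC_scaleC: "c *\<^sub>C d *\<^sub>C x = (c * d) *\<^sub>C x"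
    and cinner_commute: "cinner x y = cnj (cinner y x)"
    and cinner_add_left: "cinner (x + y) z = cinner x z + cinner y z"
    and cinner_scaleC_left: "cinner (c *\<^sub>C x) y = c * cinner x y"
    and cinner_same: "cinner x x = complex_of_real ((norm x)\<^sup>2)"

class chilbert_space = complex_inner + banach

instantiation complex :: chilbert_space
begin
definition "c *\<^sub>C (z::complex) = c * z"
definition "cinner (z::complex) w = z * cnj w"
instance
  by standard
     (simp_all add: scaleC_complex_def cinner_complex_def scaleR_conv_of_real algebra_simps
       flip: complex_norm_square of_real_power)
end

lemma cinner_add_right:
  "cinner x (y + z) = cinner x y + cinner x (z::'a::complex_inner)"
  using cinner_commute cinner_add_left by (metis complex_cnj_add)

lemma cinner_scaleC_right:
  "cinner x (c *\<^sub>C y) = cnj c * cinner x (y::'a::complex_inner)"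
  using cinner_commute cinner_scaleC_left by (metis complex_cnj_mult)

lemma norm_scaleC: "norm (c *\<^sub>C x) = cmod c * norm (x::'a::complex_inner)"
proof -
  have "complex_of_real ((norm (c *\<^sub>C x))\<^sup>2) = cinner (c *\<^sub>C x) (c *\<^sub>C x)"
    by (simp only: cinner_same)
  also have "\<dots> = (c * cnj c) * complex_of_real ((norm x)\<^sup>2)"
    by (simp only: cinner_scaleC_left cinner_scaleC_right) (simp add: cinner_same)
  also have "\<dots> = complex_of_real ((cmod c)\<^sup>2 * (norm x)\<^sup>2)"
    by (metis complex_norm_square of_real_mult)
  finally have "(norm (c *\<^sub>C x))\<^sup>2 = (cmod c * norm x)\<^sup>2"
    by (metis of_real_eq_iff power_mult_distrib)
  then show ?thesis by (simp add: power2_eq_iff_nonneg)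
qed

lemma cinner_bound: "2 * cmod (cinner x y) \<le> (norm x)\<^sup>2 + (norm (y::'a::complex_inner))\<^sup>2"
proof -
  define a where "a = cinner x y"
  define c where "c = - sgn a"
  have c: "cnj c * a = - complex_of_real (cmod a)" "cmod c \<le> 1"
  proof -
    have "cnj c * a = - ((a * cnj a) / complex_of_real (cmod a))"
      by (simp add: c_def sgn_eq)
    also have "\<dots> = - complex_of_real (cmod a)"
      unfolding complex_norm_square[symmetric] by (simp add: power2_eq_square)
    finally show "cnj c * a = - complex_of_real (cmod a)" .
    show "cmod c \<le> 1"
      by (simp add: c_def norm_sgn)
  qed
  have "complex_of_real ((norm (x + c *\<^sub>C y))\<^sup>2) = cinner (x + c *\<^sub>C y) (x + c *\<^sub>C y)"
    by (simp only: cinner_same)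
  also have "\<dots> = cinner x x + cnj c * a + (c * cnj a + c * cnj c * cinner y y)"
    unfolding a_def by (simp only: cinner_add_left cinner_add_right cinner_scaleC_left
        cinner_scaleC_right cinner_commute[of y x] distrib_left) (simp add: ac_simps)
  also have "Re \<dots> = (norm x)\<^sup>2 + 2 * Re (cnj c * a) + (cmod c)\<^sup>2 * (norm y)\<^sup>2"
    unfolding cinner_same complex_norm_square[of c, symmetric] by simp
  finally have "(norm (x + c *\<^sub>C y))\<^sup>2 = (norm x)\<^sup>2 - 2 * cmod a + (cmod c)\<^sup>2 * (norm y)\<^sup>2"
    using c(1) by simp
  moreover have "(cmod c)\<^sup>2 * (norm y)\<^sup>2 \<le> (norm y)\<^sup>2"
    using c(2) by (simp add: mult_left_le_one_le power_le_one)
  ultimately show ?thesis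
    unfolding a_def using zero_le_power2[of "norm (x + c *\<^sub>C y)"] by linarith
qed


section \<open>Square-summable families\<close>

text \<open>The Hilbert direct sum of copies of \<open>'a\<close> indexed by the type \<open>'i\<close>.\<close>

definition square_summable :: "('i \<Rightarrow> 'a::real_normed_vector) \<Rightarrow> bool" where
  "square_summable f \<longleftrightarrow> (\<lambda>i. (norm (f i))\<^sup>2) summable_on UNIV"

typedef (overloaded) ('i, 'a) l2sum = "{f :: 'i \<Rightarrow> 'a::real_normed_vector. square_summable f}"
  morphisms l2_coeff l2_of
  by (rule exI[of _ "\<lambda>_. 0"]) (simp add: square_summable_def)

lemma l2_coeff_of: "square_summable f \<Longrightarrow> l2_coeff (l2_of f) = f"
  by (simp add: l2_of_inverse)

lemma square_summable_coeff: "square_summable (l2_coeff x)"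
  using l2_coeff by blast

lemma l2_eqI: "(\<And>i. l2_coeff x i = l2_coeff y i) \<Longrightarrow> x = y"
  by (metis ext l2_coeff_inject)

lemma square_summable_comparison:
  assumes "square_summable f" and "\<And>i. norm (g i) \<le> c * norm (f i)"
  shows "square_summable g"
  unfolding square_summable_def
proof (rule summable_on_comparison_test)
  show "(\<lambda>i. c\<^sup>2 * (norm (f i))\<^sup>2) summable_on UNIV"
    using assms(1) by (auto simp: square_summable_def intro: summable_on_cmult_right)
  show "(norm (g i))\<^sup>2 \<le> c\<^sup>2 * (norm (f i))\<^sup>2" for i
    using power_mono[OF assms(2), of i 2] by (simp add: power_mult_distrib)
qed simp

lemma square_summable_add:
  assumes "square_summable f" "square_summable g"
  shows "square_summable (\<lambda>i. f i + g i)"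
  unfolding square_summable_def
proof (rule summable_on_comparison_test)
  show "(\<lambda>i. 2 * (norm (f i))\<^sup>2 + 2 * (norm (g i))\<^sup>2) summable_on UNIV"
    using assms by (auto simp: square_summable_def intro!: summable_on_add summable_on_cmult_right)
  show "(norm (f i + g i))\<^sup>2 \<le> 2 * (norm (f i))\<^sup>2 + 2 * (norm (g i))\<^sup>2" for i
  proof -
    have "(norm (f i + g i))\<^sup>2 \<le> (norm (f i) + norm (g i))\<^sup>2"
      by (simp add: norm_triangle_ineq power_mono)
    also have "\<dots> \<le> 2 * (norm (f i))\<^sup>2 + 2 * (norm (g i))\<^sup>2"
      using zero_le_power2[of "norm (f i) - norm (g i)"] by (simp add: power2_eq_square algebra_simps)
    finally show ?thesis .
  qed
qed simp

lemma square_summable_minus: "square_summable f \<Longrightarrow> square_summable (\<lambda>i. - f i)"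
  by (simp add: square_summable_def)

lemma square_summable_diff:
  "square_summable f \<Longrightarrow> square_summable g \<Longrightarrow> square_summable (\<lambda>i. f i - g i)"
  using square_summable_add[of f "\<lambda>i. - g i"] square_summable_minus[of g] by simp

lemma square_summable_zero: "square_summable (\<lambda>_. 0)"
  by (simp add: square_summable_def)

lemma square_summable_scaleR: "square_summable f \<Longrightarrow> square_summable (\<lambda>i. r *\<^sub>R f i)"
  by (rule square_summable_comparison[where c = "\<bar>r\<bar>"]) auto

lemma square_summable_scaleC:
  fixes f :: "'i \<Rightarrow> 'a::complex_inner"
  shows "square_summable f \<Longrightarrow> square_summable (\<lambda>i. c *\<^sub>C f i)"
  by (rule square_summable_comparison[where c = "cmod c"]) (auto simp: norm_scaleC)

instantiation l2sum :: (type, real_normed_vector) real_normed_vector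
begin

definition "(0 :: ('a, 'b) l2sum) = l2_of (\<lambda>_. 0)"
definition "x + y = l2_of (\<lambda>i. l2_coeff x i + l2_coeff y i)" for x y :: "('a, 'b) l2sum"
definition "- x = l2_of (\<lambda>i. - l2_coeff x i)" for x :: "('a, 'b) l2sum"
definition "x - y = l2_of (\<lambda>i. l2_coeff x i - l2_coeff y i)" for x y :: "('a, 'b) l2sum"
definition "r *\<^sub>R x = l2_of (\<lambda>i. r *\<^sub>R l2_coeff x i)" for x :: "('a, 'b) l2sum"
definition "norm x = sqrt (\<Sum>\<^sub>\<infinity>i. (norm (l2_coeff x i))\<^sup>2)" for x :: "('a, 'b) l2sum"
definition "dist x y = norm (x - y)" for x y :: "('a, 'b) l2sum"
definition "sgn x = inverse (norm x) *\<^sub>R x" for x :: "('a, 'b) l2sum"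
definition "uniformity = (INF e\<in>{0<..}. principal {(x, y :: ('a, 'b) l2sum). dist x y < e})"
definition "open U = (\<forall>x\<in>U. eventually (\<lambda>(x', y). x' = x \<longrightarrow> y \<in> U) uniformity)"
  for U :: "('a, 'b) l2sum set"

lemma l2_coeff_simps [simp]:
  "l2_coeff 0 i = 0"
  "l2_coeff (x + y) i = l2_coeff x i + l2_coeff y i"
  "l2_coeff (- x) i = - l2_coeff x i"
  "l2_coeff (x - y) i = l2_coeff x i - l2_coeff y i"
  "l2_coeff (r *\<^sub>R x) i = r *\<^sub>R l2_coeff x i"
  by (simp_all add: zero_l2sum_def plus_l2sum_def uminus_l2sum_def minus_l2sum_def scaleR_l2sum_def
      l2_coeff_of square_summable_coeff square_summable_zero square_summable_add
      square_summable_minus square_summable_diff square_summable_scaleR)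

lemma L2_set_le_norm:
  assumes "finite F"
  shows "L2_set (\<lambda>i. norm (l2_coeff x i)) F \<le> norm x"
  unfolding L2_set_def norm_l2sum_def using assms square_summable_coeff[of x]
  by (auto simp: square_summable_def intro!: finite_sum_le_infsum)

lemma l2_norm_leI:
  assumes "\<And>F. finite F \<Longrightarrow> L2_set (\<lambda>i. norm (l2_coeff x i)) F \<le> b"
  shows "norm x \<le> b"
proof -
  have b: "0 \<le> b" using assms[of "{}"] by simp
  have "(\<Sum>\<^sub>\<infinity>i. (norm (l2_coeff x i))\<^sup>2) \<le> b\<^sup>2"
  proof (rule infsum_le_finite_sums)
    show "(\<lambda>i. (norm (l2_coeff x i))\<^sup>2) summable_on UNIV"
      using square_summable_coeff[of x] by (simp add: square_summable_def)
    fix F :: "'a set" assume "finite F"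
    from assms[OF this] show "(\<Sum>i\<in>F. (norm (l2_coeff x i))\<^sup>2) \<le> b\<^sup>2"
      unfolding L2_set_def by (rule sqrt_le_D)
  qed
  then show ?thesis
    unfolding norm_l2sum_def using b by (rule real_le_lsqrt[rotated])
qed

instance
proof
  fix x y z :: "('a, 'b) l2sum" and r s :: real
  show "x + y + z = x + (y + z)" "x + y = y + x" "0 + x = x" "- x + x = 0" "x - y = x + - y"
    "r *\<^sub>R (x + y) = r *\<^sub>R x + r *\<^sub>R y" "(r + s) *\<^sub>R x = r *\<^sub>R x + s *\<^sub>R x"
    "r *\<^sub>R s *\<^sub>R x = (r * s) *\<^sub>R x" "1 *\<^sub>R x = x"
    by (rule l2_eqI; simp add: algebra_simps)+
  show "dist x y = norm (x - y)" "sgn x = inverse (norm x) *\<^sub>R x"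
    by (simp_all add: dist_l2sum_def sgn_l2sum_def)
  show "uniformity = (INF e\<in>{0<..}. principal {(x, y :: ('a, 'b) l2sum). dist x y < e})"
    by (rule uniformity_l2sum_def)
  show "open U = (\<forall>x\<in>U. eventually (\<lambda>(x', y). x' = x \<longrightarrow> y \<in> U) uniformity)"
    for U :: "('a, 'b) l2sum set"
    by (rule open_l2sum_def)
  show "norm x = 0 \<longleftrightarrow> x = 0"
  proof
    assume "norm x = 0"
    then have "L2_set (\<lambda>i. norm (l2_coeff x i)) {i} \<le> 0" for i
      using L2_set_le_norm[of "{i}" x] by simp
    then show "x = 0" by (intro l2_eqI) simp
  qed (simp add: norm_l2sum_def)
  show "norm (x + y) \<le> norm x + norm y"
  proof (rule l2_norm_leI)
    fix F :: "'a set" assume F: "finite F"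
    have "L2_set (\<lambda>i. norm (l2_coeff (x + y) i)) F
        \<le> L2_set (\<lambda>i. norm (l2_coeff x i) + norm (l2_coeff y i)) F"
      by (rule L2_set_mono) (auto simp: norm_triangle_ineq)
    also have "\<dots> \<le> L2_set (\<lambda>i. norm (l2_coeff x i)) F + L2_set (\<lambda>i. norm (l2_coeff y i)) F"
      by (rule L2_set_triangle_ineq)
    also have "\<dots> \<le> norm x + norm y"
      using F by (intro add_mono L2_set_le_norm)
    finally show "L2_set (\<lambda>i. norm (l2_coeff (x + y) i)) F \<le> norm x + norm y" .
  qed
  show "norm (r *\<^sub>R x) = \<bar>r\<bar> * norm x"
    by (simp add: norm_l2sum_def power_mult_distrib infsum_cmult_right' real_sqrt_mult)
qed

end

lemma norm_l2_coeff_le: "norm (l2_coeff x i) \<le> norm x"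
  using L2_set_le_norm[of "{i}" x] by simp

instance l2sum :: (type, banach) banach
proof
  fix X :: "nat \<Rightarrow> ('a, 'b) l2sum"
  assume X: "Cauchy X"
  have "Cauchy (\<lambda>n. l2_coeff (X n) i)" for i
  proof (rule CauchyI)
    fix e :: real assume "0 < e"
    then obtain N where N: "\<And>m n. m \<ge> N \<Longrightarrow> n \<ge> N \<Longrightarrow> norm (X m - X n) < e"
      using CauchyD[OF X] by blast
    have "norm (l2_coeff (X m) i - l2_coeff (X n) i) < e" if "m \<ge> N" "n \<ge> N" for m n
      using norm_l2_coeff_le[of "X m - X n" i] N[OF that] by simp
    then show "\<exists>N. \<forall>m\<ge>N. \<forall>n\<ge>N. norm (l2_coeff (X m) i - l2_coeff (X n) i) < e" by blast
  qed
  then have "\<forall>i. \<exists>l. (\<lambda>n. l2_coeff (X n) i) \<longlonglongrightarrow> l"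
    using Cauchy_convergent convergentD by blast
  then obtain f where f: "\<And>i. (\<lambda>n. l2_coeff (X n) i) \<longlonglongrightarrow> f i"
    by metis
  have bound: "L2_set (\<lambda>i. norm (l2_coeff (X m) i - f i)) F \<le> e"
    if "finite F" and N: "\<And>n. n \<ge> N \<Longrightarrow> norm (X m - X n) \<le> e" for m N e F
  proof (rule LIMSEQ_le_const2)
    show "(\<lambda>n. L2_set (\<lambda>i. norm (l2_coeff (X m) i - l2_coeff (X n) i)) F)
        \<longlonglongrightarrow> L2_set (\<lambda>i. norm (l2_coeff (X m) i - f i)) F"
      unfolding L2_set_def by (intro tendsto_intros f)
    have "L2_set (\<lambda>i. norm (l2_coeff (X m) i - l2_coeff (X n) i)) F \<le> e" if "n \<ge> N" for n
      using L2_set_le_norm[OF \<open>finite F\<close>, of "X m - X n"] N[OF that] by simp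
    then show "\<exists>N. \<forall>n\<ge>N. L2_set (\<lambda>i. norm (l2_coeff (X m) i - l2_coeff (X n) i)) F \<le> e" by blast
  qed
  have summ: "square_summable (\<lambda>i. l2_coeff (X m) i - f i)"
    if N: "\<And>n. n \<ge> N \<Longrightarrow> norm (X m - X n) \<le> e" for m N e
    unfolding square_summable_def
  proof (rule nonneg_bdd_above_summable_on)
    show "bdd_above (sum (\<lambda>i. (norm (l2_coeff (X m) i - f i))\<^sup>2) ` {F. F \<subseteq> UNIV \<and> finite F})"
    proof (rule bdd_aboveI2)
      fix F :: "'a set" assume "F \<in> {F. F \<subseteq> UNIV \<and> finite F}"
      then have *: "L2_set (\<lambda>i. norm (l2_coeff (X m) i - f i)) F \<le> e"
        using bound[of F N m e] N by blast
      show "(\<Sum>i\<in>F. (norm (l2_coeff (X m) i - f i))\<^sup>2) \<le> e\<^sup>2"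
        using * unfolding L2_set_def by (rule sqrt_le_D)
    qed
  qed simp
  obtain N1 where N1: "\<And>m n. m \<ge> N1 \<Longrightarrow> n \<ge> N1 \<Longrightarrow> norm (X m - X n) < 1"
    using CauchyD[OF X, of 1] by auto
  have "square_summable (\<lambda>i. l2_coeff (X N1) i - (l2_coeff (X N1) i - f i))"
    by (intro square_summable_diff square_summable_coeff summ[where N = N1 and e = 1])
       (use N1 in \<open>auto intro: less_imp_le\<close>)
  then have f_summ: "square_summable f" by simp
  have "X \<longlonglongrightarrow> l2_of f"
  proof (rule LIMSEQ_I)
    fix r :: real assume "0 < r"
    then obtain N where N: "\<And>m n. m \<ge> N \<Longrightarrow> n \<ge> N \<Longrightarrow> norm (X m - X n) < r / 2"
      using CauchyD[OF X, of "r / 2"] by auto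
    have "norm (X m - l2_of f) < r" if "m \<ge> N" for m
    proof -
      have "norm (X m - l2_of f) \<le> r / 2"
        by (rule l2_norm_leI)
           (use bound[where N = N and m = m and e = "r / 2"] N[OF that] in
             \<open>auto simp: l2_coeff_of f_summ intro: less_imp_le\<close>)
      then show ?thesis using \<open>0 < r\<close> by simp
    qed
    then show "\<exists>N. \<forall>m\<ge>N. norm (X m - l2_of f) < r" by blast
  qed
  then show "convergent X" by (auto simp: convergent_def)
qed

instantiation l2sum :: (type, complex_inner) complex_inner
begin

definition "c *\<^sub>C x = l2_of (\<lambda>i. c *\<^sub>C l2_coeff x i)" for x :: "('a, 'b) l2sum"
definition "cinner x y = (\<Sum>\<^sub>\<infinity>i. cinner (l2_coeff x i) (l2_coeff y i))"
  for x y :: "('a, 'b) l2sum"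

lemma l2_coeff_scaleC [simp]: "l2_coeff (c *\<^sub>C x) i = c *\<^sub>C l2_coeff x i"
  by (simp add: scaleC_l2sum_def l2_coeff_of square_summable_coeff square_summable_scaleC)

lemma cinner_summable: "(\<lambda>i. cinner (l2_coeff x i) (l2_coeff y i)) summable_on UNIV"
proof (rule Infinite_Sum.abs_summable_summable, rule Infinite_Sum.abs_summable_on_comparison_test')
  show "(\<lambda>i. (norm (l2_coeff x i))\<^sup>2 + (norm (l2_coeff y i))\<^sup>2) summable_on UNIV"
    using square_summable_coeff[of x] square_summable_coeff[of y]
    by (auto simp: square_summable_def intro!: summable_on_add)
  show "cmod (cinner (l2_coeff x i) (l2_coeff y i)) \<le> (norm (l2_coeff x i))\<^sup>2 + (norm (l2_coeff y i))\<^sup>2"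
    for i
    using cinner_bound[of "l2_coeff x i" "l2_coeff y i"]
      norm_ge_zero[of "cinner (l2_coeff x i) (l2_coeff y i)"] by linarith
qed

instance
proof
  fix x y z :: "('a, 'b) l2sum" and c d :: complex and r :: real
  show "r *\<^sub>R x = complex_of_real r *\<^sub>C x"
    by (rule l2_eqI) (simp add: scaleR_scaleC)
  show "c *\<^sub>C (x + y) = c *\<^sub>C x + c *\<^sub>C y"
    by (rule l2_eqI) (simp add: scaleC_add_right)
  show "(c + d) *\<^sub>C x = c *\<^sub>C x + d *\<^sub>C x"
    by (rule l2_eqI) (simp add: scaleC_add_left)
  show "c *\<^sub>C d *\<^sub>C x = (c * d) *\<^sub>C x"
    by (rule l2_eqI) (simp add: scaleC_scaleC)
  show "cinner x y = cnj (cinner y x)"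
    unfolding cinner_l2sum_def infsum_cnj[symmetric]
    by (rule infsum_cong) (rule cinner_commute)
  show "cinner (x + y) z = cinner x z + cinner y z"
    unfolding cinner_l2sum_def l2_coeff_simps cinner_add_left
    by (rule infsum_add) (rule cinner_summable)+
  show "cinner (c *\<^sub>C x) y = c * cinner x y"
    by (simp add: cinner_l2sum_def cinner_scaleC_left infsum_cmult_right')
  show "cinner x x = complex_of_real ((norm x)\<^sup>2)"
  proof -
    have "((\<lambda>i. (norm (l2_coeff x i))\<^sup>2) has_sum (norm x)\<^sup>2) UNIV"
      using square_summable_coeff[of x]
      by (simp add: norm_l2sum_def infsum_nonneg square_summable_def)
    then have "((\<lambda>i. complex_of_real ((norm (l2_coeff x i))\<^sup>2)) has_sum complex_of_real ((norm x)\<^sup>2)) UNIV"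
      by (rule has_sum_of_real)
    then show ?thesis
      unfolding cinner_l2sum_def cinner_same by (rule infsumI)
  qed
qed

end

instance l2sum :: (type, chilbert_space) chilbert_space ..


section \<open>Operators between closed subspaces\<close>

text \<open>
  Hilbert spaces other than full types are closed subspaces \<open>M\<close> of some \<^class>\<open>chilbert_space\<close> type.
  An operator from \<open>M\<close> to \<open>N\<close> is a function on the ambient type of which only the values
  on \<open>M\<close> matter.
\<close>

definition closed_csubspace :: "'a::complex_inner set \<Rightarrow> bool" where
  "closed_csubspace M \<longleftrightarrow> 0 \<in> M \<and> (\<forall>x\<in>M. \<forall>y\<in>M. x + y \<in> M) \<and> (\<forall>c. \<forall>x\<in>M. c *\<^sub>C x \<in> M) \<and> closed M"

definition bounded_op :: "'a::complex_inner set \<Rightarrow> 'b::complex_inner set \<Rightarrow> ('a \<Rightarrow> 'b) \<Rightarrow> bool" where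
  "bounded_op M N A \<longleftrightarrow>
     (\<forall>x\<in>M. A x \<in> N) \<and>
     (\<forall>x\<in>M. \<forall>y\<in>M. A (x + y) = A x + A y) \<and>
     (\<forall>c. \<forall>x\<in>M. A (c *\<^sub>C x) = c *\<^sub>C A x) \<and>
     (\<exists>K. \<forall>x\<in>M. norm (A x) \<le> K * norm x)"

definition contraction_op :: "'a::complex_inner set \<Rightarrow> 'b::complex_inner set \<Rightarrow> ('a \<Rightarrow> 'b) \<Rightarrow> bool" where
  "contraction_op M N A \<longleftrightarrow> bounded_op M N A \<and> (\<forall>x\<in>M. norm (A x) \<le> norm x)"

definition isometry_op :: "'a::complex_inner set \<Rightarrow> 'b::complex_inner set \<Rightarrow> ('a \<Rightarrow> 'b) \<Rightarrow> bool" where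
  "isometry_op M N A \<longleftrightarrow> bounded_op M N A \<and> (\<forall>x\<in>M. norm (A x) = norm x)"

text \<open>
  For a bounded operator from \<open>M\<close> to \<open>N\<close> with \<open>M\<close> a closed subspace of a Hilbert space, the
  described vector exists (Riesz) and is unique, for every \<open>y \<in> N\<close>.
\<close>

definition adjoint_op :: "'a::complex_inner set \<Rightarrow> ('a \<Rightarrow> 'b::complex_inner) \<Rightarrow> 'b \<Rightarrow> 'a" where
  "adjoint_op M A y = (THE x. x \<in> M \<and> (\<forall>z\<in>M. cinner (A z) y = cinner z x))"

definition unitary_op :: "'a::complex_inner set \<Rightarrow> ('a \<Rightarrow> 'a) \<Rightarrow> bool" where
  "unitary_op M U \<longleftrightarrow> bounded_op M M U \<and>
     (\<forall>x\<in>M. adjoint_op M U (U x) = x) \<and> (\<forall>x\<in>M. U (adjoint_op M U x) = x)"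

definition positive_op :: "'a::complex_inner set \<Rightarrow> ('a \<Rightarrow> 'a) \<Rightarrow> bool" where
  "positive_op M A \<longleftrightarrow> (\<forall>x\<in>M. cinner (A x) x \<in> \<real> \<and> 0 \<le> Re (cinner (A x) x))"


section \<open>Tuples of operators\<close>

definition is_q :: "nat \<Rightarrow> (nat \<Rightarrow> nat \<Rightarrow> complex) \<Rightarrow> bool" where
  "is_q n q \<longleftrightarrow> (\<forall>i\<in>{1..n}. \<forall>j\<in>{1..n}. cmod (q i j) = 1 \<and> q i i = 1 \<and> q i j = cnj (q j i))"

definition is_sqrt_q :: "nat \<Rightarrow> (nat \<Rightarrow> nat \<Rightarrow> complex) \<Rightarrow> (nat \<Rightarrow> nat \<Rightarrow> complex) \<Rightarrow> bool" where
  "is_sqrt_q n q s \<longleftrightarrow>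
     (\<forall>i\<in>{1..n}. \<forall>j\<in>{1..n}. (s i j)\<^sup>2 = q i j \<and> s i i = 1 \<and> s j i = cnj (s i j))"

definition q_commuting ::
    "nat \<Rightarrow> (nat \<Rightarrow> nat \<Rightarrow> complex) \<Rightarrow> 'a::complex_inner set \<Rightarrow> (nat \<Rightarrow> 'a \<Rightarrow> 'a) \<Rightarrow> bool" where
  "q_commuting n q M T \<longleftrightarrow>
     (\<forall>i\<in>{1..n}. \<forall>j\<in>{1..n}. \<forall>x\<in>M. T i (T j x) = q i j *\<^sub>C T j (T i x))"

definition doubly_q_commuting ::
    "nat \<Rightarrow> (nat \<Rightarrow> nat \<Rightarrow> complex) \<Rightarrow> 'a::complex_inner set \<Rightarrow> (nat \<Rightarrow> 'a \<Rightarrow> 'a) \<Rightarrow> bool" where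
  "doubly_q_commuting n q M T \<longleftrightarrow> q_commuting n q M T \<and>
     (\<forall>i\<in>{1..n}. \<forall>j\<in>{1..n}. i \<noteq> j \<longrightarrow>
        (\<forall>x\<in>M. T i (adjoint_op M (T j) x) = cnj (q i j) *\<^sub>C adjoint_op M (T j) (T i x)))"

definition q_contractions ::
    "nat \<Rightarrow> (nat \<Rightarrow> nat \<Rightarrow> complex) \<Rightarrow> 'a::complex_inner set \<Rightarrow> (nat \<Rightarrow> 'a \<Rightarrow> 'a) \<Rightarrow> bool" where
  "q_contractions n q M T \<longleftrightarrow> (\<forall>i\<in>{1..n}. contraction_op M M (T i)) \<and> q_commuting n q M T"

definition op_product :: "(nat \<Rightarrow> 'a \<Rightarrow> 'a) \<Rightarrow> nat list \<Rightarrow> 'a \<Rightarrow> 'a" where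
  "op_product T ks = foldr (\<lambda>k A. T k \<circ> A) ks id"

definition op_set :: "(nat \<Rightarrow> 'a \<Rightarrow> 'a) \<Rightarrow> nat set \<Rightarrow> 'a \<Rightarrow> 'a" where
  "op_set T F = op_product T (sorted_list_of_set F)"

definition op_set_adj ::
    "'a::complex_inner set \<Rightarrow> (nat \<Rightarrow> 'a \<Rightarrow> 'a) \<Rightarrow> nat set \<Rightarrow> 'a \<Rightarrow> 'a" where
  "op_set_adj M T F = op_product (\<lambda>k. adjoint_op M (T k)) (rev (sorted_list_of_set F))"

definition brehmer ::
    "nat \<Rightarrow> (nat \<Rightarrow> nat \<Rightarrow> complex) \<Rightarrow> 'a::complex_inner set \<Rightarrow> (nat \<Rightarrow> 'a \<Rightarrow> 'a) \<Rightarrow> bool" where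
  "brehmer n q M T \<longleftrightarrow> q_contractions n q M T \<and>
     (\<forall>G \<subseteq> {1..n}. positive_op M (\<lambda>h. \<Sum>F\<in>Pow G. (-1) ^ card F *\<^sub>C op_set T F (op_set_adj M T F h)))"


section \<open>Vector-valued Hardy spaces and rotational shifts\<close>

text \<open>
  A power series is given by its coefficients, a square-summable family over multi-indices
  \<open>nat \<Rightarrow> nat\<close>. Only the variables \<open>z\<^sub>i\<close> with \<open>i \<in> G\<close> occur in an element of \<open>hardy G E\<close>.
  Hence \<open>hardy {} E\<close> consists of the constants with value in \<open>E\<close>, that is, it is \<open>E\<close>.
\<close>

definition hardy ::
    "nat set \<Rightarrow> 'a::complex_inner set \<Rightarrow> (nat \<Rightarrow> nat, 'a) l2sum set" where
  "hardy G E = {f. (\<forall>k. l2_coeff f k \<in> E) \<and> (\<forall>k. (\<exists>i. i \<notin> G \<and> k i \<noteq> 0) \<longrightarrow> l2_coeff f k = 0)}"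

definition mult_z ::
    "nat \<Rightarrow> (nat \<Rightarrow> nat, 'a::complex_inner) l2sum \<Rightarrow> (nat \<Rightarrow> nat, 'a) l2sum" where
  "mult_z i f = l2_of (\<lambda>k. if k i = 0 then 0 else l2_coeff f (k(i := k i - 1)))"

text \<open>
  In \<open>rotation s G m\<close>, \<open>s i j\<close> is the chosen square root of \<open>q i j\<close>. As these have modulus 1, the
  family below is square-summable and \<open>l2_coeff_rotation\<close> applies.
\<close>

definition rotation ::
    "(nat \<Rightarrow> nat \<Rightarrow> complex) \<Rightarrow> nat set \<Rightarrow> nat \<Rightarrow>
      (nat \<Rightarrow> nat, 'a::complex_inner) l2sum \<Rightarrow> (nat \<Rightarrow> nat, 'a) l2sum" where
  "rotation s G m f = l2_of (\<lambda>k. (\<Prod>t\<in>G. s m t ^ k t) *\<^sub>C l2_coeff f k)"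

lemma l2_coeff_mult_z:
  "l2_coeff (mult_z i f) k = (if k i = 0 then 0 else l2_coeff f (k(i := k i - 1)))"
proof -
  let ?g = "\<lambda>k. if k i = 0 then 0 else l2_coeff f (k(i := k i - 1))"
  let ?S = "{k :: nat \<Rightarrow> nat. k i \<noteq> 0}"
  let ?h = "\<lambda>k :: nat \<Rightarrow> nat. k(i := Suc (k i))"
  have bij: "bij_betw ?h UNIV ?S"
    by (rule bij_betw_byWitness[where f' = "\<lambda>k. k(i := k i - 1)"]) auto
  have "(\<lambda>k. (norm (l2_coeff f k))\<^sup>2) summable_on UNIV"
    using square_summable_coeff[of f] by (simp add: square_summable_def)
  then have "(\<lambda>k. (norm (?g (?h k)))\<^sup>2) summable_on UNIV"
    by simp
  then have "(\<lambda>k. (norm (?g k))\<^sup>2) summable_on ?S"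
    using summable_on_reindex_bij_betw[OF bij, of "\<lambda>k. (norm (?g k))\<^sup>2"] by simp
  then have "square_summable ?g"
    unfolding square_summable_def
    by (rule summable_on_cong_neutral[THEN iffD1, rotated -1]) auto
  then show ?thesis by (simp add: mult_z_def l2_coeff_of)
qed

lemma l2_coeff_rotation:
  assumes "\<And>t. t \<in> G \<Longrightarrow> cmod (s m t) = 1"
  shows "l2_coeff (rotation s G m f) k = (\<Prod>t\<in>G. s m t ^ k t) *\<^sub>C l2_coeff f k"
proof -
  have "cmod (\<Prod>t\<in>G. s m t ^ k t) = 1" for k
    using assms by (simp add: norm_power flip: prod_norm)
  then have "square_summable (\<lambda>k. (\<Prod>t\<in>G. s m t ^ k t) *\<^sub>C l2_coeff f k)"
    by (intro square_summable_comparison[OF square_summable_coeff[of f], where c = 1])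
       (simp add: norm_scaleC)
  then show ?thesis by (simp add: rotation_def l2_coeff_of)
qed


section \<open>Direct sums over a set of indices\<close>

definition direct_sum :: "'i set \<Rightarrow> ('i \<Rightarrow> 'a::complex_inner set) \<Rightarrow> ('i, 'a) l2sum set" where
  "direct_sum I M = {x. (\<forall>i\<in>I. l2_coeff x i \<in> M i) \<and> (\<forall>i. i \<notin> I \<longrightarrow> l2_coeff x i = 0)}"

definition direct_sum_op ::
    "'i set \<Rightarrow> ('i \<Rightarrow> 'a \<Rightarrow> 'a) \<Rightarrow> ('i, 'a::complex_inner) l2sum \<Rightarrow> ('i, 'a) l2sum" where
  "direct_sum_op I A x = l2_of (\<lambda>i. if i \<in> I then A i (l2_coeff x i) else 0)"

text \<open>
  Types cannot be quantified existentially, so coefficient Hilbert spaces are taken among the closed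
  subspaces of \<open>(nat, 'a) l2sum\<close>, the square-summable sequences in the given space \<open>'a\<close>. This is no
  restriction up to isomorphism: the part of a model that is reducing and generated by the image of
  \<open>'a\<close> has coefficient spaces of Hilbert dimension at most \<open>\<aleph>\<^sub>0\<close> times that of \<open>'a\<close>.
\<close>

type_synonym 'a model_coeff = "(nat, 'a) l2sum"
type_synonym 'a model_hardy = "(nat \<Rightarrow> nat, 'a model_coeff) l2sum"

end

theory Submission
  imports Defs
begin

text \<open>
  Put \<open>B\<^sub>j = T\<^sub>j\<^sup>*\<close> and let \<open>\<delta>\<^sub>j f = f - f \<circ> B\<^sub>j\<close> and \<open>L\<^sub>j f = lim\<^sub>k f \<circ> B\<^sub>j\<^sup>k\<close> act on
  quadratic forms. These operations commute because the phases \<open>q(i,j)\<close> are unimodular, and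
  telescoping gives \<open>f = (\<Sum>k. \<delta>\<^sub>j f \<circ> B\<^sub>j\<^sup>k) + L\<^sub>j f\<close>. Starting from the squared norm and treating
  \<open>j = 1, \<dots>, n\<close> in turn yields \<open>(norm h)\<^sup>2 = (\<Sum>G. \<Sum>k. \<Delta>\<^sub>G (B\<^sup>k h))\<close> with \<open>k\<close> supported in \<open>G\<close>, where
  \<open>\<Delta>\<^sub>G\<close> applies \<open>\<delta>\<^sub>j\<close> for \<open>j \<in> G\<close> and \<open>L\<^sub>j\<close> for \<open>j \<notin> G\<close>; Brehmer positivity makes every \<open>\<Delta>\<^sub>G\<close>
  nonnegative. Write \<open>\<Delta>\<^sub>G h = (norm (S\<^sub>G h))\<^sup>2\<close>. For \<open>j \<notin> G\<close> the form \<open>\<Delta>\<^sub>G\<close> is invariant under \<open>B\<^sub>j\<close>, so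
  \<open>S\<^sub>G h \<mapsto> S\<^sub>G (B\<^sub>j h)\<close> is isometric, and these maps become unitary on the space of the minimal
  unitary extension of their product. The coefficients of \<open>\<Pi> h\<close> are \<open>S\<^sub>G (B\<^sup>k h)\<close> up to a phase.
\<close>

section \<open>Hilbert space preliminaries\<close>

text \<open>Forms are used instead of operators because a unimodular multiple of a vector has the
  same value: for forms, q-commuting maps simply commute, and the strong limits behind the stable
  parts become limits of decreasing real sequences. The obstacle is the part on which several
  q-commuting isometries must become unitary simultaneously. It is enough to extend their product:
  up to a phase each factor can be moved to its outer end, so each factor is onto as soon as the
  product is invertible. Every coefficient space must lie in the one type
  \<open>'a model_coeff\<close>. Hence a form is realised by a series of squares, and the unitary
  extension is laid out in blocks of a sequence space rather than as a new space. The phases are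
  shared unevenly. For i and j both in G each of the two rotations contributes a square root of
  q(i,j). For j outside G the shift by z_i contributes nothing, so the unitary has to carry all of
  q(j,i) as a diagonal weight.\<close>

lemma scaleC_one [simp]: "1 *\<^sub>C x = (x::'a::complex_inner)"
  using scaleR_scaleC[of 1 x] by simp

lemma scaleC_zero_left [simp]: "0 *\<^sub>C x = (0::'a::complex_inner)"
  using scaleR_scaleC[of 0 x] by simp

lemma scaleC_zero_right [simp]: "c *\<^sub>C (0::'a::complex_inner) = 0"
  using scaleC_add_right[of c 0 0] by simp

lemma scaleC_minus_one: "(-1) *\<^sub>C x = - (x::'a::complex_inner)"
  using scaleR_scaleC[of "-1" x] by simp

lemma scaleC_minus_right [simp]: "c *\<^sub>C (- x) = - (c *\<^sub>C (x::'a::complex_inner))"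
  using scaleC_add_right[of c x "-x"] by (simp add: eq_neg_iff_add_eq_0 add.commute)

lemma scaleC_diff_right: "c *\<^sub>C (x - y) = c *\<^sub>C x - c *\<^sub>C (y::'a::complex_inner)"
  using scaleC_add_right[of c x "-y"] by simp

lemma cinner_zero_left [simp]: "cinner 0 (x::'a::complex_inner) = 0"
  using cinner_add_left[of 0 0 x] by simp

lemma cinner_zero_right [simp]: "cinner (x::'a::complex_inner) 0 = 0"
  using cinner_add_right[of x 0 0] by simp

lemma cinner_minus_left: "cinner (- x) y = - cinner x (y::'a::complex_inner)"
  using cinner_scaleC_left[of "-1" x y] by (simp add: scaleC_minus_one)

lemma cinner_minus_right: "cinner x (- y) = - cinner x (y::'a::complex_inner)"
  using cinner_scaleC_right[of x "-1" y] by (simp add: scaleC_minus_one)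

lemma cinner_diff_left: "cinner (x - y) z = cinner x z - cinner y (z::'a::complex_inner)"
  using cinner_add_left[of x "-y" z] by (simp add: cinner_minus_left)

lemma cinner_diff_right: "cinner x (y - z) = cinner x y - cinner x (z::'a::complex_inner)"
  using cinner_add_right[of x y "-z"] by (simp add: cinner_minus_right)

lemma norm_add_sq: "(norm (x + y))\<^sup>2 = (norm x)\<^sup>2 + 2 * Re (cinner x y) + (norm (y::'a::complex_inner))\<^sup>2"
proof -
  have "complex_of_real ((norm (x + y))\<^sup>2) = cinner (x + y) (x + y)"
    by (simp only: cinner_same)
  also have "\<dots> = cinner x x + cinner x y + cnj (cinner x y) + cinner y y"
    by (simp add: cinner_add_left cinner_add_right flip: cinner_commute)
  finally have "Re (complex_of_real ((norm (x + y))\<^sup>2)) = Re (cinner x x + cinner x y + cnj (cinner x y) + cinner y y)"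
    by simp
  then show ?thesis unfolding cinner_same by simp
qed

lemma norm_diff_sq: "(norm (x - y))\<^sup>2 = (norm x)\<^sup>2 - 2 * Re (cinner x y) + (norm (y::'a::complex_inner))\<^sup>2"
  using norm_add_sq[of x "-y"] by (simp add: cinner_minus_right)

lemma cinner_norm_le:
  "cmod (cinner x y) \<le> norm x * norm (y::'a::complex_inner)"
proof (cases "norm x = 0 \<or> norm y = 0")
  case False
  define a where "a = norm x"
  define b where "b = norm y"
  have ab: "a > 0" "b > 0" using False by (auto simp: a_def b_def)
  have "2 * cmod (cinner (complex_of_real (inverse a) *\<^sub>C x) (complex_of_real (inverse b) *\<^sub>C y)) \<le> 2"
    using cinner_bound[of "complex_of_real (inverse a) *\<^sub>C x" "complex_of_real (inverse b) *\<^sub>C y"] ab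
    unfolding norm_scaleC a_def[symmetric] b_def[symmetric] by (simp add: norm_inverse)
  then have "cmod (cinner x y) * (inverse a * inverse b) \<le> 1"
    using ab by (simp add: cinner_scaleC_left cinner_scaleC_right norm_mult norm_inverse mult_ac)
  then show ?thesis using ab unfolding a_def[symmetric] b_def[symmetric] by (simp add: field_simps)
qed auto

text \<open>Variational and polarisation arguments give real parts only; replacing x by i x then
  yields the complex identity.\<close>

lemma complex_eq_by_Re:
  assumes "Re a = Re b" "Re (\<i> * a) = Re (\<i> * b)" shows "a = b"
  using assms by (simp add: complex_eq_iff)

lemma linear_coeff_zero:
  fixes a b :: real
  assumes "\<And>t. 0 \<le> t\<^sup>2 * a + 2 * t * b"
  shows "b = 0"
proof (rule ccontr)
  assume b: "b \<noteq> 0"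
  have "a \<ge> 0" using assms[of 1] assms[of "-1"] by simp
  \<comment> \<open>For a > 0 the quadratic is least at -b / a. Using a + 1 keeps the denominator
    positive when a = 0 and still gives a negative value.\<close>
  have "0 \<le> (- b / (a + 1))\<^sup>2 * a + 2 * (- b / (a + 1)) * b" by (rule assms)
  also have "\<dots> = (b\<^sup>2 / (a+1)\<^sup>2) * (- a - 2)"
  proof -
    have "a + 1 \<noteq> 0" using \<open>a \<ge> 0\<close> by simp
    then show ?thesis by (simp add: divide_simps power2_eq_square) algebra
  qed
  also have "\<dots> < 0" using b \<open>a \<ge> 0\<close> by (intro mult_pos_neg) auto
  finally show False by simp
qed

section \<open>Closed subspaces and the Riesz representation\<close>

lemma closed_csubspaceD:
  assumes "closed_csubspace M"
  shows "0 \<in> M" "x \<in> M \<Longrightarrow> y \<in> M \<Longrightarrow> x + y \<in> M" "x \<in> M \<Longrightarrow> c *\<^sub>C x \<in> M" "closed M"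
    "x \<in> M \<Longrightarrow> - x \<in> M" "x \<in> M \<Longrightarrow> y \<in> M \<Longrightarrow> x - y \<in> M" "x \<in> M \<Longrightarrow> r *\<^sub>R x \<in> M"
proof -
  show 1: "0 \<in> M" "x \<in> M \<Longrightarrow> y \<in> M \<Longrightarrow> x + y \<in> M" "x \<in> M \<Longrightarrow> c *\<^sub>C x \<in> M" "closed M" for x y c
    using assms by (auto simp: closed_csubspace_def)
  show 2: "x \<in> M \<Longrightarrow> - x \<in> M" for x
    using 1(3)[of x "-1"] by (simp add: scaleC_minus_one)
  show "x \<in> M \<Longrightarrow> y \<in> M \<Longrightarrow> x - y \<in> M"
    using 1(2)[of x "-y"] 2 by simp
  show "x \<in> M \<Longrightarrow> r *\<^sub>R x \<in> M" unfolding scaleR_scaleC by (rule 1)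
qed

lemma closed_csubspace_UNIV: "closed_csubspace UNIV"
  by (simp add: closed_csubspace_def)

text \<open>The representing vector is the minimiser of \<open>(norm x)\<^sup>2 - 2 * Re (\<phi> x)\<close>.\<close>

lemma riesz_representation:
  fixes M :: "'a::chilbert_space set" and \<phi> :: "'a \<Rightarrow> complex"
  assumes M: "closed_csubspace M"
    and add: "\<And>x y. x \<in> M \<Longrightarrow> y \<in> M \<Longrightarrow> \<phi> (x + y) = \<phi> x + \<phi> y"
    and scale: "\<And>c x. x \<in> M \<Longrightarrow> \<phi> (c *\<^sub>C x) = c * \<phi> x"
    and bound: "\<And>x. x \<in> M \<Longrightarrow> cmod (\<phi> x) \<le> K * norm x"
  shows "\<exists>y\<in>M. \<forall>x\<in>M. \<phi> x = cinner x y"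
proof -
  note MD = closed_csubspaceD[OF M]
  define J where "J x = (norm x)\<^sup>2 - 2 * Re (\<phi> x)" for x
  have scaleR: "\<phi> (r *\<^sub>R x) = r * \<phi> x" if "x \<in> M" for r x
    unfolding scaleR_scaleC using scale[OF that] by simp
  have lower: "- K\<^sup>2 \<le> J x" if "x \<in> M" for x
  proof -
    have "Re (\<phi> x) \<le> K * norm x"
      using bound[OF that] complex_Re_le_cmod[of "\<phi> x"] by linarith
    moreover have "0 \<le> (norm x - K)\<^sup>2" by simp
    ultimately show ?thesis unfolding J_def by (simp add: power2_diff algebra_simps)
  qed
  define d where "d = Inf (J ` M)"
  have bdd: "bdd_below (J ` M)" by (rule bdd_belowI2) (rule lower)
  have d_le: "d \<le> J x" if "x \<in> M" for x
    unfolding d_def using bdd that by (simp add: cINF_lower)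
  have "\<exists>x\<in>M. J x < d + 1 / real (Suc m)" for m
    using cInf_lessD[of "J ` M" "d + 1 / real (Suc m)"] MD(1) unfolding d_def by auto
  then obtain X where X: "\<And>m. X m \<in> M" "\<And>m. J (X m) < d + 1 / real (Suc m)"
    by metis
  \<comment> \<open>Parallelogram law: \<open>J\<close> is at least d at the midpoint, so two
    near-minimisers are close. This makes \<open>X\<close> a Cauchy sequence.\<close>
  have par: "(norm (x - y))\<^sup>2 \<le> 2 * (J x + J y - 2 * d)" if "x \<in> M" "y \<in> M" for x y
  proof -
    have "d \<le> J ((1/2) *\<^sub>R (x + y))" by (intro d_le MD(7) MD(2) that)
    also have "\<dots> = (norm (x + y))\<^sup>2 / 4 - Re (\<phi> x) - Re (\<phi> y)"
      unfolding J_def scaleR[OF MD(2)[OF that]] add[OF that] norm_scaleR by (simp add: power_mult_distrib power2_eq_square add_divide_distrib)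
    finally show ?thesis unfolding J_def norm_add_sq norm_diff_sq by (simp add: algebra_simps)
  qed
  have "Cauchy X"
  proof (rule CauchyI)
    fix e :: real assume e: "0 < e"
    then obtain N where N: "4 / e\<^sup>2 < real N" using reals_Archimedean2 by blast
    have "norm (X a - X b) < e" if "a \<ge> N" "b \<ge> N" for a b
    proof -
      have "0 < 4 / e\<^sup>2" using e by simp
      with N have N0: "0 < real N" by linarith
      have "J (X c) < d + 1 / real N" if "c \<ge> N" for c
      proof -
        have "1 / real (Suc c) \<le> 1 / real N" using that N0 by (intro divide_left_mono) auto
        then show ?thesis using X(2)[of c] by linarith
      qed
      from this[OF that(1)] this[OF that(2)] have "(norm (X a - X b))\<^sup>2 < 4 * (1 / real N)"
        using par[OF X(1) X(1), of a b] by argo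
      also have "\<dots> < e\<^sup>2" using N N0 e by (simp add: field_simps)
      finally show ?thesis using e by (simp add: power2_less_imp_less)
    qed
    then show "\<exists>N. \<forall>a\<ge>N. \<forall>b\<ge>N. norm (X a - X b) < e" by blast
  qed
  then obtain y where y: "X \<longlonglongrightarrow> y" using Cauchy_convergent convergentD by blast
  have yM: "y \<in> M" by (rule closed_sequentially[OF MD(4) X(1) y])
  have "(\<lambda>m. \<phi> (X m) - \<phi> y) \<longlonglongrightarrow> 0"
  proof (rule Lim_null_comparison)
    have "\<phi> (X m) - \<phi> y = \<phi> (X m - y)" for m
      using add[OF MD(6)[OF X(1) yM] yM, of m] by simp
    then show "\<forall>\<^sub>F m in sequentially. norm (\<phi> (X m) - \<phi> y) \<le> K * norm (X m - y)"
      using bound[OF MD(6)[OF X(1) yM]] by simp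
    show "(\<lambda>m. K * norm (X m - y)) \<longlonglongrightarrow> 0"
      using tendsto_mult_right_zero[OF tendsto_norm_zero[OF LIM_zero[OF y]], of K] by simp
  qed
  then have "(\<lambda>m. \<phi> (X m)) \<longlonglongrightarrow> \<phi> y" by (rule LIM_zero_cancel)
  then have "(\<lambda>m. J (X m)) \<longlonglongrightarrow> J y"
    unfolding J_def by (intro tendsto_intros y)
  moreover have "(\<lambda>m. d + 1 / real (Suc m)) \<longlonglongrightarrow> d + 0"
    by (intro tendsto_intros LIMSEQ_inverse_real_of_nat[unfolded inverse_eq_divide])
  ultimately have Jy: "J y \<le> d"
    using X(2) by (intro LIMSEQ_le[where X = "\<lambda>m. J (X m)"]) (auto intro: less_imp_le)
  have re: "Re (\<phi> z) = Re (cinner z y)" if z: "z \<in> M" for z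
  proof -
    \<comment> \<open>Since y minimises \<open>J\<close>, the variation along z is nonnegative for
      all real t, which forces its linear coefficient to vanish.\<close>
    have "0 \<le> t\<^sup>2 * (norm z)\<^sup>2 + 2 * t * (Re (cinner z y) - Re (\<phi> z))" for t
    proof -
      have "J y \<le> J (y + t *\<^sub>R z)" using Jy d_le[OF MD(2)[OF yM MD(7)[OF z]], of t] by linarith
      moreover have "Re (cinner y (t *\<^sub>R z)) = t * Re (cinner z y)"
        using cinner_commute[of y z] by (simp add: scaleR_scaleC cinner_scaleC_right)
      ultimately show ?thesis
        unfolding J_def add[OF yM MD(7)[OF z]] scaleR[OF z] norm_add_sq
        by (simp add: power_mult_distrib algebra_simps)
    qed
    from linear_coeff_zero[OF this] show ?thesis by simp
  qed
  have "\<phi> z = cinner z y" if z: "z \<in> M" for z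
  proof (rule complex_eq_by_Re)
    show "Re (\<i> * \<phi> z) = Re (\<i> * cinner z y)"
      using re[OF MD(3)[OF z, of \<i>]] unfolding scale[OF z] cinner_scaleC_left .
  qed (rule re[OF z])
  then show ?thesis using yM by blast
qed

section \<open>Bounded operators and adjoints\<close>

lemma bounded_opD:
  assumes "bounded_op M N A"
  shows "x \<in> M \<Longrightarrow> A x \<in> N" "x \<in> M \<Longrightarrow> y \<in> M \<Longrightarrow> A (x + y) = A x + A y"
    "x \<in> M \<Longrightarrow> A (c *\<^sub>C x) = c *\<^sub>C A x"
    "\<exists>K. \<forall>x\<in>M. norm (A x) \<le> K * norm x"
  using assms unfolding bounded_op_def by auto

lemma bounded_op_diff:
  assumes "closed_csubspace M" "bounded_op M N A" "x \<in> M" "y \<in> M"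
  shows "A (x - y) = A x - A y"
  using bounded_opD(2)[OF assms(2) closed_csubspaceD(6)[OF assms(1,3,4)] assms(4)] by simp

lemma bounded_op_zero:
  assumes "closed_csubspace M" "bounded_op M N A"
  shows "A 0 = 0"
  using bounded_op_diff[OF assms, of 0 0] closed_csubspaceD(1)[OF assms(1)] by simp

lemma adjoint_op_eqI:
  assumes "closed_csubspace M" "x \<in> M" "\<And>z. z \<in> M \<Longrightarrow> cinner (A z) y = cinner z x"
  shows "adjoint_op M A y = x"
  unfolding adjoint_op_def
proof (rule the_equality)
  fix x' assume *: "x' \<in> M \<and> (\<forall>z\<in>M. cinner (A z) y = cinner z x')"
  have "x' - x \<in> M" using * assms closed_csubspaceD(6) by blast
  then have "cinner (x' - x) x' = cinner (x' - x) x" using * assms(3) by metis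
  then have "cinner (x' - x) (x' - x) = 0" by (simp add: cinner_diff_right)
  then show "x' = x" by (simp add: cinner_same)
qed (use assms in auto)

lemma adjoint_op_works:
  fixes M :: "'a::chilbert_space set"
  assumes M: "closed_csubspace M" and A: "bounded_op M N A"
  shows "adjoint_op M A y \<in> M" "z \<in> M \<Longrightarrow> cinner (A z) y = cinner z (adjoint_op M A y)"
proof -
  obtain K where K: "\<And>x. x \<in> M \<Longrightarrow> norm (A x) \<le> K * norm x"
    using bounded_opD(4)[OF A] by blast
  have "\<exists>x\<in>M. \<forall>z\<in>M. cinner (A z) y = cinner z x"
  proof (rule riesz_representation[OF M, where K = "K * norm y"])
    fix x assume "x \<in> M"
    have "cmod (cinner (A x) y) \<le> norm (A x) * norm y" by (rule cinner_norm_le)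
    also have "\<dots> \<le> K * norm x * norm y" using K[OF \<open>x \<in> M\<close>] by (intro mult_right_mono) auto
    finally show "cmod (cinner (A x) y) \<le> K * norm y * norm x" by (simp add: mult_ac)
  qed (simp_all add: bounded_opD[OF A] cinner_add_left cinner_scaleC_left)
  then obtain x where x: "x \<in> M" "\<And>z. z \<in> M \<Longrightarrow> cinner (A z) y = cinner z x" by blast
  then have "adjoint_op M A y = x" by (intro adjoint_op_eqI[OF M])
  with x show "adjoint_op M A y \<in> M" "z \<in> M \<Longrightarrow> cinner (A z) y = cinner z (adjoint_op M A y)"
    by auto
qed

lemma adjoint_op_linear:
  fixes M :: "'a::chilbert_space set"
  assumes M: "closed_csubspace M" and A: "bounded_op M N A"
  shows "adjoint_op M A (x + y) = adjoint_op M A x + adjoint_op M A y"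
    and "adjoint_op M A (c *\<^sub>C x) = c *\<^sub>C adjoint_op M A x"
proof -
  note w = adjoint_op_works[OF M A]
  show "adjoint_op M A (x + y) = adjoint_op M A x + adjoint_op M A y"
    by (rule adjoint_op_eqI[OF M]) (simp_all add: w closed_csubspaceD(2)[OF M] cinner_add_right)
  show "adjoint_op M A (c *\<^sub>C x) = c *\<^sub>C adjoint_op M A x"
    by (rule adjoint_op_eqI[OF M]) (simp_all add: w closed_csubspaceD(3)[OF M] cinner_scaleC_right)
qed

lemma adjoint_op_contraction:
  fixes M :: "'a::chilbert_space set"
  assumes M: "closed_csubspace M" and A: "contraction_op M N A"
  shows "norm (adjoint_op M A y) \<le> norm y"
proof -
  let ?x = "adjoint_op M A y"
  have A': "bounded_op M N A" using A by (simp add: contraction_op_def)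
  note w = adjoint_op_works[OF M A', where y = y]
  have "(norm ?x)\<^sup>2 = cmod (cinner (A ?x) y)"
    unfolding w(2)[OF w(1)] cinner_same by (simp del: of_real_power)
  also have "\<dots> \<le> norm (A ?x) * norm y" by (rule cinner_norm_le)
  also have "\<dots> \<le> norm ?x * norm y"
    using A w(1) by (intro mult_right_mono) (auto simp: contraction_op_def)
  finally have "norm ?x * norm ?x \<le> norm ?x * norm y" by (simp add: power2_eq_square)
  then show ?thesis by (cases "norm ?x = 0") (auto simp: mult_le_cancel_left)
qed

section \<open>Isometries and their unitary extension\<close>

lemma closure_seqI: "(\<And>n. s n \<in> S) \<Longrightarrow> s \<longlonglongrightarrow> x \<Longrightarrow> x \<in> closure S"
  for s :: "nat \<Rightarrow> 'a::first_countable_topology"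
  using closure_sequential by metis

lemma closure_seqD: "x \<in> closure S \<Longrightarrow> \<exists>s. (\<forall>n. s n \<in> S) \<and> s \<longlonglongrightarrow> x"
  for x :: "'a::first_countable_topology"
  by (simp add: closure_sequential)

lemma bounded_op_tendsto:
  assumes M: "closed_csubspace M" and A: "bounded_op M N A"
    and X: "\<And>n. X n \<in> M" "X \<longlonglongrightarrow> x"
  shows "(\<lambda>n. A (X n)) \<longlonglongrightarrow> A x"
proof -
  have x: "x \<in> M" by (rule closed_sequentially[OF closed_csubspaceD(4)[OF M] X])
  obtain K where K: "\<And>x. x \<in> M \<Longrightarrow> norm (A x) \<le> K * norm x"
    using bounded_opD(4)[OF A] by blast
  have "(\<lambda>n. A (X n) - A x) \<longlonglongrightarrow> 0"
  proof (rule Lim_null_comparison)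
    show "\<forall>\<^sub>F n in sequentially. norm (A (X n) - A x) \<le> K * norm (X n - x)"
      using K[OF closed_csubspaceD(6)[OF M X(1) x]] bounded_op_diff[OF M A X(1) x] by simp
    show "(\<lambda>n. K * norm (X n - x)) \<longlonglongrightarrow> 0"
      using tendsto_mult_right_zero[OF tendsto_norm_zero[OF LIM_zero[OF X(2)]], of K] by simp
  qed
  then show ?thesis by (rule LIM_zero_cancel)
qed

lemma bounded_op_eq_on_closure:
  assumes M: "closed_csubspace (closure X)"
    and A: "bounded_op (closure X) N A" "bounded_op (closure X) N' A'"
    and eq: "\<And>x. x \<in> X \<Longrightarrow> A x = A' x" and x: "x \<in> closure X"
  shows "A x = A' x"
proof -
  from closure_seqD[OF x] obtain s where s: "\<And>n. s n \<in> X" "s \<longlonglongrightarrow> x" by metis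
  have sc: "\<And>n. s n \<in> closure X" using s(1) closure_subset by blast
  have "(\<lambda>n. A (s n)) \<longlonglongrightarrow> A x" "(\<lambda>n. A' (s n)) \<longlonglongrightarrow> A' x"
    using bounded_op_tendsto[OF M A(1) sc s(2)] bounded_op_tendsto[OF M A(2) sc s(2)] .
  then show ?thesis unfolding eq[OF s(1)] by (rule LIMSEQ_unique)
qed

lemma bounded_op_comp:
  assumes "bounded_op M N A" "bounded_op N K B"
  shows "bounded_op M K (\<lambda>x. B (A x))"
proof -
  obtain a b where a: "\<And>x. x \<in> M \<Longrightarrow> norm (A x) \<le> a * norm x"
    and b: "\<And>x. x \<in> N \<Longrightarrow> norm (B x) \<le> b * norm x"
    using assms bounded_opD(4) by metis
  have "norm (B (A x)) \<le> (\<bar>b\<bar> * a) * norm x" if "x \<in> M" for x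
  proof -
    have "norm (B (A x)) \<le> \<bar>b\<bar> * norm (A x)"
      using b[OF bounded_opD(1)[OF assms(1) that]] mult_right_mono[OF abs_ge_self norm_ge_zero]
      by (rule order_trans)
    also have "\<dots> \<le> \<bar>b\<bar> * (a * norm x)" by (intro mult_left_mono a that) simp
    finally show ?thesis by (simp add: mult_ac)
  qed
  then show ?thesis
    using assms unfolding bounded_op_def by metis
qed

lemma bounded_op_scaleC:
  assumes "bounded_op M N A" "closed_csubspace N"
  shows "bounded_op M N (\<lambda>x. c *\<^sub>C A x)"
proof -
  obtain a where a: "\<And>x. x \<in> M \<Longrightarrow> norm (A x) \<le> a * norm x"
    using bounded_opD(4)[OF assms(1)] by metis
  have "norm (c *\<^sub>C A x) \<le> (cmod c * a) * norm x" if "x \<in> M" for x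
    using mult_left_mono[OF a[OF that] norm_ge_zero[of c]] by (simp add: norm_scaleC mult_ac)
  then have "\<exists>K. \<forall>x\<in>M. norm (c *\<^sub>C A x) \<le> K * norm x" by blast
  then show ?thesis
    using bounded_opD(1-3)[OF assms(1)] closed_csubspaceD(3)[OF assms(2)]
    unfolding bounded_op_def by (simp add: scaleC_add_right scaleC_scaleC mult.commute)
qed

lemma tendsto_scaleC:
  fixes x :: "'b::complex_inner"
  assumes "X \<longlonglongrightarrow> x"
  shows "(\<lambda>n. c *\<^sub>C X n) \<longlonglongrightarrow> c *\<^sub>C x"
proof (rule bounded_op_tendsto[OF closed_csubspace_UNIV _ _ assms])
  have "\<exists>K. \<forall>y::'b. norm (c *\<^sub>C y) \<le> K * norm y" by (auto simp: norm_scaleC)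
  then show "bounded_op UNIV UNIV (\<lambda>x. c *\<^sub>C x :: 'b)"
    unfolding bounded_op_def by (auto simp: scaleC_add_right scaleC_scaleC mult.commute)
qed simp

section \<open>Isometries and their extension by continuity\<close>

lemma isometry_opD:
  assumes "isometry_op M N A"
  shows "bounded_op M N A" "x \<in> M \<Longrightarrow> norm (A x) = norm x"
  using assms by (auto simp: isometry_op_def)

lemma isometry_op_cinner:
  assumes M: "closed_csubspace M" and A: "isometry_op M N A" and x: "x \<in> M" and y: "y \<in> M"
  shows "cinner (A x) (A y) = cinner x y"
proof -
  note MD = closed_csubspaceD[OF M] and bA = bounded_opD[OF isometry_opD(1)[OF A]]
  have re: "Re (cinner (A x) (A y)) = Re (cinner x y)" if x: "x \<in> M" for x
    using isometry_opD(2)[OF A MD(2)[OF x y]] norm_add_sq[of "A x" "A y"] norm_add_sq[of x y]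
      isometry_opD(2)[OF A x] isometry_opD(2)[OF A y] bA(2)[OF x y] by simp
  show ?thesis
  proof (rule complex_eq_by_Re)
    show "Re (\<i> * cinner (A x) (A y)) = Re (\<i> * cinner x y)"
      using re[OF MD(3)[OF x, of \<i>]] unfolding bA(3)[OF x] cinner_scaleC_left .
  qed (rule re[OF x])
qed

text \<open>The index p is only a parameter: closure under the operations is asked of the range, not
  linearity of \<open>u\<close>. The later use has pairs (l, h) as indices, with l a natural
  number.\<close>

lemma closed_csubspace_closure_range:
  fixes u :: "'i \<Rightarrow> 'b::complex_inner"
  assumes add: "\<And>p p'. \<exists>p''. u p'' = u p + u p'"
    and scale: "\<And>c p. \<exists>p''. u p'' = c *\<^sub>C u p"
  shows "closed_csubspace (closure (range u))"
proof -
  obtain p where "u p = 0" using scale[of 0 undefined] by auto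
  then have "0 \<in> range u" by (metis rangeI)
  then have 0: "0 \<in> closure (range u)" by (rule subsetD[OF closure_subset])
  have "x + y \<in> closure (range u)" if "x \<in> closure (range u)" "y \<in> closure (range u)" for x y
  proof -
    from closure_seqD[OF that(1)] obtain s where s: "\<And>n. s n \<in> range u" "s \<longlonglongrightarrow> x" by metis
    from closure_seqD[OF that(2)] obtain t where t: "\<And>n. t n \<in> range u" "t \<longlonglongrightarrow> y" by metis
    have "s n + t n \<in> range u" for n
    proof -
      obtain p p' where "s n = u p" "t n = u p'" using s(1)[of n] t(1)[of n] by blast
      then show ?thesis using add[of p p'] by (metis rangeI)
    qed
    from this tendsto_add[OF s(2) t(2)] show ?thesis by (rule closure_seqI)
  qed
  moreover have "c *\<^sub>C x \<in> closure (range u)" if "x \<in> closure (range u)" for c x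
  proof -
    from closure_seqD[OF that] obtain s where s: "\<And>n. s n \<in> range u" "s \<longlonglongrightarrow> x" by metis
    have "c *\<^sub>C s n \<in> range u" for n
    proof -
      obtain p where "s n = u p" using s(1)[of n] by blast
      then show ?thesis using scale[of c p] by (metis rangeI)
    qed
    from this tendsto_scaleC[OF s(2)] show ?thesis by (rule closure_seqI)
  qed
  ultimately show ?thesis using 0 by (auto simp: closed_csubspace_def)
qed

text \<open>The norm equality, applied to a parameter of a difference, gives equality of distances.
  This shows at once that \<open>v p\<close> depends on \<open>u p\<close> alone and that the
  induced map is uniformly continuous, hence extends to the closure. The shared witnesses for
  \<open>u\<close> and \<open>v\<close> make it linear.\<close>

lemma isometry_extension:
  fixes u v :: "'i \<Rightarrow> 'b::chilbert_space"
  assumes add: "\<And>p p'. \<exists>p''. u p'' = u p + u p' \<and> v p'' = v p + v p'"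
    and scale: "\<And>c p. \<exists>p''. u p'' = c *\<^sub>C u p \<and> v p'' = c *\<^sub>C v p"
    and norm: "\<And>p. norm (v p) = norm (u p)"
  shows "\<exists>g. isometry_op (closure (range u)) (closure (range v)) g \<and> (\<forall>p. g (u p) = v p)"
proof -
  have dist: "dist (v p) (v p') = dist (u p) (u p')" for p p'
  proof -
    obtain r where r: "u r = (-1) *\<^sub>C u p'" "v r = (-1) *\<^sub>C v p'" using scale by metis
    obtain r' where "u r' = u p + u r" "v r' = v p + v r" using add by metis
    with r have "u r' = u p - u p'" "v r' = v p - v p'" by (simp_all add: scaleC_minus_one)
    then show ?thesis using norm[of r'] by (simp add: dist_norm)
  qed
  define f where "f x = v (SOME p. u p = x)" for x
  have f: "f (u p) = v p" for p
  proof -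
    have "u (SOME p'. u p' = u p) = u p" by (rule someI) simp
    then have "dist (v (SOME p'. u p' = u p)) (v p) = 0" unfolding dist by simp
    then show ?thesis by (simp add: f_def)
  qed
  have "uniformly_continuous_on (range u) f"
    unfolding uniformly_continuous_on_def by (auto simp: f dist)
  then obtain g where g: "uniformly_continuous_on (closure (range u)) g"
    and gf: "\<And>x. x \<in> range u \<Longrightarrow> f x = g x"
    by (rule uniformly_continuous_on_extension_on_closure) metis
  have gu: "g (u p) = v p" for p using gf[of "u p"] f[of p] by simp
  have lim: "(\<lambda>n. v (p n)) \<longlonglongrightarrow> g x" if "(\<lambda>n. u (p n)) \<longlonglongrightarrow> x" for p x
  proof -
    have "x \<in> closure (range u)" by (rule closure_seqI[OF _ that]) simp
    moreover have "\<forall>\<^sub>F n in sequentially. u (p n) \<in> closure (range u)"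
      by (intro always_eventually allI subsetD[OF closure_subset] rangeI)
    ultimately have "(\<lambda>n. g (u (p n))) \<longlonglongrightarrow> g x"
      by (rule continuous_on_tendsto_compose[OF uniformly_continuous_imp_continuous[OF g] that])
    then show ?thesis by (simp add: gu)
  qed
  have seq: "\<exists>p. (\<lambda>n. u (p n)) \<longlonglongrightarrow> x" if x: "x \<in> closure (range u)" for x
  proof -
    from closure_seqD[OF x] obtain s where s: "\<And>n. s n \<in> range u" "s \<longlonglongrightarrow> x" by metis
    have "\<forall>n. \<exists>p. s n = u p" using s(1) by (simp add: image_iff)
    from choice[OF this] obtain p where "\<forall>n. s n = u (p n)" ..
    then have "s = (\<lambda>n. u (p n))" by (simp add: fun_eq_iff)
    with s(2) have "(\<lambda>n. u (p n)) \<longlonglongrightarrow> x" by simp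
    then show ?thesis by (rule exI[of _ p])
  qed
  have gadd: "g (x + y) = g x + g y" if "x \<in> closure (range u)" "y \<in> closure (range u)" for x y
  proof -
    from seq[OF that(1)] obtain p where p: "(\<lambda>n. u (p n)) \<longlonglongrightarrow> x" ..
    from seq[OF that(2)] obtain p' where p': "(\<lambda>n. u (p' n)) \<longlonglongrightarrow> y" ..
    have "\<forall>n. \<exists>r. u r = u (p n) + u (p' n) \<and> v r = v (p n) + v (p' n)" using add by simp
    from choice[OF this] obtain r
      where r: "\<And>n. u (r n) = u (p n) + u (p' n)" "\<And>n. v (r n) = v (p n) + v (p' n)" by auto
    have "(\<lambda>n. v (r n)) \<longlonglongrightarrow> g (x + y)"
      by (rule lim) (simp add: r(1) p p' tendsto_add)
    moreover have "(\<lambda>n. v (r n)) \<longlonglongrightarrow> g x + g y"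
      unfolding r(2) by (intro tendsto_add lim p p')
    ultimately show ?thesis by (rule LIMSEQ_unique)
  qed
  have gscale: "g (c *\<^sub>C x) = c *\<^sub>C g x" if x: "x \<in> closure (range u)" for c x
  proof -
    from seq[OF x] obtain p where p: "(\<lambda>n. u (p n)) \<longlonglongrightarrow> x" ..
    have "\<forall>n. \<exists>r. u r = c *\<^sub>C u (p n) \<and> v r = c *\<^sub>C v (p n)" using scale by simp
    from choice[OF this] obtain r
      where r: "\<And>n. u (r n) = c *\<^sub>C u (p n)" "\<And>n. v (r n) = c *\<^sub>C v (p n)" by auto
    have "(\<lambda>n. v (r n)) \<longlonglongrightarrow> g (c *\<^sub>C x)"
      by (rule lim) (simp add: r(1) p tendsto_scaleC)
    moreover have "(\<lambda>n. v (r n)) \<longlonglongrightarrow> c *\<^sub>C g x"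
      unfolding r(2) by (intro tendsto_scaleC lim p)
    ultimately show ?thesis by (rule LIMSEQ_unique)
  qed
  have gnorm: "norm (g x) = norm x" and gin: "g x \<in> closure (range v)"
    if x: "x \<in> closure (range u)" for x
  proof -
    from seq[OF x] obtain p where p: "(\<lambda>n. u (p n)) \<longlonglongrightarrow> x" ..
    note l = lim[OF p]
    have "(\<lambda>n. norm (v (p n))) \<longlonglongrightarrow> norm x" unfolding norm by (rule tendsto_norm[OF p])
    then show "norm (g x) = norm x" using tendsto_norm[OF l] LIMSEQ_unique by blast
    show "g x \<in> closure (range v)" by (rule closure_seqI[OF _ l]) simp
  qed
  have "isometry_op (closure (range u)) (closure (range v)) g"
    unfolding isometry_op_def bounded_op_def using gadd gscale gnorm gin
    by (intro conjI ballI allI exI[of _ 1]) simp_all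
  then show ?thesis using gu by metis
qed

section \<open>A unitary extension inside the sequence space\<close>

lemma l2_norm_has_sum: "((\<lambda>i. (norm (l2_coeff x i))\<^sup>2) has_sum (norm x)\<^sup>2) UNIV"
  using square_summable_coeff[of x]
  by (simp add: norm_l2sum_def infsum_nonneg square_summable_def)

lemma l2_of_has_sum:
  assumes "((\<lambda>i. (norm (f i))\<^sup>2) has_sum r) UNIV"
  shows "l2_coeff (l2_of f) = f" "(norm (l2_of f))\<^sup>2 = r"
proof -
  have "square_summable f"
    using assms unfolding square_summable_def summable_on_def by blast
  then show 1: "l2_coeff (l2_of f) = f" by (rule l2_coeff_of)
  show "(norm (l2_of f))\<^sup>2 = r"
    using l2_norm_has_sum[of "l2_of f"] assms unfolding 1 by (rule has_sum_unique)
qed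

text \<open>\<open>prod_decode\<close> arranges the sequence index in countably many rows, and row i
  receives a copy of the whole space. The direct sums needed for a unitary extension thus stay in
  the same type.\<close>

definition block :: "nat \<Rightarrow> (nat, 'a::complex_inner) l2sum \<Rightarrow> (nat, 'a) l2sum" where
  "block i x = l2_of (\<lambda>m. if fst (prod_decode m) = i then l2_coeff x (snd (prod_decode m)) else 0)"

lemma
  shows l2_coeff_block: "l2_coeff (block i x) m =
      (if fst (prod_decode m) = i then l2_coeff x (snd (prod_decode m)) else 0)"
    and norm_block: "norm (block i x) = norm x"
proof -
  let ?f = "\<lambda>m. if fst (prod_decode m) = i then l2_coeff x (snd (prod_decode m)) else 0"
  let ?g = "\<lambda>b. prod_encode (i, b)"
  have inj: "inj ?g" by (auto simp: inj_on_def)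
  have "((\<lambda>m. (norm (?f m))\<^sup>2) \<circ> ?g has_sum (norm x)\<^sup>2) UNIV"
    using l2_norm_has_sum[of x] by (simp add: comp_def)
  then have "((\<lambda>m. (norm (?f m))\<^sup>2) has_sum (norm x)\<^sup>2) (range ?g)"
    using has_sum_reindex[OF inj] by blast
  moreover have "m \<in> range ?g" if "fst (prod_decode m) = i" for m
    using that by (metis prod.collapse prod_decode_inverse rangeI)
  ultimately have "((\<lambda>m. (norm (?f m))\<^sup>2) has_sum (norm x)\<^sup>2) UNIV"
    by (subst has_sum_cong_neutral[where T = "range ?g" and g = "\<lambda>m. (norm (?f m))\<^sup>2"]) auto
  note l2_of_has_sum[OF this]
  then show "l2_coeff (block i x) m = ?f m" "norm (block i x) = norm x"
    unfolding block_def by auto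
qed

lemma block_add: "block i (x + y) = block i x + block i y"
  by (rule l2_eqI) (simp add: l2_coeff_block)

lemma block_scaleC: "block i (c *\<^sub>C x) = c *\<^sub>C block i x"
  by (rule l2_eqI) (simp add: l2_coeff_block)

lemma block_zero: "block i 0 = 0"
  by (rule l2_eqI) (simp add: l2_coeff_block)

lemma block_orthogonal: "i \<noteq> j \<Longrightarrow> cinner (block i x) (block j y) = 0"
  unfolding cinner_l2sum_def by (intro infsum_0) (auto simp: l2_coeff_block)

text \<open>In the minimal unitary extension \<open>U\<close> of an isometry \<open>W\<close> with adjoint \<open>Q\<close>, the space
  \<open>U\<^sup>-\<^sup>k D\<close> splits into \<open>D\<close> and \<open>k\<close> copies of the range of \<open>1 - W Q\<close>, and \<open>backward W Q k d\<close>
  is \<open>U\<^sup>-\<^sup>k d\<close> in this decomposition.\<close>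

primrec backward :: "((nat, 'a::complex_inner) l2sum \<Rightarrow> (nat, 'a) l2sum) \<Rightarrow>
    ((nat, 'a) l2sum \<Rightarrow> (nat, 'a) l2sum) \<Rightarrow> nat \<Rightarrow> (nat, 'a) l2sum \<Rightarrow> (nat, 'a) l2sum" where
  "backward W Q 0 d = block 0 d"
| "backward W Q (Suc k) d = backward W Q k (Q d) + block (Suc k) (d - W (Q d))"

context
  fixes D :: "(nat, 'a::chilbert_space) l2sum set" and W Q
  assumes D: "closed_csubspace D" and W: "isometry_op D D W"
  defines "Q \<equiv> adjoint_op D W"
begin

lemma Q_works: "Q y \<in> D" "z \<in> D \<Longrightarrow> cinner (W z) y = cinner z (Q y)"
  unfolding Q_def using adjoint_op_works[OF D isometry_opD(1)[OF W]] by auto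

lemma Q_W: "d \<in> D \<Longrightarrow> Q (W d) = d"
  unfolding Q_def by (rule adjoint_op_eqI[OF D]) (auto simp: isometry_op_cinner[OF D W])

lemma Q_linear: "Q (x + y) = Q x + Q y" "Q (c *\<^sub>C x) = c *\<^sub>C Q x"
  unfolding Q_def by (rule adjoint_op_linear[OF D isometry_opD(1)[OF W]])+

text \<open>Because Q W = 1, the new block vanishes at \<open>W d\<close>. This consistency is what
  lets \<open>backward\<close> stand for inverse powers of an extension that is itself never
  defined.\<close>

lemma backward_W: "d \<in> D \<Longrightarrow> backward W Q (Suc k) (W d) = backward W Q k d"
  by (simp add: Q_W block_zero)

lemma backward_add:
  "d \<in> D \<Longrightarrow> e \<in> D \<Longrightarrow> backward W Q k (d + e) = backward W Q k d + backward W Q k e"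
proof (induction k arbitrary: d e)
  case (Suc k)
  have "d + e - W (Q d + Q e) = (d - W (Q d)) + (e - W (Q e))"
    using bounded_opD(2)[OF isometry_opD(1)[OF W] Q_works(1) Q_works(1), of d e] by simp
  then show ?case
    by (simp only: backward.simps Q_linear Suc.IH[OF Q_works(1) Q_works(1)] block_add) simp
qed (simp add: block_add)

lemma backward_scaleC: "d \<in> D \<Longrightarrow> backward W Q k (c *\<^sub>C d) = c *\<^sub>C backward W Q k d"
proof (induction k arbitrary: d)
  case (Suc k)
  have "c *\<^sub>C d - W (Q (c *\<^sub>C d)) = c *\<^sub>C (d - W (Q d))"
    using bounded_opD(3)[OF isometry_opD(1)[OF W] Q_works(1), of c d]
    by (simp add: Q_linear scaleC_diff_right)
  then show ?case using Suc.IH[OF Q_works(1), of d] by (simp add: Q_linear block_scaleC scaleC_add_right)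
qed (simp add: block_scaleC)

lemma backward_orthogonal: "k < m \<Longrightarrow> cinner (backward W Q k d) (block m y) = 0"
  by (induction k arbitrary: d) (auto simp: cinner_add_left block_orthogonal)

text \<open>Pythagoras for the splitting of d into \<open>W (Q d)\<close>, of norm
  \<open>norm (Q d)\<close>, and \<open>d - W (Q d)\<close>. The block added at each stage is
  orthogonal to the earlier ones.\<close>

lemma norm_backward: "d \<in> D \<Longrightarrow> norm (backward W Q k d) = norm d"
proof (induction k arbitrary: d)
  case (Suc k)
  have "cinner (W (Q d)) (d - W (Q d)) = 0"
    using Q_W[OF Q_works(1), of d]
    by (simp add: cinner_diff_right Q_works isometry_op_cinner[OF D W])
  then have "(norm (W (Q d) + (d - W (Q d))))\<^sup>2 = (norm (W (Q d)))\<^sup>2 + (norm (d - W (Q d)))\<^sup>2"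
    unfolding norm_add_sq by simp
  then have "(norm d)\<^sup>2 = (norm (Q d))\<^sup>2 + (norm (d - W (Q d)))\<^sup>2"
    using isometry_opD(2)[OF W Q_works(1), of d] by simp
  also have "\<dots> = (norm (backward W Q (Suc k) d))\<^sup>2"
    using Suc.IH[OF Q_works(1), of d] by (simp add: norm_add_sq backward_orthogonal norm_block)
  finally show ?case by simp
qed (simp add: norm_block)

end

section \<open>Quadratic forms\<close>

definition hermitian_form :: "('a::complex_inner \<Rightarrow> 'a \<Rightarrow> complex) \<Rightarrow> ('a \<Rightarrow> real) \<Rightarrow> bool" where
  "hermitian_form \<phi> f \<longleftrightarrow>
     (\<forall>x y z. \<phi> (x + y) z = \<phi> x z + \<phi> y z) \<and> (\<forall>c x z. \<phi> (c *\<^sub>C x) z = c * \<phi> x z) \<and>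
     (\<forall>x y. \<phi> x y = cnj (\<phi> y x)) \<and> (\<forall>x. \<phi> x x = complex_of_real (f x))"

text \<open>Only the diagonal f is carried along; the sesquilinear form is recovered by polarisation
  when needed. Positivity stays separate because differences of forms are taken.\<close>

definition quadratic_form :: "('a::complex_inner \<Rightarrow> real) \<Rightarrow> bool" where
  "quadratic_form f \<longleftrightarrow> (\<exists>\<phi>. hermitian_form \<phi> f)"

lemma hermitian_formD:
  assumes "hermitian_form \<phi> f"
  shows "\<phi> (x + y) z = \<phi> x z + \<phi> y z" "\<phi> (c *\<^sub>C x) z = c * \<phi> x z"
    "\<phi> x y = cnj (\<phi> y x)" "\<phi> x x = complex_of_real (f x)"
    "\<phi> z (x + y) = \<phi> z x + \<phi> z y" "\<phi> z (c *\<^sub>C x) = cnj c * \<phi> z x"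
proof -
  show 1: "\<phi> (x + y) z = \<phi> x z + \<phi> y z" "\<phi> (c *\<^sub>C x) z = c * \<phi> x z"
    "\<phi> x y = cnj (\<phi> y x)" "\<phi> x x = complex_of_real (f x)" for x y z c
    using assms unfolding hermitian_form_def by metis+
  show "\<phi> z (x + y) = \<phi> z x + \<phi> z y" "\<phi> z (c *\<^sub>C x) = cnj c * \<phi> z x"
    using 1(3)[of z "x + y"] 1(3)[of z x] 1(3)[of z y] 1(3)[of z "c *\<^sub>C x"] by (simp_all add: 1(1,2))
qed

lemma hermitian_form_expand:
  assumes "hermitian_form \<phi> f"
  shows "f (x + c *\<^sub>C y) = f x + 2 * Re (cnj c * \<phi> x y) + (cmod c)\<^sup>2 * f y"
proof -
  note D = hermitian_formD[OF assms]
  have "complex_of_real (f (x + c *\<^sub>C y)) = \<phi> (x + c *\<^sub>C y) (x + c *\<^sub>C y)" by (simp add: D(4))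
  also have "\<dots> = \<phi> x x + cnj c * \<phi> x y + (c * cnj (\<phi> x y) + c * cnj c * \<phi> y y)"
    using D(3)[of y x] by (simp add: D(1,2,5,6) distrib_left del: complex_cnj_cnj)
  also have "\<dots> = complex_of_real (f x) + cnj c * \<phi> x y + cnj (cnj c * \<phi> x y) + complex_of_real ((cmod c)\<^sup>2 * f y)"
    unfolding D(4) of_real_mult complex_norm_square by simp
  finally have "Re (complex_of_real (f (x + c *\<^sub>C y))) = Re (complex_of_real (f x) + cnj c * \<phi> x y
      + cnj (cnj c * \<phi> x y) + complex_of_real ((cmod c)\<^sup>2 * f y))" by (rule arg_cong)
  then show ?thesis by simp
qed

text \<open>The factor depends on \<open>cmod c\<close> alone: this is how the phases of q disappear
  from every form.\<close>

lemma quadratic_form_scaleC: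
  assumes "quadratic_form f"
  shows "f (c *\<^sub>C x) = (cmod c)\<^sup>2 * f x"
proof -
  obtain \<phi> where "hermitian_form \<phi> f" using assms unfolding quadratic_form_def by blast
  note D = hermitian_formD[OF this]
  have "complex_of_real (f (c *\<^sub>C x)) = (c * cnj c) * complex_of_real (f x)"
    unfolding D(4)[symmetric] D(2) D(6) by simp
  also have "\<dots> = complex_of_real ((cmod c)\<^sup>2 * f x)" unfolding of_real_mult complex_norm_square ..
  finally show ?thesis unfolding of_real_eq_iff .
qed

lemma quadratic_form_norm: "quadratic_form (\<lambda>h. (norm h)\<^sup>2)"
  unfolding quadratic_form_def hermitian_form_def
  by (intro exI[of _ cinner] conjI allI cinner_add_left cinner_scaleC_left cinner_same cinner_commute)

lemma quadratic_form_diff: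
  assumes "quadratic_form f" "quadratic_form g"
  shows "quadratic_form (\<lambda>h. f h - g h)"
proof -
  obtain \<phi> \<psi> where "hermitian_form \<phi> f" "hermitian_form \<psi> g"
    using assms unfolding quadratic_form_def by blast
  note D = hermitian_formD[OF this(1)] hermitian_formD[OF this(2)]
  have "hermitian_form (\<lambda>x y. \<phi> x y - \<psi> x y) (\<lambda>h. f h - g h)"
    unfolding hermitian_form_def complex_cnj_diff D(3)[symmetric] D(9)[symmetric]
    by (simp add: D(1,2,4,7,8,10) algebra_simps)
  then show ?thesis unfolding quadratic_form_def by blast
qed

lemma quadratic_form_comp:
  assumes "quadratic_form f" "bounded_op UNIV UNIV B"
  shows "quadratic_form (\<lambda>h. f (B h))"
proof -
  obtain \<phi> where "hermitian_form \<phi> f"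
    using assms unfolding quadratic_form_def by blast
  note D = hermitian_formD[OF this]
  have "hermitian_form (\<lambda>x y. \<phi> (B x) (B y)) (\<lambda>h. f (B h))"
    unfolding hermitian_form_def D(3)[symmetric]
    by (simp add: D(1,2,4) bounded_opD(2,3)[OF assms(2)])
  then show ?thesis unfolding quadratic_form_def by blast
qed

text \<open>Polarisation expresses a sesquilinear form by finitely many diagonal values, so
  convergence of the diagonals forces convergence of the forms, and each axiom of
  \<open>hermitian_form\<close> survives pointwise limits.\<close>

lemma quadratic_form_limit:
  assumes F: "\<And>k. quadratic_form (F k)" and lim: "\<And>h. (\<lambda>k. F k h) \<longlonglongrightarrow> f h"
  shows "quadratic_form f"
proof -
  have "\<forall>k. \<exists>\<phi>. hermitian_form \<phi> (F k)" using F unfolding quadratic_form_def by simp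
  from choice[OF this] obtain \<Phi> where \<Phi>: "\<And>k. hermitian_form (\<Phi> k) (F k)" by auto
  note D = hermitian_formD[OF \<Phi>]
  \<comment> \<open>The cross term at x + c y is 2 Re (cnj c * phi x y): c = 1 gives the real part
    and c = i the imaginary part. The factor \<open>1 *\<^sub>C\<close> matches the shape of
    \<open>hermitian_form_expand\<close>.\<close>
  define polar where "polar g x y = Complex ((g (x + 1 *\<^sub>C y) - g x - g y) / 2) ((g (x + \<i> *\<^sub>C y) - g x - g y) / 2)"
    for g :: "'a \<Rightarrow> real" and x y
  have "\<Phi> k x y = polar (F k) x y" for k x y
    unfolding polar_def by (rule complex_eqI) (simp_all only: hermitian_form_expand[OF \<Phi>], simp_all)
  moreover have "(\<lambda>k. polar (F k) x y) \<longlonglongrightarrow> polar f x y" for x y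
    unfolding polar_def by (intro tendsto_intros lim) auto
  ultimately have P: "(\<lambda>k. \<Phi> k x y) \<longlonglongrightarrow> polar f x y" for x y by simp
  have "hermitian_form (polar f) f"
    unfolding hermitian_form_def
  proof (intro conjI allI)
    fix x y z c
    have "(\<lambda>k. \<Phi> k (x + y) z) \<longlonglongrightarrow> polar f x z + polar f y z"
      unfolding D(1) by (intro tendsto_intros P)
    then show "polar f (x + y) z = polar f x z + polar f y z" by (rule LIMSEQ_unique[OF P])
    have "(\<lambda>k. \<Phi> k (c *\<^sub>C x) z) \<longlonglongrightarrow> c * polar f x z"
      unfolding D(2) by (intro tendsto_intros P)
    then show "polar f (c *\<^sub>C x) z = c * polar f x z" by (rule LIMSEQ_unique[OF P])
    have "(\<lambda>k. cnj (\<Phi> k y x)) \<longlonglongrightarrow> cnj (polar f y x)" by (intro tendsto_intros P)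
    then have "(\<lambda>k. \<Phi> k x y) \<longlonglongrightarrow> cnj (polar f y x)" unfolding D(3)[symmetric] .
    then show "polar f x y = cnj (polar f y x)" by (rule LIMSEQ_unique[OF P])
    have "(\<lambda>k. \<Phi> k x x) \<longlonglongrightarrow> complex_of_real (f x)"
      unfolding D(4) by (intro tendsto_intros lim)
    then show "polar f x x = complex_of_real (f x)" by (rule LIMSEQ_unique[OF P])
  qed
  then show ?thesis unfolding quadratic_form_def by blast
qed

text \<open>This replaces the square root: the operators \<open>A\<^sub>0 = A\<close>, \<open>A\<^sub>k\<^sub>+\<^sub>1 = A\<^sub>k - A\<^sub>k\<^sup>2\<close> satisfy
  \<open>A = (\<Sum>k. A\<^sub>k\<^sup>2)\<close>, so \<open>h \<mapsto> (A\<^sub>k h)\<^sub>k\<close> realises the form of \<open>A\<close>.\<close>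

lemma quadratic_form_factorization:
  fixes f :: "'a::chilbert_space \<Rightarrow> real"
  assumes f: "quadratic_form f" and nonneg: "\<And>h. 0 \<le> f h" and le: "\<And>h. f h \<le> (norm h)\<^sup>2"
  shows "\<exists>S :: 'a \<Rightarrow> (nat, 'a) l2sum. bounded_op UNIV UNIV S \<and> (\<forall>h. (norm (S h))\<^sup>2 = f h)"
proof -
  obtain \<phi> where \<phi>: "hermitian_form \<phi> f" using f unfolding quadratic_form_def by blast
  note D = hermitian_formD[OF \<phi>]
  have bound: "2 * cmod (\<phi> x y) \<le> (norm x)\<^sup>2 + (norm y)\<^sup>2" for x y
  proof -
    \<comment> \<open>This c turns the cross term into its most negative value; positivity at x + c
      y then bounds it.\<close>
    define c where "c = - sgn (\<phi> x y)"
    have c: "cnj c * \<phi> x y = - complex_of_real (cmod (\<phi> x y))"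
    proof -
      have "cnj c * \<phi> x y = - ((\<phi> x y * cnj (\<phi> x y)) / complex_of_real (cmod (\<phi> x y)))"
        by (simp add: c_def sgn_eq)
      also have "\<dots> = - complex_of_real (cmod (\<phi> x y))"
        unfolding complex_norm_square[symmetric] by (simp add: power2_eq_square)
      finally show ?thesis .
    qed
    have "cmod c \<le> 1" by (simp add: c_def norm_sgn)
    then have "(cmod c)\<^sup>2 * f y \<le> f y" using nonneg by (simp add: mult_left_le_one_le power_le_one)
    moreover have "0 \<le> f x - 2 * cmod (\<phi> x y) + (cmod c)\<^sup>2 * f y"
      using nonneg[of "x + c *\<^sub>C y"] unfolding hermitian_form_expand[OF \<phi>] c by simp
    ultimately show ?thesis using le[of x] le[of y] by linarith
  qed
  have "\<exists>z. \<forall>x. \<phi> x y = cinner x z" for y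
  proof -
    \<comment> \<open>Obtained by normalising x. The constant depends on y, which suffices since
      Riesz is applied to one y at a time.\<close>
    have "cmod (\<phi> x y) \<le> (1 + (norm y)\<^sup>2) / 2 * norm x" for x
    proof (cases "x = 0")
      case True
      then show ?thesis using D(2)[of 0 0 y] by simp
    next
      case False
      have "2 * cmod (\<phi> (complex_of_real (inverse (norm x)) *\<^sub>C x) y) \<le> 1 + (norm y)\<^sup>2"
        using bound[of "complex_of_real (inverse (norm x)) *\<^sub>C x" y] False
        by (simp add: norm_scaleC norm_inverse)
      then show ?thesis using False by (simp add: D(2) norm_mult norm_inverse norm_divide field_simps)
    qed
    then have "\<exists>z\<in>UNIV. \<forall>x\<in>UNIV. \<phi> x y = cinner x z"
      by (intro riesz_representation[OF closed_csubspace_UNIV, where K = "(1 + (norm y)\<^sup>2) / 2"])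
        (simp_all add: D(1,2))
    then show ?thesis by simp
  qed
  then have "\<forall>y. \<exists>z. \<forall>x. \<phi> x y = cinner x z" ..
  from choice[OF this] obtain A where A: "\<And>x y. \<phi> x y = cinner x (A y)" by auto
  \<comment> \<open>In operator terms: X is linear and self-adjoint with 0 \<le> X \<le> 1.\<close>
  define good :: "('a \<Rightarrow> 'a) \<Rightarrow> bool" where "good X \<longleftrightarrow>
      (\<forall>x y. X (x + y) = X x + X y) \<and> (\<forall>c x. X (c *\<^sub>C x) = c *\<^sub>C X x) \<and>
      (\<forall>x y. cinner (X x) y = cinner x (X y)) \<and>
      (\<forall>x. 0 \<le> Re (cinner x (X x))) \<and> (\<forall>x. Re (cinner x (X x)) \<le> (norm x)\<^sup>2)" for X
  have eqI: "a = b" if "\<And>x. cinner x a = cinner x b" for a b :: 'a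
    using that[of "a - b"] cinner_same[of "a - b"] by (simp add: cinner_diff_right)
  have goodA: "good A"
    unfolding good_def
  proof (intro conjI allI)
    fix x y c
    show "A (x + y) = A x + A y" by (rule eqI) (simp add: cinner_add_right D(5) flip: A)
    show "A (c *\<^sub>C x) = c *\<^sub>C A x" by (rule eqI) (simp add: cinner_scaleC_right D(6) flip: A)
    show "cinner (A x) y = cinner x (A y)"
      using D(3)[of x y] cinner_commute[of "A x" y] by (simp flip: A)
    show "0 \<le> Re (cinner x (A x))" "Re (cinner x (A x)) \<le> (norm x)\<^sup>2"
      using nonneg le by (simp_all add: D(4) flip: A)
  qed
  \<comment> \<open>X - X^2 is the sum of X (1 - X)^2, nonnegative by testing X at x - X x, and of X
    (1 - X) X, nonnegative because X \<le> 1.\<close>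
  have good_sq: "(norm (X x))\<^sup>2 \<le> Re (cinner x (X x))" if "good X" for X x
  proof -
    have X: "\<And>x y. X (x + y) = X x + X y" "\<And>c x. X (c *\<^sub>C x) = c *\<^sub>C X x"
      "\<And>x y. cinner (X x) y = cinner x (X y)" "\<And>x. 0 \<le> Re (cinner x (X x))"
      "\<And>x. Re (cinner x (X x)) \<le> (norm x)\<^sup>2"
      using that unfolding good_def by auto
    have Xd: "X (a - b) = X a - X b" for a b using X(1)[of "a - b" b] by simp
    have "Re (cinner (x - X x) (X (x - X x)))
        = Re (cinner x (X x)) - 2 * (norm (X x))\<^sup>2 + Re (cinner (X x) (X (X x)))"
      unfolding Xd cinner_diff_left cinner_diff_right
      by (simp add: X(3)[symmetric] cinner_same)
    then show ?thesis using X(4)[of "x - X x"] X(5)[of "X x"] by linarith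
  qed
  have good_step: "good (\<lambda>x. X x - X (X x))" if "good X" for X
  proof -
    have X: "\<And>x y. X (x + y) = X x + X y" "\<And>c x. X (c *\<^sub>C x) = c *\<^sub>C X x"
      "\<And>x y. cinner (X x) y = cinner x (X y)" "\<And>x. 0 \<le> Re (cinner x (X x))"
      "\<And>x. Re (cinner x (X x)) \<le> (norm x)\<^sup>2"
      using that unfolding good_def by auto
    have "Re (cinner x (X x - X (X x))) = Re (cinner x (X x)) - (norm (X x))\<^sup>2" for x
      by (simp add: cinner_diff_right X(3)[symmetric] cinner_same)
    then show ?thesis unfolding good_def using good_sq[OF that] X(5)
      by (auto simp: X(1,2) scaleC_diff_right cinner_diff_left cinner_diff_right X(3))
        (smt (verit) zero_le_power2)
  qed
  define As where "As k = ((\<lambda>X x. X x - X (X x)) ^^ k) A" for k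
  have As_0: "As 0 = A" and As_Suc: "As (Suc k) x = As k x - As k (As k x)" for k x
    by (simp_all add: As_def)
  have good: "good (As k)" for k
  proof (induction k)
    case (Suc k)
    then show ?case using good_step[OF Suc] by (simp add: As_def)
  qed (simp add: As_0 goodA)
  have tel: "(\<Sum>k<N. (norm (As k x))\<^sup>2) = f x - Re (cinner x (As N x))" for N x
  proof (induction N)
    case 0
    show ?case by (simp add: As_0 D(4) flip: A)
  next
    case (Suc N)
    have "cinner x (As N (As N x)) = complex_of_real ((norm (As N x))\<^sup>2)"
      using good[of N] unfolding good_def by (metis cinner_same)
    then show ?case using Suc by (simp add: As_Suc cinner_diff_right)
  qed
  \<comment> \<open>The partial sums are at most \<open>f x\<close>, so the squares are summable.
    Hence \<open>As k x\<close> tends to 0, and with it the remainder of the telescoping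
    sum.\<close>
  have hs: "((\<lambda>k. (norm (As k x))\<^sup>2) has_sum f x) UNIV" for x
  proof -
    have "summable (\<lambda>k. (norm (As k x))\<^sup>2)"
      by (rule summableI_nonneg_bounded[where x = "f x"]) (use good in \<open>auto simp: tel good_def\<close>)
    then have "(\<lambda>k. (norm (As k x))\<^sup>2) \<longlonglongrightarrow> 0" by (rule summable_LIMSEQ_zero)
    then have "(\<lambda>k. sqrt ((norm (As k x))\<^sup>2)) \<longlonglongrightarrow> sqrt 0" by (rule tendsto_real_sqrt)
    then have 0: "(\<lambda>k. norm (As k x)) \<longlonglongrightarrow> 0" by simp
    have "(\<lambda>k. Re (cinner x (As k x))) \<longlonglongrightarrow> 0"
    proof (rule Lim_null_comparison)
      have "\<bar>Re (cinner x (As k x))\<bar> \<le> norm x * norm (As k x)" for k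
        using abs_Re_le_cmod cinner_norm_le by (rule order_trans)
      then show "\<forall>\<^sub>F k in sequentially. norm (Re (cinner x (As k x))) \<le> norm x * norm (As k x)" by simp
      show "(\<lambda>k. norm x * norm (As k x)) \<longlonglongrightarrow> 0" using tendsto_mult_right_zero[OF 0] by simp
    qed
    then have "(\<lambda>N. f x - Re (cinner x (As N x))) \<longlonglongrightarrow> f x - 0" by (intro tendsto_intros)
    then have "(\<lambda>k. (norm (As k x))\<^sup>2) sums f x" unfolding sums_def tel by simp
    then show ?thesis by (intro norm_summable_imp_has_sum) (auto simp: sums_iff)
  qed
  note S = l2_of_has_sum[OF hs]
  have "bounded_op UNIV UNIV (\<lambda>x. l2_of (\<lambda>k. As k x))"
    unfolding bounded_op_def
  proof (intro conjI ballI allI exI)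
    fix x y :: 'a and c
    show "l2_of (\<lambda>k. As k (x + y)) = l2_of (\<lambda>k. As k x) + l2_of (\<lambda>k. As k y)"
      by (rule l2_eqI, simp only: l2_coeff_simps l2_coeff_scaleC S(1))
        (use good in \<open>auto simp: good_def\<close>)
    show "l2_of (\<lambda>k. As k (c *\<^sub>C x)) = c *\<^sub>C l2_of (\<lambda>k. As k x)"
      by (rule l2_eqI, simp only: l2_coeff_simps l2_coeff_scaleC S(1))
        (use good in \<open>auto simp: good_def\<close>)
    show "norm (l2_of (\<lambda>k. As k x)) \<le> 1 * norm x"
      using le[of x] S(2)[of x] by (simp add: power2_le_imp_le)
  qed simp
  then show ?thesis using S(2) by blast
qed

section \<open>Decomposition of the norm for a q-commuting tuple\<close>

locale q_tuple =
  fixes n :: nat and q :: "nat \<Rightarrow> nat \<Rightarrow> complex" and B :: "nat \<Rightarrow> 'a::chilbert_space \<Rightarrow> 'a"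
  assumes q: "is_q n q"
    and bounded_B: "i \<in> {1..n} \<Longrightarrow> bounded_op UNIV UNIV (B i)"
    and B_commute: "i \<in> {1..n} \<Longrightarrow> j \<in> {1..n} \<Longrightarrow> B i (B j x) = q i j *\<^sub>C B j (B i x)"
begin

lemma norm_q: "i \<in> {1..n} \<Longrightarrow> j \<in> {1..n} \<Longrightarrow> cmod (q i j) = 1"
  using q unfolding is_q_def by blast

lemma norm_q_prod: "m \<le> n \<Longrightarrow> j \<in> {1..n} \<Longrightarrow> cmod (\<Prod>t\<in>{1..m}. q t j ^ k t) = 1"
  by (simp add: norm_power norm_q flip: prod_norm)

lemma B_add: "i \<in> {1..n} \<Longrightarrow> B i (x + y) = B i x + B i y"
  and B_scaleC: "i \<in> {1..n} \<Longrightarrow> B i (c *\<^sub>C x) = c *\<^sub>C B i x"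
  using bounded_opD(2,3)[OF bounded_B] by auto

lemma B_power_add: "i \<in> {1..n} \<Longrightarrow> (B i ^^ a) (x + y) = (B i ^^ a) x + (B i ^^ a) y"
  by (induction a) (simp_all add: B_add)

lemma B_power_scaleC: "i \<in> {1..n} \<Longrightarrow> (B i ^^ a) (c *\<^sub>C x) = c *\<^sub>C (B i ^^ a) x"
  by (induction a) (simp_all add: B_scaleC)

lemma B_power_commute:
  "i \<in> {1..n} \<Longrightarrow> j \<in> {1..n} \<Longrightarrow> (B i ^^ a) (B j x) = q i j ^ a *\<^sub>C B j ((B i ^^ a) x)"
proof (induction a)
  case (Suc a)
  then show ?case
    by (simp add: B_scaleC B_commute[of i j "(B i ^^ a) x"] scaleC_scaleC mult.commute)
qed simp

primrec bpow :: "nat \<Rightarrow> (nat \<Rightarrow> nat) \<Rightarrow> 'a \<Rightarrow> 'a" where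
  "bpow 0 k h = h"
| "bpow (Suc m) k h = (B (Suc m) ^^ k (Suc m)) (bpow m k h)"

lemma bpow_cong: "(\<And>t. t \<in> {1..m} \<Longrightarrow> k t = k' t) \<Longrightarrow> bpow m k h = bpow m k' h"
  by (induction m) simp_all

lemma bpow_add: "m \<le> n \<Longrightarrow> bpow m k (x + y) = bpow m k x + bpow m k y"
  by (induction m) (simp_all add: B_power_add)

lemma bpow_scaleC: "m \<le> n \<Longrightarrow> bpow m k (c *\<^sub>C x) = c *\<^sub>C bpow m k x"
  by (induction m) (simp_all add: B_power_scaleC)

lemma bpow_B_commute:
  "m \<le> n \<Longrightarrow> j \<in> {1..n} \<Longrightarrow> bpow m k (B j h) = (\<Prod>t\<in>{1..m}. q t j ^ k t) *\<^sub>C B j (bpow m k h)"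
  by (induction m) (simp_all add: B_power_scaleC B_power_commute scaleC_scaleC)

text \<open>\<open>B i\<close> enters at the inner end, so it passes only the powers with index
  below i before joining the power of \<open>B i\<close>; in \<open>bpow_B_commute\<close> it passes
  all of them.\<close>

lemma bpow_B_absorb:
  assumes "m \<le> n" "i \<in> {1..m}"
  shows "bpow m k (B i h) = (\<Prod>t\<in>{1..<i}. q t i ^ k t) *\<^sub>C bpow m (k(i := Suc (k i))) h"
  using assms
proof (induction m)
  case (Suc m)
  show ?case
  proof (cases "i = Suc m")
    case True
    have "bpow m (k(i := Suc (k i))) h = bpow m k h" by (rule bpow_cong) (simp add: True)
    moreover have "{1..<i} = {1..m}" using True by auto
    ultimately show ?thesis
      using Suc.prems bpow_B_commute[of m i k h] unfolding True
      by (simp add: B_power_scaleC funpow_swap1 fun_upd_same del: fun_upd_apply)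
  next
    case False
    then show ?thesis using Suc by (simp add: B_power_scaleC)
  qed
qed simp

section \<open>Defects and stable parts of forms\<close>

definition defect :: "nat \<Rightarrow> ('a \<Rightarrow> real) \<Rightarrow> 'a \<Rightarrow> real" where
  "defect i f h = f h - f (B i h)"

definition stable_part :: "nat \<Rightarrow> ('a \<Rightarrow> real) \<Rightarrow> 'a \<Rightarrow> real" where
  "stable_part i f h = lim (\<lambda>k. f ((B i ^^ k) h))"

text \<open>The two conjuncts skip or apply the defect of i, so this unfolds to nonnegativity after
  the defects along every subsequence of the list. In this shape Brehmer positivity can be consumed
  one index at a time.\<close>

primrec pos :: "nat list \<Rightarrow> ('a \<Rightarrow> real) \<Rightarrow> bool" where
  "pos [] f \<longleftrightarrow> (\<forall>h. 0 \<le> f h)"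
| "pos (i # is) f \<longleftrightarrow> pos is f \<and> pos is (defect i f)"

lemma pos_nonneg: "pos is f \<Longrightarrow> 0 \<le> f h"
  by (induction "is" arbitrary: f) auto

lemma quadratic_form_swap:
  assumes "quadratic_form f" "i \<in> {1..n}" "j \<in> {1..n}"
  shows "f ((B i ^^ a) (B j h)) = f (B j ((B i ^^ a) h))"
  unfolding B_power_commute[OF assms(2,3)] quadratic_form_scaleC[OF assms(1)]
  using assms(2,3) by (simp add: norm_power norm_q)

lemma quadratic_form_defect: "quadratic_form f \<Longrightarrow> i \<in> {1..n} \<Longrightarrow> quadratic_form (defect i f)"
  unfolding defect_def[abs_def]
  using quadratic_form_diff[OF _ quadratic_form_comp[OF _ bounded_B], of f f i] by blast

lemma defect_commute:
  assumes "quadratic_form f" "i \<in> {1..n}" "j \<in> {1..n}"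
  shows "defect i (defect j f) = defect j (defect i f)"
proof
  show "defect i (defect j f) h = defect j (defect i f) h" for h
    using quadratic_form_swap[OF assms, of 1 h] by (simp add: defect_def)
qed

text \<open>A nonnegative defect makes the sequence decreasing, and nonnegativity of f bounds it
  below, so the \<open>lim\<close> in \<open>stable_part\<close> is a genuine limit.\<close>

lemma stable_part_tendsto:
  assumes "\<And>h. 0 \<le> f h" "\<And>h. 0 \<le> defect i f h"
  shows "(\<lambda>k. f ((B i ^^ k) h)) \<longlonglongrightarrow> stable_part i f h"
proof -
  have "decseq (\<lambda>k. f ((B i ^^ k) h))"
    using assms(2) by (intro decseq_SucI) (simp add: defect_def)
  then obtain l where "(\<lambda>k. f ((B i ^^ k) h)) \<longlonglongrightarrow> l"
    using decseq_convergent[of "\<lambda>k. f ((B i ^^ k) h)" 0] assms(1) by metis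
  then have "convergent (\<lambda>k. f ((B i ^^ k) h))" by (rule convergentI)
  then show ?thesis unfolding stable_part_def convergent_LIMSEQ_iff .
qed

lemma quadratic_form_stable_part:
  assumes "quadratic_form f" "i \<in> {1..n}" "\<And>h. 0 \<le> f h" "\<And>h. 0 \<le> defect i f h"
  shows "quadratic_form (stable_part i f)"
proof (rule quadratic_form_limit)
  show "(\<lambda>k. f ((B i ^^ k) h)) \<longlonglongrightarrow> stable_part i f h" for h by (rule stable_part_tendsto[OF assms(3,4)])
  show "quadratic_form (\<lambda>h. f ((B i ^^ k) h))" for k
  proof (induction k)
    case (Suc k)
    from quadratic_form_comp[OF Suc bounded_B[OF assms(2)]] show ?case by (simp add: funpow_swap1)
  qed (simp add: assms(1))
qed

lemma stable_part_le:
  assumes "\<And>h. 0 \<le> f h" "\<And>h. 0 \<le> defect i f h"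
  shows "stable_part i f h \<le> f h" "0 \<le> stable_part i f h"
proof -
  have "decseq (\<lambda>k. f ((B i ^^ k) h))"
    using assms(2) by (intro decseq_SucI) (simp add: defect_def)
  from decseq_ge[OF this stable_part_tendsto[OF assms], of 0] show "stable_part i f h \<le> f h" by simp
  show "0 \<le> stable_part i f h"
    by (rule LIMSEQ_le_const[OF stable_part_tendsto[OF assms]]) (simp add: assms(1))
qed

lemma stable_part_B:
  assumes "\<And>h. 0 \<le> f h" "\<And>h. 0 \<le> defect i f h"
  shows "stable_part i f (B i h) = stable_part i f h"
proof (rule LIMSEQ_unique[OF stable_part_tendsto[OF assms]])
  show "(\<lambda>k. f ((B i ^^ k) (B i h))) \<longlonglongrightarrow> stable_part i f h"
    using LIMSEQ_Suc[OF stable_part_tendsto[OF assms, of h]] by (simp add: funpow_swap1)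
qed

lemma defect_stable_part:
  assumes "quadratic_form f" "i \<in> {1..n}" "j \<in> {1..n}"
    and "\<And>h. 0 \<le> f h" "\<And>h. 0 \<le> defect i f h"
  shows "defect j (stable_part i f) = stable_part i (defect j f)"
proof
  fix h
  have "(\<lambda>k. f ((B i ^^ k) h) - f ((B i ^^ k) (B j h))) \<longlonglongrightarrow> stable_part i f h - stable_part i f (B j h)"
    by (intro tendsto_diff stable_part_tendsto assms)
  then show "defect j (stable_part i f) h = stable_part i (defect j f) h"
    unfolding quadratic_form_swap[OF assms(1-3)] stable_part_def[of i "defect j f"] defect_def
    by (rule limI[symmetric])
qed

text \<open>Defects of later indices commute with \<open>stable_part i\<close>, and limits of
  nonnegative numbers are nonnegative. The form f is generalised because the recursion also visits
  \<open>defect j f\<close>.\<close>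

lemma pos_stable_part:
  assumes "quadratic_form f" "i \<in> {1..n}" "set is \<subseteq> {1..n}" "pos (i # is) f"
  shows "pos is (stable_part i f)"
  using assms
proof (induction "is" arbitrary: f)
  case Nil
  then show ?case using stable_part_le(2)[of f i] by simp
next
  case (Cons j "is")
  have j: "j \<in> {1..n}" using Cons.prems by simp
  have f: "0 \<le> f h" "0 \<le> defect i f h" for h
    using Cons.prems(4) pos_nonneg[of "j # is" f h] pos_nonneg[of "j # is" "defect i f" h] by simp_all
  have "pos is (stable_part i f)" by (rule Cons.IH) (use Cons.prems in auto)
  moreover have "pos is (stable_part i (defect j f))"
  proof (rule Cons.IH)
    show "quadratic_form (defect j f)" using quadratic_form_defect Cons.prems(1) j .
    show "pos (i # is) (defect j f)"
      using Cons.prems by (simp add: defect_commute[OF Cons.prems(1,2) j])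
  qed (use Cons.prems in auto)
  ultimately show ?case using defect_stable_part[OF Cons.prems(1,2) j f] by simp
qed

primrec Delta :: "nat set \<Rightarrow> nat \<Rightarrow> 'a \<Rightarrow> real" where
  "Delta G 0 = (\<lambda>h. (norm h)\<^sup>2)"
| "Delta G (Suc m) = (if Suc m \<in> G then defect (Suc m) (Delta G m) else stable_part (Suc m) (Delta G m))"

lemma Delta_cong: "(\<And>t. t \<in> {1..m} \<Longrightarrow> t \<in> G \<longleftrightarrow> t \<in> G') \<Longrightarrow> Delta G m = Delta G' m"
  by (induction m) simp_all

end

locale brehmer_tuple = q_tuple +
  assumes pos_norm: "pos [1..<Suc n] (\<lambda>h. (norm h)\<^sup>2)"
begin

text \<open>Stage m consumes the indices 1 to m. The positivity kept for the remaining ones is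
  exactly what makes the next stable part converge.\<close>

lemma Delta_invariant:
  "m \<le> n \<Longrightarrow> quadratic_form (Delta G m) \<and> pos [Suc m..<Suc n] (Delta G m)"
proof (induction m)
  case 0
  then show ?case using pos_norm quadratic_form_norm by simp
next
  case (Suc m)
  then have IH: "quadratic_form (Delta G m)" "pos (Suc m # [Suc (Suc m)..<Suc n]) (Delta G m)"
    by (simp_all only: upt_conv_Cons[of "Suc m" "Suc n"] Suc_le_lessD less_Suc_eq_le Suc_leD)
  have m: "Suc m \<in> {1..n}" "set [Suc (Suc m)..<Suc n] \<subseteq> {1..n}" using Suc.prems by auto
  have f: "0 \<le> Delta G m h" "0 \<le> defect (Suc m) (Delta G m) h" for h
    using IH(2) pos_nonneg[of _ "Delta G m" h] pos_nonneg[of _ "defect (Suc m) (Delta G m)" h]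
    unfolding pos.simps by metis+
  show ?case
    using quadratic_form_defect[OF IH(1) m(1)] quadratic_form_stable_part[OF IH(1) m(1) f]
      pos_stable_part[OF IH(1) m IH(2)] IH(2) by (simp del: upt_Suc)
qed

lemma quadratic_form_Delta: "m \<le> n \<Longrightarrow> quadratic_form (Delta G m)"
  using Delta_invariant by blast

lemma Delta_nonneg: "m \<le> n \<Longrightarrow> 0 \<le> Delta G m h"
  using Delta_invariant pos_nonneg by blast

lemma defect_Delta_nonneg: "Suc m \<le> n \<Longrightarrow> 0 \<le> defect (Suc m) (Delta G m) h"
  using Delta_invariant[of m G] pos_nonneg[of "[Suc (Suc m)..<Suc n]" "defect (Suc m) (Delta G m)" h]
  by (simp add: upt_conv_Cons[of "Suc m" "Suc n"] del: upt_Suc)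

text \<open>Provides the upper bound that \<open>quadratic_form_factorization\<close>
  requires.\<close>

lemma Delta_le: "m \<le> n \<Longrightarrow> Delta G m h \<le> (norm h)\<^sup>2"
proof (induction m)
  case (Suc m)
  have "Delta G (Suc m) h \<le> Delta G m h"
    using stable_part_le(1)[OF Delta_nonneg defect_Delta_nonneg, of m G h] Delta_nonneg[of m G "B (Suc m) h"]
      Suc.prems by (auto simp: defect_def)
  then show ?case using Suc by simp
qed simp

text \<open>Invariance arises at stage j, where the limit along the powers of \<open>B j\<close> is
  taken. It survives the later stages because \<open>B j\<close> passes their operators up to a
  phase.\<close>

lemma Delta_B:
  assumes "m \<le> n" "j \<in> {1..m}" "j \<notin> G"
  shows "Delta G m (B j h) = Delta G m h"
  using assms
proof (induction m arbitrary: h)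
  case (Suc m)
  note f = Delta_nonneg[of m G] defect_Delta_nonneg[of m G]
  show ?case
  proof (cases "j = Suc m")
    case True
    then show ?thesis using Suc.prems stable_part_B[OF f] by simp
  next
    case False
    then have j: "j \<in> {1..m}" "j \<in> {1..n}" using Suc.prems by auto
    have IH: "Delta G m (B j h) = Delta G m h" for h using Suc j by simp
    have "Delta G m ((B (Suc m) ^^ k) (B j h)) = Delta G m ((B (Suc m) ^^ k) h)" for k
      using quadratic_form_swap[OF quadratic_form_Delta _ j(2), of m "Suc m" G k h] Suc.prems IH by simp
    from this this[of 1] show ?thesis by (simp add: defect_def stable_part_def IH)
  qed
qed simp

section \<open>Expansion of the squared norm\<close>

definition exponents :: "nat set \<Rightarrow> (nat \<Rightarrow> nat) set" where
  "exponents G = {k. \<forall>i. i \<notin> G \<longrightarrow> k i = 0}"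

text \<open>Telescoping along the powers of \<open>B (Suc m)\<close>: \<open>Some l\<close> carries
  the l-th defect and \<open>None\<close> the limit that remains. Indexing by options makes this a
  single sum, ready for reindexing.\<close>

lemma Delta_split:
  assumes "Suc m \<le> n" "G \<subseteq> {1..m}"
  shows "((\<lambda>l. case l of None \<Rightarrow> Delta G (Suc m) x
      | Some l \<Rightarrow> Delta (insert (Suc m) G) (Suc m) ((B (Suc m) ^^ l) x)) has_sum Delta G m x) UNIV"
    (is "(?F has_sum _) _")
proof -
  have [simp]: "Suc m \<notin> G" using assms by auto
  have [simp]: "Delta (insert (Suc m) G) m = Delta G m" by (rule Delta_cong) auto
  note f = Delta_nonneg[of m G] defect_Delta_nonneg[of m G]
  have "(\<lambda>l. Delta G m ((B (Suc m) ^^ l) x)) \<longlonglongrightarrow> stable_part (Suc m) (Delta G m) x"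
    using assms(1) by (intro stable_part_tendsto f) auto
  from telescope_sums'[OF this]
  have "(\<lambda>l. defect (Suc m) (Delta G m) ((B (Suc m) ^^ l) x)) sums
      (Delta G m x - stable_part (Suc m) (Delta G m) x)" by (simp add: defect_def)
  then have "((\<lambda>l. defect (Suc m) (Delta G m) ((B (Suc m) ^^ l) x)) has_sum
      (Delta G m x - stable_part (Suc m) (Delta G m) x)) UNIV"
    by (rule sums_nonneg_imp_has_sum) (use assms f in auto)
  then have "(?F has_sum (Delta G m x - stable_part (Suc m) (Delta G m) x)) (range Some)"
    by (subst has_sum_reindex) (simp_all add: comp_def)
  moreover have "(?F has_sum ?F None) {None}" by (rule has_sum_finiteI) simp_all
  ultimately have "(?F has_sum (Delta G m x - stable_part (Suc m) (Delta G m) x + ?F None)) (range Some \<union> {None})"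
    by (rule has_sum_Un_disjoint) auto
  moreover have "range Some \<union> {None} = (UNIV :: nat option set)"
    using UNIV_option_conv by auto
  ultimately show ?thesis by simp
qed

lemma norm_decomposition:
  assumes "m \<le> n"
  shows "((\<lambda>(G, k). Delta G m (bpow m k h)) has_sum (norm h)\<^sup>2) (Sigma (Pow {1..m}) exponents)"
  using assms
proof (induction m)
  case 0
  have "Sigma (Pow {1..0}) exponents = {({}, \<lambda>_. 0)}" by (auto simp: exponents_def)
  then show ?case using has_sum_finite[of "{({}, \<lambda>_. 0)}" "\<lambda>(G, k). Delta G 0 (bpow 0 k h)"]
    by (simp add: split_def)
next
  case (Suc m)
  let ?I = "Sigma (Pow {1..m}) exponents" and ?I' = "Sigma (Pow {1..Suc m}) exponents"
  define F where "F = (\<lambda>((G, k), l). case l of None \<Rightarrow> Delta G (Suc m) (bpow m k h)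
      | Some l \<Rightarrow> Delta (insert (Suc m) G) (Suc m) ((B (Suc m) ^^ l) (bpow m k h)))"
  have inner: "((\<lambda>l. F (p, l)) has_sum (case p of (G, k) \<Rightarrow> Delta G m (bpow m k h))) UNIV" if "p \<in> ?I" for p
  proof -
    obtain G k where p: "p = (G, k)" by (metis prod.exhaust)
    with that have "G \<subseteq> {1..m}" by simp
    from Delta_split[OF Suc.prems this, of "bpow m k h"] show ?thesis by (simp only: F_def p prod.case)
  qed
  have IH: "((\<lambda>(G, k). Delta G m (bpow m k h)) has_sum (norm h)\<^sup>2) ?I" using Suc by simp
  have "F summable_on (Sigma ?I (\<lambda>_. UNIV))"
  proof (rule summable_on_SigmaI[OF inner])
    show "(\<lambda>(G, k). Delta G m (bpow m k h)) summable_on ?I" using IH by (rule has_sum_imp_summable)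
    show "0 \<le> F (p, l)" for p l
      unfolding F_def using Delta_nonneg[OF Suc.prems]
      by (auto simp del: Delta.simps split: prod.split option.split)
  qed
  from has_sum_SigmaI[OF inner IH this] have "(F has_sum (norm h)\<^sup>2) (Sigma ?I (\<lambda>_. UNIV))" .
  \<comment> \<open>Each pair (G, k) below \<open>Suc m\<close> either stays as it is
    (\<open>None\<close>, exponent 0 in the new variable) or acquires \<open>Suc m\<close> with
    exponent l. Every pair one level up arises exactly once.\<close>
  moreover have "(F has_sum (norm h)\<^sup>2) (Sigma ?I (\<lambda>_. UNIV)) \<longleftrightarrow>
      ((\<lambda>(G, k). Delta G (Suc m) (bpow (Suc m) k h)) has_sum (norm h)\<^sup>2) ?I'"
  proof (rule has_sum_reindex_bij_witness)
    let ?j = "\<lambda>((G, k), l). case l of None \<Rightarrow> (G, k)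
        | Some l \<Rightarrow> (insert (Suc m) G, k(Suc m := l))"
    let ?i = "\<lambda>(G, k). if Suc m \<in> G then ((G - {Suc m}, k(Suc m := 0)), Some (k (Suc m))) else ((G, k), None)"
    fix a assume a: "a \<in> Sigma ?I (\<lambda>_. UNIV :: nat option set)"
    obtain G k l where [simp]: "a = ((G, k), l)" by (metis prod.exhaust)
    have G: "G \<subseteq> {1..m}" "k \<in> exponents G" using a by auto
    then have G': "Suc m \<notin> G" "k (Suc m) = 0" by (auto simp: exponents_def)
    then have k: "k(Suc m := 0) = k" by auto
    show "?i (?j a) = a" using G' k by (auto split: option.split)
    show "?j a \<in> ?I'" using G by (auto split: option.split simp: exponents_def le_Suc_eq)
    have "bpow m (k(Suc m := l)) h = bpow m k h" for l by (rule bpow_cong) simp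
    then show "(case ?j a of (G, k) \<Rightarrow> Delta G (Suc m) (bpow (Suc m) k h)) = F a"
      using G' by (simp add: F_def del: Delta.simps split: option.split)
  next
    let ?j = "\<lambda>((G, k), l). case l of None \<Rightarrow> (G, k)
        | Some l \<Rightarrow> (insert (Suc m) G, k(Suc m := l))"
    let ?i = "\<lambda>(G, k). if Suc m \<in> G then ((G - {Suc m}, k(Suc m := 0)), Some (k (Suc m))) else ((G, k), None)"
    fix b assume b: "b \<in> ?I'"
    obtain G k where [simp]: "b = (G, k)" by (metis prod.exhaust)
    have G: "G \<subseteq> {1..Suc m}" "k \<in> exponents G" using b by auto
    show "?j (?i b) = b" by (auto simp: insert_absorb)
    have "G - {Suc m} \<subseteq> {1..m}" using G by (auto simp: le_Suc_eq)
    then show "?i b \<in> Sigma ?I (\<lambda>_. UNIV)" using G by (auto simp: exponents_def le_Suc_eq)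
  qed simp
  ultimately show ?case by simp
qed

end

section \<open>The coefficient spaces\<close>

lemma isometry_op_mono: "isometry_op M N A \<Longrightarrow> N \<subseteq> N' \<Longrightarrow> isometry_op M N' A"
  unfolding isometry_op_def bounded_op_def by blast

lemma isometry_op_left_inverse:
  assumes M: "closed_csubspace (closure X)"
    and A: "isometry_op (closure X) (closure X) A" and C: "isometry_op (closure X) (closure X) C"
    and inv: "\<And>x. x \<in> X \<Longrightarrow> C (A x) = x" and x: "x \<in> closure X"
  shows "C (A x) = x"
  using bounded_op_eq_on_closure[OF M bounded_op_comp[OF isometry_opD(1)[OF A] isometry_opD(1)[OF C]] _ _ x,
      of "closure X" "\<lambda>x. x"] inv
  by (simp add: bounded_op_def) (metis mult_1 order_refl)

context brehmer_tuple
begin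

lemma Delta_bpow:
  assumes "m \<le> n" "\<And>t. k t \<noteq> 0 \<Longrightarrow> t \<notin> G"
  shows "Delta G n (bpow m k h) = Delta G n h"
  using assms(1)
proof (induction m)
  case (Suc m)
  have "Delta G n ((B (Suc m) ^^ a) x) = Delta G n x" if "Suc m \<notin> G" for a x
    using that Suc.prems by (induction a) (simp_all add: Delta_B)
  then show ?case using Suc assms(2)[of "Suc m"] by (cases "k (Suc m) = 0") simp_all
qed simp

text \<open>Drop the factor \<open>B j\<close> from the product, then put it back either at the
  inner or at the outer end: the results differ by a nonzero scalar. So the range of the product
  lies in the range of \<open>B j\<close>, which later gives surjectivity.\<close>

lemma bpow_factor:
  assumes j: "j \<in> {1..n}" and k: "k j = 1"
  shows "\<exists>c g. c \<noteq> 0 \<and> bpow n k h = c *\<^sub>C B j g"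
proof -
  let ?k = "k(j := 0)"
  define a b where "a = (\<Prod>t\<in>{1..<j}. q t j ^ ?k t)" and "b = (\<Prod>t\<in>{1..n}. q t j ^ ?k t)"
  have "q t j \<noteq> 0" if "t \<in> {1..n}" for t using norm_q[OF that j] by auto
  then have nz: "a \<noteq> 0" "b \<noteq> 0" unfolding a_def b_def using j by auto
  have "?k(j := Suc (?k j)) = k" using k by auto
  then have "a *\<^sub>C bpow n k h = b *\<^sub>C B j (bpow n ?k h)"
    using bpow_B_absorb[of n j ?k h] bpow_B_commute[of n j ?k h] j
    unfolding a_def b_def by simp
  then have "(inverse a * a) *\<^sub>C bpow n k h = (inverse a * b) *\<^sub>C B j (bpow n ?k h)"
    by (simp only: scaleC_scaleC[symmetric])
  then have "bpow n k h = (inverse a * b) *\<^sub>C B j (bpow n ?k h)" using nz by simp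
  moreover have "inverse a * b \<noteq> 0" using nz by simp
  ultimately show ?thesis by blast
qed

text \<open>E is the space of the minimal unitary extension of \<open>W\<close>, where
  \<open>W\<close> extends the map from \<open>S0 h\<close> to \<open>S0 (w h)\<close> and w is the
  product of the \<open>B j\<close> with j outside G. Since every such \<open>B j\<close> is a
  factor of w, inverting w makes each isometry \<open>Y j\<close> onto.\<close>

lemma model_space:
  shows "\<exists>E S Y U. closed_csubspace E \<and> bounded_op UNIV E (S :: 'a \<Rightarrow> 'a model_coeff) \<and>
    (\<forall>h. (norm (S h))\<^sup>2 = Delta G n h) \<and>
    (\<forall>j\<in>{1..n} - G. isometry_op E E (Y j) \<and> isometry_op E E (U j) \<and>
       (\<forall>x\<in>E. Y j (U j x) = x) \<and> (\<forall>x\<in>E. U j (Y j x) = x) \<and> (\<forall>h. Y j (S h) = S (B j h))) \<and>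
    (\<forall>i\<in>{1..n} - G. \<forall>j\<in>{1..n} - G. \<forall>x\<in>E. Y i (Y j x) = q i j *\<^sub>C Y j (Y i x))"
proof -
  \<comment> \<open>Exponent one off G: each \<open>B j\<close> concerned occurs exactly once in w,
    as \<open>bpow_factor\<close> requires.\<close>
  define k where "k t = (if t \<in> {1..n} - G then 1 else 0 :: nat)" for t
  define w where "w = bpow n k"
  define c where "c j = (\<Prod>t\<in>{1..n}. q t j ^ k t)" for j
  have c: "cmod (c j) = 1" if "j \<in> {1..n}" for j
    unfolding c_def by (rule norm_q_prod[OF order_refl that])
  have w_add: "w (x + y) = w x + w y" and w_scale: "w (a *\<^sub>C x) = a *\<^sub>C w x" for x y a
    unfolding w_def by (simp_all add: bpow_add bpow_scaleC)
  have w_B: "w (B j h) = c j *\<^sub>C B j (w h)" if "j \<in> {1..n}" for j h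
    unfolding w_def c_def by (rule bpow_B_commute[OF order_refl that])
  have Delta_w: "Delta G n (w h) = Delta G n h" for h
    unfolding w_def by (rule Delta_bpow) (auto simp: k_def split: if_splits)
  have "\<exists>S :: 'a \<Rightarrow> (nat, 'a) l2sum. bounded_op UNIV UNIV S \<and> (\<forall>h. (norm (S h))\<^sup>2 = Delta G n h)"
    by (intro quadratic_form_factorization quadratic_form_Delta Delta_nonneg Delta_le order_refl)
  then obtain S0 :: "'a \<Rightarrow> (nat, 'a) l2sum"
    where S0: "bounded_op UNIV UNIV S0" and norm_S0: "\<And>h. (norm (S0 h))\<^sup>2 = Delta G n h"
    by blast
  have S0_add: "S0 (x + y) = S0 x + S0 y" and S0_scale: "S0 (a *\<^sub>C x) = a *\<^sub>C S0 x" for x y a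
    using bounded_opD(2,3)[OF S0] by auto
  define D where "D = closure (range S0)"
  have D: "closed_csubspace D"
    unfolding D_def by (rule closed_csubspace_closure_range) (metis S0_add, metis S0_scale)
  have S0_D: "S0 h \<in> D" for h unfolding D_def by (rule subsetD[OF closure_subset]) simp
  have "norm (S0 (w h)) = norm (S0 h)" for h
    by (rule power2_eq_imp_eq) (simp_all add: norm_S0 Delta_w)
  then have "\<exists>W. isometry_op (closure (range S0)) (closure (range (\<lambda>h. S0 (w h)))) W \<and>
      (\<forall>h. W (S0 h) = S0 (w h))"
    by (intro isometry_extension) (metis S0_add w_add, metis S0_scale w_scale)
  then obtain W where W: "isometry_op D (closure (range (\<lambda>h. S0 (w h)))) W"
    and W_S0: "\<And>h. W (S0 h) = S0 (w h)" unfolding D_def by blast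
  have W: "isometry_op D D W"
    by (rule isometry_op_mono[OF W]) (auto simp: D_def intro!: closure_mono)
  \<comment> \<open>Stands for the inverse of the extension of \<open>W\<close>, applied l times to
    \<open>S0 h\<close>.\<close>
  define S where "S l h = backward W (adjoint_op D W) l (S0 h)" for l h
  have S_add: "S l (x + y) = S l x + S l y" and S_scale: "S l (a *\<^sub>C x) = a *\<^sub>C S l x" for l x y a
    unfolding S_def S0_add S0_scale
    by (rule backward_add[OF D W S0_D S0_D], rule backward_scaleC[OF D W S0_D])
  have S_w: "S (Suc l) (w h) = S l h" for l h
    unfolding S_def W_S0[symmetric] by (rule backward_W[OF D W S0_D])
  have norm_S: "(norm (S l h))\<^sup>2 = Delta G n h" for l h
    unfolding S_def norm_backward[OF D W S0_D] norm_S0 ..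
  define u where "u p = S (fst p) (snd p)" for p
  \<comment> \<open>The forced value of \<open>Y j\<close> at \<open>u p\<close>. By
    \<open>w_B\<close>, moving \<open>Y j\<close> past one inverse of the extension costs a factor
    \<open>c j\<close>, and there are \<open>fst p\<close> of them.\<close>
  define v where "v j p = c j ^ fst p *\<^sub>C S (fst p) (B j (snd p))" for j p
  define E where "E = closure (range u)"
  have v_u: "v j p = u (fst p, c j ^ fst p *\<^sub>C B j (snd p))" for j p
    unfolding u_def v_def by (simp add: S_scale)
  \<comment> \<open>The pairs (l, h) and (l + m, w^m h) name the same vector. Two pairs can be added
    once both are raised to a common level.\<close>
  have lift_u: "u (l, h) = u (l + m, (w ^^ m) h)" for l m h
    by (induction m) (simp_all add: u_def S_w)
  have lift_v: "v j (l, h) = v j (l + m, (w ^^ m) h)" if j: "j \<in> {1..n}" for j l m h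
  proof (induction m)
    case (Suc m)
    have "v j (Suc l, w h) = v j (l, h)" for l h
    proof -
      have "v j (Suc l, w h) = c j ^ l *\<^sub>C S (Suc l) (c j *\<^sub>C B j (w h))"
        unfolding v_def by (simp add: S_scale scaleC_scaleC mult.commute)
      also have "\<dots> = v j (l, h)" unfolding w_B[OF j, symmetric] S_w by (simp add: v_def)
      finally show ?thesis .
    qed
    with Suc show ?case by simp
  qed simp
  have add: "\<exists>p''. u p'' = u p + u p' \<and> (\<forall>j\<in>{1..n}. v j p'' = v j p + v j p')" for p p'
  proof (intro exI conjI ballI)
    let ?h = "(w ^^ fst p') (snd p)" and ?h' = "(w ^^ fst p) (snd p')"
    let ?p = "(fst p + fst p', ?h + ?h')"
    show "u ?p = u p + u p'"
      using lift_u[of "fst p" "snd p" "fst p'"] lift_u[of "fst p'" "snd p'" "fst p"]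
      by (simp add: u_def S_add add.commute)
    show "v j ?p = v j p + v j p'" if j: "j \<in> {1..n}" for j
      using lift_v[OF j, of "fst p" "snd p" "fst p'"] lift_v[OF j, of "fst p'" "snd p'" "fst p"]
      by (simp add: v_def S_add B_add[OF j] scaleC_add_right add.commute)
  qed
  have scale: "\<exists>p''. u p'' = a *\<^sub>C u p \<and> (\<forall>j\<in>{1..n}. v j p'' = a *\<^sub>C v j p)" for a p
    by (rule exI[of _ "(fst p, a *\<^sub>C snd p)"])
      (simp add: u_def v_def S_scale B_scaleC scaleC_scaleC mult.commute)
  have E: "closed_csubspace E"
    unfolding E_def by (rule closed_csubspace_closure_range) (metis add, metis scale)
  have u_E: "u p \<in> E" for p unfolding E_def by (rule subsetD[OF closure_subset]) simp
  have norm_v: "norm (v j p) = norm (u p)" if "j \<in> {1..n} - G" for j p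
  proof -
    have "(norm (v j p))\<^sup>2 = (norm (u p))\<^sup>2"
      using that c[of j] by (simp add: v_def u_def norm_scaleC norm_power norm_S Delta_B)
    then show ?thesis by (rule power2_eq_imp_eq) simp_all
  qed
  \<comment> \<open>A preimage is not visible at level l. One level higher the same vector is built
    from w h, which is a multiple of a value of \<open>B j\<close>.\<close>
  have range_v: "range (v j) = range u" if j: "j \<in> {1..n} - G" for j
  proof
    show "range (v j) \<subseteq> range u" unfolding v_u by blast
    show "range u \<subseteq> range (v j)"
    proof
      fix x assume "x \<in> range u"
      then obtain l h where x: "x = u (l, h)" by (metis imageE prod.exhaust)
      obtain a g where ag: "a \<noteq> 0" "w h = a *\<^sub>C B j g"
        using bpow_factor[of j k h] j unfolding w_def by (auto simp: k_def)
      have jn: "j \<in> {1..n}" using j by simp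
      have cj: "c j ^ Suc l \<noteq> 0" using c[OF jn] by auto
      have "x = u (Suc l, w h)" unfolding x by (simp add: u_def S_w)
      \<comment> \<open>The scalar is arranged to cancel the factor \<open>c j ^ Suc l\<close> that
        \<open>v j\<close> carries.\<close>
      also have "\<dots> = (c j ^ Suc l * (a * inverse (c j ^ Suc l))) *\<^sub>C S (Suc l) (B j g)"
      proof -
        have "c j ^ Suc l * (a * inverse (c j ^ Suc l)) = a" using cj by (simp del: power_Suc)
        then show ?thesis by (simp only: u_def ag(2) S_scale fst_conv snd_conv)
      qed
      also have "\<dots> = v j (Suc l, (a * inverse (c j ^ Suc l)) *\<^sub>C g)"
        unfolding v_def fst_conv snd_conv B_scaleC[OF jn] S_scale scaleC_scaleC ..
      finally show "x \<in> range (v j)" by blast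
    qed
  qed
  have "\<exists>Yj Uj. isometry_op E E Yj \<and> isometry_op E E Uj \<and> (\<forall>p. Yj (u p) = v j p) \<and> (\<forall>p. Uj (v j p) = u p)"
    if j: "j \<in> {1..n} - G" for j
  proof -
    have jn: "j \<in> {1..n}" using j by simp
    have "\<exists>g. isometry_op (closure (range u)) (closure (range (v j))) g \<and> (\<forall>p. g (u p) = v j p)"
      by (rule isometry_extension) (use add scale jn norm_v[OF j] in metis)+
    moreover have "\<exists>g. isometry_op (closure (range (v j))) (closure (range u)) g \<and> (\<forall>p. g (v j p) = u p)"
      by (rule isometry_extension) (use add scale jn norm_v[OF j] in metis)+
    ultimately show ?thesis unfolding range_v[OF j] E_def by blast
  qed
  then have "\<forall>j. \<exists>YU. j \<in> {1..n} - G \<longrightarrow> isometry_op E E (fst YU) \<and> isometry_op E E (snd YU) \<and>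
      (\<forall>p. fst YU (u p) = v j p) \<and> (\<forall>p. snd YU (v j p) = u p)" by (metis fst_conv snd_conv)
  from choice[OF this] obtain YU where YU: "\<And>j. j \<in> {1..n} - G \<Longrightarrow> isometry_op E E (fst (YU j)) \<and>
      isometry_op E E (snd (YU j)) \<and> (\<forall>p. fst (YU j) (u p) = v j p) \<and> (\<forall>p. snd (YU j) (v j p) = u p)"
    by blast
  define Y U where "Y j = fst (YU j)" and "U j = snd (YU j)" for j
  have Y: "isometry_op E E (Y j)" "Y j (u p) = v j p" and U: "isometry_op E E (U j)" "U j (v j p) = u p"
    if "j \<in> {1..n} - G" for j p
    using YU[OF that] unfolding Y_def U_def by blast+
  have UY: "U j (Y j x) = x" if j: "j \<in> {1..n} - G" and x: "x \<in> E" for j x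
    using isometry_op_left_inverse[OF E[unfolded E_def] Y(1)[OF j, unfolded E_def] U(1)[OF j, unfolded E_def]
      _ x[unfolded E_def]] Y(2)[OF j] U(2)[OF j] by force
  \<comment> \<open>\<open>U j\<close> is known on the values of \<open>v j\<close>, so the identity
    is checked there; by \<open>range_v\<close> these fill \<open>range u\<close>.\<close>
  have YU': "Y j (U j x) = x" if j: "j \<in> {1..n} - G" and x: "x \<in> E" for j x
  proof (rule isometry_op_left_inverse[OF E[unfolded E_def] U(1)[OF j, unfolded E_def] Y(1)[OF j, unfolded E_def]
      _ x[unfolded E_def]])
    fix y assume "y \<in> range u"
    then obtain p where "y = v j p" using range_v[OF j] by blast
    then show "Y j (U j y) = y" using Y(2)[OF j] U(2)[OF j] by simp
  qed
  have comm: "Y i (Y j x) = q i j *\<^sub>C Y j (Y i x)"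
    if i: "i \<in> {1..n} - G" and j: "j \<in> {1..n} - G" and x: "x \<in> E" for i j x
  proof -
    note b = isometry_opD(1)[OF Y(1), unfolded E_def]
    have "Y i (Y j (u p)) = q i j *\<^sub>C Y j (Y i (u p))" for p
    proof -
      have ij: "i \<in> {1..n}" "j \<in> {1..n}" using i j by auto
      have "Y i (Y j (u p)) = v i (fst p, c j ^ fst p *\<^sub>C B j (snd p))"
        unfolding Y(2)[OF j] v_u[of j] by (rule Y(2)[OF i])
      also have "\<dots> = (c i ^ fst p * c j ^ fst p) *\<^sub>C S (fst p) (B i (B j (snd p)))"
        by (simp add: v_def B_scaleC[OF ij(1)] B_scaleC[OF ij(2)] S_scale scaleC_scaleC)
      also have "\<dots> = q i j *\<^sub>C (c j ^ fst p * c i ^ fst p) *\<^sub>C S (fst p) (B j (B i (snd p)))"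
        unfolding B_commute[OF ij] S_scale scaleC_scaleC by (simp add: mult_ac)
      also have "(c j ^ fst p * c i ^ fst p) *\<^sub>C S (fst p) (B j (B i (snd p)))
          = v j (fst p, c i ^ fst p *\<^sub>C B i (snd p))"
        by (simp add: v_def B_scaleC[OF ij(1)] B_scaleC[OF ij(2)] S_scale scaleC_scaleC)
      also have "\<dots> = Y j (Y i (u p))"
        unfolding Y(2)[OF i] v_u[of i] by (rule Y(2)[OF j, symmetric])
      finally show ?thesis .
    qed
    then show ?thesis
      using bounded_op_eq_on_closure[OF E[unfolded E_def] bounded_op_comp[OF b[OF j] b[OF i]]
          bounded_op_scaleC[OF bounded_op_comp[OF b[OF i] b[OF j]] E[unfolded E_def], of "q i j"]
          _ x[unfolded E_def]] by blast
  qed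
  obtain K where "\<And>h. norm (S0 h) \<le> K * norm h" using bounded_opD(4)[OF S0] by blast
  then have "norm (S 0 h) \<le> K * norm h" for h unfolding S_def norm_backward[OF D W S0_D] .
  then have S_op: "bounded_op UNIV E (S 0)"
    unfolding bounded_op_def using u_E[of "(0, _)"] S_add S_scale by (auto simp: u_def)
  have "Y j (S 0 h) = S 0 (B j h)" if "j \<in> {1..n} - G" for j h
    using Y(2)[OF that, of "(0, h)"] by (simp add: u_def v_def)
  then show ?thesis
    using E S_op norm_S Y(1) U(1) UY YU' comm by (intro exI[of _ E] exI[of _ "S 0"] exI[of _ Y] exI[of _ U]) blast
qed

end

section \<open>Rotational shifts on the Hardy space\<close>

lemma hardyD:
  "f \<in> hardy G E \<Longrightarrow> l2_coeff f k \<in> E"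
  "f \<in> hardy G E \<Longrightarrow> i \<notin> G \<Longrightarrow> k i \<noteq> 0 \<Longrightarrow> l2_coeff f k = 0"
  by (auto simp: hardy_def)

lemma closed_csubspace_hardy:
  assumes E: "closed_csubspace E"
  shows "closed_csubspace (hardy G E)"
  unfolding closed_csubspace_def
proof (intro conjI ballI allI)
  note ED = closed_csubspaceD[OF E]
  show "0 \<in> hardy G E" using ED(1) by (simp add: hardy_def)
  show "x + y \<in> hardy G E" if "x \<in> hardy G E" "y \<in> hardy G E" for x y
    using that ED(2) by (simp add: hardy_def)
  show "c *\<^sub>C x \<in> hardy G E" if "x \<in> hardy G E" for c x
    using that ED(3) by (simp add: hardy_def)
  show "closed (hardy G E)"
    unfolding closed_sequential_limits
  proof (intro allI impI, elim conjE)
    fix f l assume f: "\<forall>n. f n \<in> hardy G E" and l: "f \<longlonglongrightarrow> l"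
    have lim: "(\<lambda>n. l2_coeff (f n) k) \<longlonglongrightarrow> l2_coeff l k" for k
    proof (rule bounded_op_tendsto[OF closed_csubspace_UNIV _ _ l])
      have "\<exists>K. \<forall>x::(nat \<Rightarrow> nat, 'a) l2sum. norm (l2_coeff x k) \<le> K * norm x"
        by (rule exI[of _ 1]) (simp add: norm_l2_coeff_le)
      then show "bounded_op UNIV UNIV (\<lambda>x::(nat \<Rightarrow> nat, 'a) l2sum. l2_coeff x k)"
        by (simp add: bounded_op_def)
    qed simp
    have "l2_coeff l k \<in> E" for k
      by (rule closed_sequentially[OF ED(4) _ lim]) (use f hardyD(1) in blast)
    moreover have "l2_coeff l k = 0" if "\<exists>i. i \<notin> G \<and> k i \<noteq> 0" for k
    proof -
      have "l2_coeff (f n) k = 0" for n using that f hardyD(2) by blast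
      then show ?thesis using lim[of k] by (simp add: LIMSEQ_const_iff)
    qed
    ultimately show "l \<in> hardy G E" by (simp add: hardy_def)
  qed
qed

text \<open>The shape of \<open>V j\<close> and of its adjoint for j outside G. Acting by U on
  coefficients alone would commute with the rotational shifts; the weights w produce the required
  phases.\<close>

definition diag_op ::
    "((nat \<Rightarrow> nat) \<Rightarrow> complex) \<Rightarrow> ('a \<Rightarrow> 'a) \<Rightarrow> (nat \<Rightarrow> nat, 'a::complex_inner) l2sum \<Rightarrow> (nat \<Rightarrow> nat, 'a) l2sum" where
  "diag_op w U f = l2_of (\<lambda>k. w k *\<^sub>C U (l2_coeff f k))"

lemma diag_op:
  assumes w: "\<And>k. cmod (w k) = 1" and U: "isometry_op E E U" and f: "f \<in> hardy G E"
  shows l2_coeff_diag_op: "l2_coeff (diag_op w U f) k = w k *\<^sub>C U (l2_coeff f k)"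
    and norm_diag_op: "norm (diag_op w U f) = norm f"
proof -
  have "norm (w k *\<^sub>C U (l2_coeff f k)) = norm (l2_coeff f k)" for k
    using isometry_opD(2)[OF U hardyD(1)[OF f]] by (simp add: norm_scaleC w)
  then have "((\<lambda>k. (norm (w k *\<^sub>C U (l2_coeff f k)))\<^sup>2) has_sum (norm f)\<^sup>2) UNIV"
    using l2_norm_has_sum[of f] by simp
  note l2_of_has_sum[OF this]
  then show "l2_coeff (diag_op w U f) k = w k *\<^sub>C U (l2_coeff f k)" "norm (diag_op w U f) = norm f"
    unfolding diag_op_def by (simp_all add: fun_eq_iff power2_eq_iff_nonneg)
qed

lemma isometry_op_diag_op:
  assumes E: "closed_csubspace E" and w: "\<And>k. cmod (w k) = 1" and U: "isometry_op E E U"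
  shows "isometry_op (hardy G E) (hardy G E) (diag_op w U)"
  unfolding isometry_op_def bounded_op_def
proof (intro conjI ballI allI)
  note c = l2_coeff_diag_op[OF w U] and H = closed_csubspaceD[OF closed_csubspace_hardy[OF E, of G]]
  note bU = bounded_opD[OF isometry_opD(1)[OF U]]
  fix f assume f: "f \<in> hardy G E"
  show "diag_op w U f \<in> hardy G E"
    using hardyD[OF f] bU(1) closed_csubspaceD(3)[OF E] bounded_op_zero[OF E isometry_opD(1)[OF U]]
    by (auto simp: hardy_def c[OF f])
  show "diag_op w U (a *\<^sub>C f) = a *\<^sub>C diag_op w U f" for a
    by (rule l2_eqI) (simp add: c[OF f] c[OF H(3)[OF f]] bU(3)[OF hardyD(1)[OF f]] scaleC_scaleC mult.commute)
  show "norm (diag_op w U f) = norm f" by (rule norm_diag_op[OF w U f])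
  fix g assume g: "g \<in> hardy G E"
  show "diag_op w U (f + g) = diag_op w U f + diag_op w U g"
    by (rule l2_eqI) (simp add: c[OF f] c[OF g] c[OF H(2)[OF f g]] bU(2)[OF hardyD(1)[OF f] hardyD(1)[OF g]] scaleC_add_right)
next
  show "\<exists>K. \<forall>f\<in>hardy G E. norm (diag_op w U f) \<le> K * norm f"
    using norm_diag_op[OF w U] by (intro exI[of _ 1]) simp
qed

section \<open>Shifts of multi-indices\<close>

definition shift_up :: "nat \<Rightarrow> (nat \<Rightarrow> nat) \<Rightarrow> nat \<Rightarrow> nat" where
  "shift_up i k = k(i := Suc (k i))"

lemma shift_up_cases: obtains "k i = 0" | m where "k = shift_up i m"
proof (cases "k i")
  case (Suc r)
  then have "k = shift_up i (k(i := r))" by (simp add: shift_up_def fun_eq_iff)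
  then show ?thesis using that(2) by blast
qed (use that(1) in blast)

lemma shift_up_simps [simp]:
  "shift_up i k i = Suc (k i)" "j \<noteq> i \<Longrightarrow> shift_up i k j = k j"
  "(shift_up i k)(i := k i) = k"
  by (simp_all add: shift_up_def)

lemma shift_up_commute: "shift_up i (shift_up j k) = shift_up j (shift_up i k)"
  by (auto simp: shift_up_def)

lemma inj_shift_up: "inj (shift_up i)"
proof (rule injI)
  fix k m assume "shift_up i k = shift_up i m"
  then have "shift_up i k t = shift_up i m t" for t by simp
  then have "k t = m t" for t by (cases "t = i") (metis shift_up_simps nat.inject)+
  then show "k = m" by blast
qed

lemma range_shift_up: "range (shift_up i) = {k. k i \<noteq> 0}"
proof -
  have "k \<in> range (shift_up i)" if "k i \<noteq> 0" for k
    using that by (cases k i rule: shift_up_cases) auto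
  then show ?thesis by auto
qed

lemma has_sum_shift_up:
  assumes "\<And>k. k i = 0 \<Longrightarrow> f k = 0"
  shows "(f has_sum r) UNIV \<longleftrightarrow> ((\<lambda>k. f (shift_up i k)) has_sum r) UNIV"
proof -
  have "((\<lambda>k. f (shift_up i k)) has_sum r) UNIV \<longleftrightarrow> (f has_sum r) (range (shift_up i))"
    by (simp add: has_sum_reindex[OF inj_shift_up] comp_def)
  also have "\<dots> \<longleftrightarrow> (f has_sum r) UNIV"
    by (rule has_sum_cong_neutral) (use assms in \<open>auto simp: range_shift_up\<close>)
  finally show ?thesis ..
qed

lemma infsum_shift_up:
  fixes f :: "(nat \<Rightarrow> nat) \<Rightarrow> complex"
  assumes "\<And>k. k i = 0 \<Longrightarrow> f k = 0" and "f summable_on UNIV"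
  shows "infsum f UNIV = (\<Sum>\<^sub>\<infinity>k. f (shift_up i k))"
proof -
  have "((\<lambda>k. f (shift_up i k)) has_sum infsum f UNIV) UNIV"
    using has_sum_shift_up[of i f] assms(1) has_sum_infsum[OF assms(2)] by blast
  then show ?thesis by (rule infsumI[symmetric])
qed

text \<open>With the conjugated rotation weights this is the adjoint of the rotational
  shift.\<close>

definition backward_shift ::
    "((nat \<Rightarrow> nat) \<Rightarrow> complex) \<Rightarrow> nat \<Rightarrow> (nat \<Rightarrow> nat, 'a::complex_inner) l2sum \<Rightarrow> (nat \<Rightarrow> nat, 'a) l2sum" where
  "backward_shift w i f = l2_of (\<lambda>k. w k *\<^sub>C l2_coeff f (shift_up i k))"

lemma l2_coeff_backward_shift:
  assumes "\<And>k. cmod (w k) = 1"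
  shows "l2_coeff (backward_shift w i f) k = w k *\<^sub>C l2_coeff f (shift_up i k)"
proof -
  have "(\<lambda>k. (norm (l2_coeff f k))\<^sup>2) summable_on (range (shift_up i))"
    by (rule summable_on_subset_banach[of _ UNIV])
      (use square_summable_coeff[of f] in \<open>auto simp: square_summable_def\<close>)
  then have "square_summable (\<lambda>k. w k *\<^sub>C l2_coeff f (shift_up i k))"
    by (simp add: square_summable_def norm_scaleC assms summable_on_reindex[OF inj_shift_up] comp_def)
  then show ?thesis by (simp add: backward_shift_def l2_coeff_of)
qed

section \<open>The model tuple on the Hardy space\<close>

locale hardy_model =
  fixes n :: nat and q s :: "nat \<Rightarrow> nat \<Rightarrow> complex" and G :: "nat set"
    and E :: "'a::chilbert_space set" and U Y :: "nat \<Rightarrow> 'a \<Rightarrow> 'a"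
  assumes q: "is_q n q" and s: "is_sqrt_q n q s" and G: "G \<subseteq> {1..n}" and E: "closed_csubspace E"
    and U: "j \<in> {1..n} - G \<Longrightarrow> isometry_op E E (U j)"
    and Y: "j \<in> {1..n} - G \<Longrightarrow> isometry_op E E (Y j)"
    and UY: "j \<in> {1..n} - G \<Longrightarrow> x \<in> E \<Longrightarrow> U j (Y j x) = x"
    and YU: "j \<in> {1..n} - G \<Longrightarrow> x \<in> E \<Longrightarrow> Y j (U j x) = x"
    and Y_commute: "i \<in> {1..n} - G \<Longrightarrow> j \<in> {1..n} - G \<Longrightarrow> x \<in> E \<Longrightarrow> Y i (Y j x) = q i j *\<^sub>C Y j (Y i x)"
begin

abbreviation "H \<equiv> hardy G E"

text \<open>\<open>\<sigma> i\<close> is the weight of the rotation, whereas \<open>\<tau> j\<close>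
  uses q itself and not its square root. For i and j in G, both rotations see the variable of the
  other and contribute one root each; for j outside G there is no variable z_j, so the weight of
  \<open>V j\<close> must supply the whole phase.\<close>

definition \<sigma> :: "nat \<Rightarrow> (nat \<Rightarrow> nat) \<Rightarrow> complex" where "\<sigma> i k = (\<Prod>t\<in>G. s i t ^ k t)"
definition \<tau> :: "nat \<Rightarrow> (nat \<Rightarrow> nat) \<Rightarrow> complex" where "\<tau> j k = (\<Prod>t\<in>G. q j t ^ k t)"

definition V where
  "V j = (if j \<in> G then \<lambda>f. mult_z j (rotation s G j f) else diag_op (\<tau> j) (U j))"

definition Vadj where
  "Vadj j = (if j \<in> G then backward_shift (\<lambda>k. cnj (\<sigma> j k)) j else diag_op (\<lambda>k. cnj (\<tau> j k)) (Y j))"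

lemma norm_q: "i \<in> {1..n} \<Longrightarrow> j \<in> {1..n} \<Longrightarrow> cmod (q i j) = 1"
  and q_cnj: "i \<in> {1..n} \<Longrightarrow> j \<in> {1..n} \<Longrightarrow> q i j = cnj (q j i)"
  and q_refl: "i \<in> {1..n} \<Longrightarrow> q i i = 1"
  using q unfolding is_q_def by blast+

lemma s_sq: "i \<in> {1..n} \<Longrightarrow> j \<in> {1..n} \<Longrightarrow> (s i j)\<^sup>2 = q i j"
  and s_cnj: "i \<in> {1..n} \<Longrightarrow> j \<in> {1..n} \<Longrightarrow> s j i = cnj (s i j)"
  using s unfolding is_sqrt_q_def by blast+

lemma norm_s: "i \<in> {1..n} \<Longrightarrow> j \<in> {1..n} \<Longrightarrow> cmod (s i j) = 1"
proof -
  assume ij: "i \<in> {1..n}" "j \<in> {1..n}"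
  have "(cmod (s i j))\<^sup>2 = 1\<^sup>2" unfolding norm_power[symmetric] s_sq[OF ij] norm_q[OF ij] by simp
  then show "cmod (s i j) = 1" by (rule power2_eq_imp_eq) simp_all
qed

lemma cnj_mult_self: "cmod z = 1 \<Longrightarrow> z * cnj z = 1" "cmod z = 1 \<Longrightarrow> cnj z * z = 1" for z
  using complex_norm_square[of z] by (simp_all add: mult.commute)

lemma norm_\<sigma>: "j \<in> {1..n} \<Longrightarrow> cmod (\<sigma> j k) = 1"
  unfolding \<sigma>_def using G by (auto simp: norm_power norm_s simp flip: prod_norm intro!: prod.neutral)

lemma norm_\<tau>: "j \<in> {1..n} \<Longrightarrow> cmod (\<tau> j k) = 1"
  unfolding \<tau>_def using G by (auto simp: norm_power norm_q simp flip: prod_norm intro!: prod.neutral)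

lemma finite_G: "finite G" using G finite_subset by blast

lemma prod_shift_up:
  fixes w :: "nat \<Rightarrow> complex"
  assumes "i \<in> G"
  shows "(\<Prod>t\<in>G. w t ^ shift_up i k t) = w i * (\<Prod>t\<in>G. w t ^ k t)"
proof -
  have "(\<Prod>t\<in>G - {i}. w t ^ shift_up i k t) = (\<Prod>t\<in>G - {i}. w t ^ k t)" by (rule prod.cong) auto
  then show ?thesis by (simp add: prod.remove[OF finite_G assms] mult_ac)
qed

lemma \<sigma>_shift_up: "i \<in> G \<Longrightarrow> \<sigma> j (shift_up i k) = s j i * \<sigma> j k"
  unfolding \<sigma>_def by (rule prod_shift_up)

lemma \<tau>_shift_up: "i \<in> G \<Longrightarrow> \<tau> j (shift_up i k) = q j i * \<tau> j k"
  unfolding \<tau>_def by (rule prod_shift_up)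

lemma GD: "i \<in> G \<Longrightarrow> i \<in> {1..n}" using G by blast

lemma V_coeff_zero: "i \<in> G \<Longrightarrow> k i = 0 \<Longrightarrow> l2_coeff (V i f) k = 0"
  by (simp add: V_def l2_coeff_mult_z)

lemma V_coeff_shift: "i \<in> G \<Longrightarrow> l2_coeff (V i f) (shift_up i k) = \<sigma> i k *\<^sub>C l2_coeff f k"
  using norm_s[OF GD GD] unfolding V_def \<sigma>_def
  by (simp add: l2_coeff_mult_z l2_coeff_rotation del: fun_upd_apply)

lemma V_coeff: "j \<in> {1..n} - G \<Longrightarrow> f \<in> H \<Longrightarrow> l2_coeff (V j f) k = \<tau> j k *\<^sub>C U j (l2_coeff f k)"
  unfolding V_def using l2_coeff_diag_op[OF norm_\<tau> U] by simp

lemma Vadj_coeff_shift: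
  "i \<in> G \<Longrightarrow> l2_coeff (Vadj i f) k = cnj (\<sigma> i k) *\<^sub>C l2_coeff f (shift_up i k)"
  unfolding Vadj_def by (simp add: l2_coeff_backward_shift norm_\<sigma>[OF GD])

lemma Vadj_coeff:
  "j \<in> {1..n} - G \<Longrightarrow> f \<in> H \<Longrightarrow> l2_coeff (Vadj j f) k = cnj (\<tau> j k) *\<^sub>C Y j (l2_coeff f k)"
  unfolding Vadj_def using l2_coeff_diag_op[OF _ Y, of "\<lambda>k. cnj (\<tau> j k)"] norm_\<tau>[of j] by simp

lemma H: "closed_csubspace H" by (rule closed_csubspace_hardy[OF E])

lemma V_eqI:
  assumes "i \<in> G" "\<And>k. k i = 0 \<Longrightarrow> l2_coeff g k = 0"
    and "\<And>k. l2_coeff g (shift_up i k) = \<sigma> i k *\<^sub>C l2_coeff f k"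
  shows "V i f = g"
proof (rule l2_eqI)
  show "l2_coeff (V i f) k = l2_coeff g k" for k
    by (cases k i rule: shift_up_cases) (simp_all add: V_coeff_zero V_coeff_shift assms)
qed

lemma isometry_V: "j \<in> {1..n} \<Longrightarrow> isometry_op H H (V j)"
proof (cases "j \<in> G")
  case False
  assume "j \<in> {1..n}"
  then show ?thesis using False isometry_op_diag_op[OF E norm_\<tau> U] by (simp add: V_def)
next
  case j: True
  have norm: "norm (V j f) = norm f" for f :: "(nat \<Rightarrow> nat, 'a) l2sum"
  proof -
    have "((\<lambda>k. (norm (l2_coeff (V j f) (shift_up j k)))\<^sup>2) has_sum (norm f)\<^sup>2) UNIV"
      using l2_norm_has_sum[of f] by (simp add: V_coeff_shift[OF j] norm_scaleC norm_\<sigma>[OF GD[OF j]])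
    then have "((\<lambda>k. (norm (l2_coeff (V j f) k))\<^sup>2) has_sum (norm f)\<^sup>2) UNIV"
      by (subst has_sum_shift_up[of j]) (simp_all add: V_coeff_zero[OF j])
    then have "(norm (V j f))\<^sup>2 = (norm f)\<^sup>2" using l2_norm_has_sum has_sum_unique by blast
    then show ?thesis by (rule power2_eq_imp_eq) simp_all
  qed
  show ?thesis
    unfolding isometry_op_def bounded_op_def
  proof (intro conjI ballI allI)
    fix f assume f: "f \<in> H"
    have "l2_coeff (V j f) k \<in> E \<and> ((\<exists>i. i \<notin> G \<and> k i \<noteq> 0) \<longrightarrow> l2_coeff (V j f) k = 0)" for k
    proof (cases k j rule: shift_up_cases)
      case 1
      then show ?thesis using closed_csubspaceD(1)[OF E] by (simp add: V_coeff_zero[OF j])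
    next
      case (2 m)
      have "l2_coeff f m = 0" if "i \<notin> G" "k i \<noteq> 0" for i
        using hardyD(2)[OF f that(1), of m] that(2) j that(1) unfolding 2 by (cases "i = j") auto
      then show ?thesis
        unfolding 2 V_coeff_shift[OF j] using closed_csubspaceD(3)[OF E hardyD(1)[OF f]] 2 by auto
    qed
    then show "V j f \<in> H" by (simp add: hardy_def)
    show "V j (c *\<^sub>C f) = c *\<^sub>C V j f" for c
      by (rule V_eqI[OF j]) (simp_all add: V_coeff_zero[OF j] V_coeff_shift[OF j] scaleC_scaleC mult.commute)
    show "V j (f + g) = V j f + V j g" for g
      by (rule V_eqI[OF j]) (simp_all add: V_coeff_zero[OF j] V_coeff_shift[OF j] scaleC_add_right)
  qed (use norm in \<open>auto intro!: exI[of _ 1]\<close>)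
qed

lemma V_H: "j \<in> {1..n} \<Longrightarrow> f \<in> H \<Longrightarrow> V j f \<in> H"
  by (rule bounded_opD(1)[OF isometry_opD(1)[OF isometry_V]])

lemma V_scaleC: "j \<in> {1..n} \<Longrightarrow> f \<in> H \<Longrightarrow> V j (c *\<^sub>C f) = c *\<^sub>C V j f"
  by (rule bounded_opD(3)[OF isometry_opD(1)[OF isometry_V]])

lemma Vadj_H:
  assumes "j \<in> {1..n}" "f \<in> H"
  shows "Vadj j f \<in> H"
proof (cases "j \<in> G")
  case True
  have "l2_coeff f (shift_up j k) = 0" if "i \<notin> G" "k i \<noteq> 0" for i k
    using hardyD(2)[OF assms(2) that(1), of "shift_up j k"] that by (cases "i = j") auto
  then show ?thesis
    using closed_csubspaceD(3)[OF E hardyD(1)[OF assms(2)]] by (auto simp: hardy_def Vadj_coeff_shift[OF True])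
next
  case False
  then have "isometry_op H H (Vadj j)"
    unfolding Vadj_def using isometry_op_diag_op[OF E _ Y, of "\<lambda>k. cnj (\<tau> j k)" j] norm_\<tau> assms(1) by simp
  from bounded_opD(1)[OF isometry_opD(1)[OF this] assms(2)] show ?thesis .
qed

lemma cinner_U: "j \<in> {1..n} - G \<Longrightarrow> x \<in> E \<Longrightarrow> y \<in> E \<Longrightarrow> cinner (U j x) y = cinner x (Y j y)"
proof -
  assume j: "j \<in> {1..n} - G" and x: "x \<in> E" and y: "y \<in> E"
  have "cinner (Y j (U j x)) (Y j (U j (Y j y))) = cinner (U j x) (U j (Y j y))"
    using bounded_opD(1)[OF isometry_opD(1)[OF U[OF j]]] bounded_opD(1)[OF isometry_opD(1)[OF Y[OF j]]]
    by (intro isometry_op_cinner[OF E Y[OF j]]) (simp_all add: x y)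
  moreover have "Y j y \<in> E" by (rule bounded_opD(1)[OF isometry_opD(1)[OF Y[OF j]] y])
  ultimately show ?thesis by (simp add: YU[OF j x] YU[OF j] UY[OF j y])
qed

lemma adjoint_V:
  assumes "j \<in> {1..n}" "g \<in> H"
  shows "adjoint_op H (V j) g = Vadj j g"
proof (rule adjoint_op_eqI[OF H Vadj_H[OF assms]])
  fix f assume f: "f \<in> H"
  show "cinner (V j f) g = cinner f (Vadj j g)"
  proof (cases "j \<in> G")
    case True
    have "cinner (V j f) g = (\<Sum>\<^sub>\<infinity>k. cinner (l2_coeff (V j f) (shift_up j k)) (l2_coeff g (shift_up j k)))"
      unfolding cinner_l2sum_def by (rule infsum_shift_up) (simp_all add: V_coeff_zero[OF True] cinner_summable)
    also have "\<dots> = cinner f (Vadj j g)"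
      unfolding cinner_l2sum_def
      by (simp add: V_coeff_shift[OF True] Vadj_coeff_shift[OF True] cinner_scaleC_left cinner_scaleC_right)
    finally show ?thesis .
  next
    case False
    then have j: "j \<in> {1..n} - G" using assms by simp
    show ?thesis
      unfolding cinner_l2sum_def
      by (simp add: V_coeff[OF j f] Vadj_coeff[OF j assms(2)] cinner_scaleC_left cinner_scaleC_right
          cinner_U[OF j hardyD(1)[OF f] hardyD(1)[OF assms(2)]])
  qed
qed

lemma V_Vadj:
  assumes j: "j \<in> {1..n} - G" and f: "f \<in> H"
  shows "V j (Vadj j f) = f" "Vadj j (V j f) = f"
proof -
  have jn: "j \<in> {1..n}" using j by simp
  note b = bounded_opD(3)[OF isometry_opD(1)[OF U[OF j]] bounded_opD(1)[OF isometry_opD(1)[OF Y[OF j]] hardyD(1)[OF f]]]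
    bounded_opD(3)[OF isometry_opD(1)[OF Y[OF j]] bounded_opD(1)[OF isometry_opD(1)[OF U[OF j]] hardyD(1)[OF f]]]
  show "V j (Vadj j f) = f"
    by (rule l2_eqI) (simp add: V_coeff[OF j Vadj_H[OF jn f]] Vadj_coeff[OF j f] b(1) UY[OF j hardyD(1)[OF f]]
        scaleC_scaleC cnj_mult_self norm_\<tau>[OF jn])
  show "Vadj j (V j f) = f"
    by (rule l2_eqI) (simp add: V_coeff[OF j f] Vadj_coeff[OF j V_H[OF jn f]] b(2) YU[OF j hardyD(1)[OF f]]
        scaleC_scaleC cnj_mult_self norm_\<tau>[OF jn])
qed

lemma unitary_V: "j \<in> {1..n} - G \<Longrightarrow> unitary_op H (V j)"
  unfolding unitary_op_def using isometry_opD(1)[OF isometry_V]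
  by (simp add: adjoint_V V_H V_Vadj)

text \<open>Inverting the relation for \<open>Y\<close> reverses both products and inverts the
  phase. The two effects cancel, so the inverses satisfy the same relation.\<close>

lemma U_commute:
  assumes i: "i \<in> {1..n} - G" and j: "j \<in> {1..n} - G" and x: "x \<in> E"
  shows "U i (U j x) = q i j *\<^sub>C U j (U i x)"
proof -
  have U_E: "U t y \<in> E" and Y_E: "Y t y \<in> E" if "t \<in> {1..n} - G" "y \<in> E" for t y
    using bounded_opD(1)[OF isometry_opD(1)[OF U]] bounded_opD(1)[OF isometry_opD(1)[OF Y]] that by auto
  have "x = Y j (Y i (U i (U j x)))" using YU U_E i j x by simp
  then have "q i j *\<^sub>C x = Y i (Y j (U i (U j x)))"
    using Y_commute[OF i j U_E[OF i U_E[OF j x]]] by simp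
  then have "U j (U i (q i j *\<^sub>C x)) = U i (U j x)"
    using UY U_E Y_E i j x by simp
  then show ?thesis
    using bounded_opD(3)[OF isometry_opD(1)[OF U]] U_E i j x by simp
qed

lemma q_s: "i \<in> {1..n} \<Longrightarrow> j \<in> {1..n} \<Longrightarrow> q i j * s j i = s i j"
proof -
  assume ij: "i \<in> {1..n}" "j \<in> {1..n}"
  show "q i j * s j i = s i j"
    unfolding s_sq[OF ij, symmetric] s_cnj[OF ij] power2_eq_square mult.assoc
      cnj_mult_self(1)[OF norm_s[OF ij]] by simp
qed

lemma q_q: "i \<in> {1..n} \<Longrightarrow> j \<in> {1..n} \<Longrightarrow> q i j * q j i = 1"
  by (subst q_cnj[of j i]) (simp_all only: cnj_mult_self(1) norm_q)

text \<open>Only the weight of \<open>V j\<close> notices the shift by z_i: it picks up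
  \<open>q j i\<close>, the inverse of \<open>q i j\<close>.\<close>

lemma V_commute_mixed:
  assumes i: "i \<in> G" and j: "j \<in> {1..n} - G" and f: "f \<in> H"
  shows "V i (V j f) = q i j *\<^sub>C V j (V i f)"
proof (rule V_eqI[OF i])
  have jn: "j \<in> {1..n}" using j by simp
  note Vj = V_coeff[OF j V_H[OF GD[OF i] f]] and b = isometry_opD(1)[OF U[OF j]]
  show "l2_coeff (q i j *\<^sub>C V j (V i f)) k = 0" if "k i = 0" for k
    using that by (simp add: Vj V_coeff_zero[OF i] bounded_op_zero[OF E b])
  show "l2_coeff (q i j *\<^sub>C V j (V i f)) (shift_up i k) = \<sigma> i k *\<^sub>C l2_coeff (V j f) k" for k
  proof -
    have "l2_coeff (q i j *\<^sub>C V j (V i f)) (shift_up i k)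
        = ((q i j * q j i) * \<tau> j k * \<sigma> i k) *\<^sub>C U j (l2_coeff f k)"
      by (simp add: Vj V_coeff_shift[OF i] \<tau>_shift_up[OF i] bounded_opD(3)[OF b hardyD(1)[OF f]] scaleC_scaleC mult_ac)
    then show ?thesis by (simp only: q_q[OF GD[OF i] jn]) (simp add: V_coeff[OF j f] scaleC_scaleC mult_ac)
  qed
qed

text \<open>Past the variable of the other, \<open>V i\<close> picks up \<open>s i j\<close> and
  \<open>V j\<close> picks up \<open>s j i\<close>; their quotient is \<open>q i j\<close>.\<close>

lemma V_commute_shifts:
  assumes i: "i \<in> G" and j: "j \<in> G" and ij: "i \<noteq> j"
  shows "V i (V j f) = q i j *\<^sub>C V j (V i f)"
proof (rule V_eqI[OF i])
  show "l2_coeff (q i j *\<^sub>C V j (V i f)) k = 0" if "k i = 0" for k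
  proof (cases k j rule: shift_up_cases)
    case (2 m)
    then have "m i = 0" using that ij by auto
    then show ?thesis by (simp add: 2 V_coeff_shift[OF j] V_coeff_zero[OF i])
  qed (simp add: V_coeff_zero[OF j])
  show "l2_coeff (q i j *\<^sub>C V j (V i f)) (shift_up i k) = \<sigma> i k *\<^sub>C l2_coeff (V j f) k" for k
  proof (cases k j rule: shift_up_cases)
    case 1
    then show ?thesis using ij by (simp add: V_coeff_zero[OF j])
  next
    case (2 m)
    have "l2_coeff (q i j *\<^sub>C V j (V i f)) (shift_up i k)
        = ((q i j * s j i) * \<sigma> j m * \<sigma> i m) *\<^sub>C l2_coeff f m"
      by (simp add: 2 shift_up_commute[of i j m] V_coeff_shift[OF i] V_coeff_shift[OF j] \<sigma>_shift_up[OF i]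
          scaleC_scaleC mult_ac)
    then show ?thesis
      by (simp only: q_s[OF GD[OF i] GD[OF j]]) (simp add: 2 V_coeff_shift[OF j] \<sigma>_shift_up[OF j] scaleC_scaleC mult_ac)
  qed
qed

lemma V_commute:
  assumes i: "i \<in> {1..n}" and j: "j \<in> {1..n}" and f: "f \<in> H"
  shows "V i (V j f) = q i j *\<^sub>C V j (V i f)"
proof -
  consider "i = j" | "i \<in> G" "j \<in> G" "i \<noteq> j" | "i \<in> G" "j \<notin> G" | "i \<notin> G" "j \<in> G" | "i \<notin> G" "j \<notin> G"
    by blast
  then show ?thesis
  proof cases
    case 1
    then show ?thesis using q_refl[OF i] by simp
  next
    case 2
    then show ?thesis by (intro V_commute_shifts)
  next
    case 3
    then show ?thesis using j f by (intro V_commute_mixed) auto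
  next
    case 4
    then have "V j (V i f) = q j i *\<^sub>C V i (V j f)" using i f by (intro V_commute_mixed) auto
    then show ?thesis by (simp add: scaleC_scaleC q_q[OF i j])
  next
    case 5
    then have ij: "i \<in> {1..n} - G" "j \<in> {1..n} - G" using i j by auto
    note b = isometry_opD(1)[OF U[OF ij(1)]] isometry_opD(1)[OF U[OF ij(2)]]
    show ?thesis
    proof (rule l2_eqI)
      fix k
      have "l2_coeff (V i (V j f)) k = (\<tau> i k * \<tau> j k) *\<^sub>C U i (U j (l2_coeff f k))"
        using bounded_opD(3)[OF b(1) bounded_opD(1)[OF b(2) hardyD(1)[OF f]]]
        by (simp add: V_coeff[OF ij(1) V_H[OF j f]] V_coeff[OF ij(2) f] scaleC_scaleC)
      also have "\<dots> = (\<tau> i k * \<tau> j k * q i j) *\<^sub>C U j (U i (l2_coeff f k))"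
        unfolding U_commute[OF ij hardyD(1)[OF f]] scaleC_scaleC ..
      also have "\<dots> = l2_coeff (q i j *\<^sub>C V j (V i f)) k"
        using bounded_opD(3)[OF b(2) bounded_opD(1)[OF b(1) hardyD(1)[OF f]]]
        by (simp add: V_coeff[OF ij(2) V_H[OF i f]] V_coeff[OF ij(1) f] scaleC_scaleC mult_ac)
      finally show "l2_coeff (V i (V j f)) k = l2_coeff (q i j *\<^sub>C V j (V i f)) k" .
    qed
  qed
qed

text \<open>For a unitary \<open>V j\<close> this is \<open>V_commute\<close> multiplied by
  inverses. For a shift \<open>V j\<close> commutation alone does not give it, so coefficients are
  compared; as i \<noteq> j, shifting back in z_j leaves the exponent of z_i alone.\<close>

lemma V_Vadj_commute:
  assumes i: "i \<in> {1..n}" and j: "j \<in> {1..n}" and ij: "i \<noteq> j" and f: "f \<in> H"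
  shows "V i (Vadj j f) = cnj (q i j) *\<^sub>C Vadj j (V i f)"
proof (cases "j \<in> G")
  case False
  then have j': "j \<in> {1..n} - G" using j by simp
  note adj_f = Vadj_H[OF j f] and V_adj_f = V_H[OF i Vadj_H[OF j f]]
  have "V i f = q i j *\<^sub>C V j (V i (Vadj j f))"
    using V_commute[OF i j adj_f] V_Vadj(1)[OF j' f] by simp
  also have "\<dots> = V j (q i j *\<^sub>C V i (Vadj j f))" by (rule V_scaleC[OF j V_adj_f, symmetric])
  finally have "Vadj j (V i f) = q i j *\<^sub>C V i (Vadj j f)"
    using V_Vadj(2)[OF j' closed_csubspaceD(3)[OF H V_adj_f]] by simp
  then show ?thesis by (simp add: scaleC_scaleC cnj_mult_self(2)[OF norm_q[OF i j]])
next
  case jG: True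
  show ?thesis
  proof (cases "i \<in> G")
    case iG: True
    show ?thesis
    proof (rule V_eqI[OF iG])
      show "l2_coeff (cnj (q i j) *\<^sub>C Vadj j (V i f)) k = 0" if "k i = 0" for k
        using that ij by (simp add: Vadj_coeff_shift[OF jG] V_coeff_zero[OF iG])
      show "l2_coeff (cnj (q i j) *\<^sub>C Vadj j (V i f)) (shift_up i k) = \<sigma> i k *\<^sub>C l2_coeff (Vadj j f) k" for k
      proof -
        have "l2_coeff (cnj (q i j) *\<^sub>C Vadj j (V i f)) (shift_up i k)
            = (cnj (q i j * s j i) * s i j * cnj (\<sigma> j k) * \<sigma> i k) *\<^sub>C l2_coeff f (shift_up j k)"
          by (simp add: Vadj_coeff_shift[OF jG] \<sigma>_shift_up[OF iG] shift_up_commute[of j i] V_coeff_shift[OF iG]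
              \<sigma>_shift_up[OF jG] scaleC_scaleC mult_ac)
        then show ?thesis
          by (simp only: q_s[OF i j] cnj_mult_self(2)[OF norm_s[OF i j]])
            (simp add: Vadj_coeff_shift[OF jG] scaleC_scaleC mult_ac)
      qed
    qed
  next
    case False
    then have i': "i \<in> {1..n} - G" using i by simp
    show ?thesis
    proof (rule l2_eqI)
      fix k
      have "l2_coeff (cnj (q i j) *\<^sub>C Vadj j (V i f)) k
          = ((cnj (q i j) * q i j) * cnj (\<sigma> j k) * \<tau> i k) *\<^sub>C U i (l2_coeff f (shift_up j k))"
        by (simp add: Vadj_coeff_shift[OF jG] V_coeff[OF i' f] \<tau>_shift_up[OF jG] scaleC_scaleC mult_ac)
      also have "\<dots> = l2_coeff (V i (Vadj j f)) k"
        by (simp only: cnj_mult_self(2)[OF norm_q[OF i j]])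
          (simp add: V_coeff[OF i' Vadj_H[OF j f]] Vadj_coeff_shift[OF jG] scaleC_scaleC mult_ac
            bounded_opD(3)[OF isometry_opD(1)[OF U[OF i']] hardyD(1)[OF f]])
      finally show "l2_coeff (V i (Vadj j f)) k = l2_coeff (cnj (q i j) *\<^sub>C Vadj j (V i f)) k" ..
    qed
  qed
qed

lemma doubly_q_commuting_V: "doubly_q_commuting n q H V"
  unfolding doubly_q_commuting_def q_commuting_def
proof (intro conjI ballI impI)
  fix i j f assume *: "i \<in> {1..n}" "j \<in> {1..n}" "f \<in> H"
  show "V i (V j f) = q i j *\<^sub>C V j (V i f)" by (rule V_commute[OF *])
  show "V i (adjoint_op H (V j) f) = cnj (q i j) *\<^sub>C adjoint_op H (V j) (V i f)" if "i \<noteq> j"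
    unfolding adjoint_V[OF *(2,3)] adjoint_V[OF *(2) V_H[OF *(1,3)]]
    by (rule V_Vadj_commute[OF *(1,2) that *(3)])
qed

end

section \<open>Passage to the adjoint tuple\<close>

lemma cinner_sum_left: "cinner (\<Sum>i\<in>A. f i) y = (\<Sum>i\<in>A. cinner (f i) (y::'a::complex_inner))"
  by (induction A rule: infinite_finite_induct) (simp_all add: cinner_add_left)

lemma op_product_append: "op_product A (xs @ ys) h = op_product A xs (op_product A ys h)"
  by (induction xs) (simp_all add: op_product_def)

lemma op_product_Cons: "op_product A (x # xs) h = A x (op_product A xs h)"
  by (simp add: op_product_def)

lemma op_product_Nil: "op_product A [] h = h"
  by (simp add: op_product_def)

lemma sorted_list_of_set_insert_less:
  assumes "finite F" "\<And>x. x \<in> F \<Longrightarrow> i < x"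
  shows "sorted_list_of_set (insert i F) = i # sorted_list_of_set (F :: nat set)"
  using assms by (intro sorted_list_of_set_unique[THEN iffD1])
    (auto simp: card_insert_if less_imp_le)

context q_tuple
begin

section \<open>Brehmer positivity as nonnegativity of iterated defects\<close>

lemma quadratic_form_foldr_defect:
  "quadratic_form f \<Longrightarrow> set is \<subseteq> {1..n} \<Longrightarrow> quadratic_form (foldr defect is f)"
  by (induction "is") (simp_all add: quadratic_form_defect)

lemma foldr_defect_commute:
  assumes "quadratic_form f" "i \<in> {1..n}"
  shows "set is \<subseteq> {1..n} \<Longrightarrow> foldr defect is (defect i f) = defect i (foldr defect is f)"
proof (induction "is")
  case (Cons j "is")
  then have "foldr defect (j # is) (defect i f) = defect j (defect i (foldr defect is f))" by simp
  also have "\<dots> = defect i (defect j (foldr defect is f))"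
    by (rule defect_commute) (use Cons.prems assms quadratic_form_foldr_defect in auto)
  finally show ?case by simp
qed simp

text \<open>\<open>pos\<close> applies the defect of the first index innermost, \<open>foldr\<close>
  applies it outermost; \<open>foldr_defect_commute\<close> reconciles the two. Increasing lists
  stand for the subsets in the Brehmer condition.\<close>

lemma posI:
  assumes "quadratic_form f" "set is \<subseteq> {1..n}" "sorted_wrt (<) is"
    and "\<And>ys h. sorted_wrt (<) ys \<Longrightarrow> set ys \<subseteq> set is \<Longrightarrow> 0 \<le> foldr defect ys f h"
  shows "pos is f"
  using assms
proof (induction "is" arbitrary: f)
  case Nil
  from Nil(4)[of "[]"] show ?case by simp
next
  case (Cons i "is")
  have i: "i \<in> {1..n}" using Cons.prems by simp
  have "pos is f"
  proof (rule Cons.IH)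
    show "0 \<le> foldr defect ys f h" if "sorted_wrt (<) ys" "set ys \<subseteq> set is" for ys h
      by (rule Cons.prems(4)[OF that(1)]) (use that(2) in auto)
  qed (use Cons.prems in auto)
  moreover have "pos is (defect i f)"
  proof (rule Cons.IH)
    show "quadratic_form (defect i f)" by (rule quadratic_form_defect[OF Cons.prems(1) i])
    show "0 \<le> foldr defect ys (defect i f) h" if ys: "sorted_wrt (<) ys" "set ys \<subseteq> set is" for ys h
    proof -
      have "set ys \<subseteq> {1..n}" using ys Cons.prems(2) by auto
      then have "foldr defect ys (defect i f) = foldr defect (i # ys) f"
        by (simp add: foldr_defect_commute[OF Cons.prems(1) i])
      moreover have "sorted_wrt (<) (i # ys)" "set (i # ys) \<subseteq> set (i # is)"
        using ys Cons.prems(3) by auto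
      ultimately show ?thesis using Cons.prems(4)[of "i # ys" h] by simp
    qed
  qed (use Cons.prems in auto)
  ultimately show ?case by simp
qed

text \<open>The outermost defect belongs to the least index i and evaluates the rest at
  \<open>B i h\<close>. In the reversed product for F the operator of the least index acts first
  too, which is why the list must be increasing.\<close>

lemma foldr_defect_norm:
  "sorted_wrt (<) is \<Longrightarrow> foldr defect is (\<lambda>h. (norm h)\<^sup>2) h =
    (\<Sum>F\<in>Pow (set is). (-1) ^ card F * (norm (op_product B (rev (sorted_list_of_set F)) h))\<^sup>2)"
proof (induction "is" arbitrary: h)
  case Nil
  show ?case by (simp add: op_product_Nil)
next
  case (Cons i "is")
  let ?g = "\<lambda>F h. (-1) ^ card F * (norm (op_product B (rev (sorted_list_of_set F)) h))\<^sup>2"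
  have less: "\<And>x. x \<in> set is \<Longrightarrow> i < x" using Cons.prems by simp
  then have i: "i \<notin> set is" by blast
  have "?g (insert i F) h = - ?g F (B i h)" if "F \<in> Pow (set is)" for F
  proof -
    have F: "finite F" "\<And>x. x \<in> F \<Longrightarrow> i < x" using that less finite_subset by auto
    then have "i \<notin> F" by blast
    moreover have "op_product B (rev (sorted_list_of_set (insert i F))) h
        = op_product B (rev (sorted_list_of_set F)) (B i h)"
      by (subst sorted_list_of_set_insert_less)
        (simp_all add: F op_product_append op_product_Cons op_product_Nil)
    ultimately show ?thesis using F(1) by simp
  qed
  then have "(\<Sum>F\<in>insert i ` Pow (set is). ?g F h) = - (\<Sum>F\<in>Pow (set is). ?g F (B i h))"
  proof (subst sum.reindex)
    show "inj_on (insert i) (Pow (set is))"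
      by (rule inj_onI) (use i in \<open>metis PowD insert_ident subsetD\<close>)
  qed (auto simp: sum_negf[symmetric] intro!: sum.cong)
  moreover have "(\<Sum>F\<in>Pow (set (i # is)). ?g F h)
      = (\<Sum>F\<in>Pow (set is). ?g F h) + (\<Sum>F\<in>insert i ` Pow (set is). ?g F h)"
    unfolding list.set Pow_insert by (rule sum.union_disjoint) (use i in auto)
  ultimately show ?case using Cons by (simp add: defect_def)
qed

end

lemma cinner_op_product:
  assumes "\<And>k x y. k \<in> set ks \<Longrightarrow> cinner (T k x) y = cinner x (A k y)"
  shows "cinner (op_product T ks x) y = cinner x (op_product A (rev ks) y)"
  using assms
proof (induction ks arbitrary: y)
  case (Cons k ks)
  then show ?case by (simp add: op_product_append op_product_Cons op_product_Nil)
qed (simp add: op_product_Nil)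

lemma brehmer_tuple_adjoint:
  fixes T :: "nat \<Rightarrow> 'a::chilbert_space \<Rightarrow> 'a"
  assumes q: "is_q n q" and T: "brehmer n q UNIV T"
  shows "brehmer_tuple n q (\<lambda>j. adjoint_op UNIV (T j))"
proof -
  let ?B = "\<lambda>j. adjoint_op UNIV (T j)"
  have contr: "contraction_op UNIV UNIV (T j)" if "j \<in> {1..n}" for j
    using T that unfolding brehmer_def q_contractions_def by blast
  then have bT: "bounded_op UNIV UNIV (T j)" if "j \<in> {1..n}" for j
    using that unfolding contraction_op_def by blast
  have adj: "cinner (T j x) y = cinner x (?B j y)" if "j \<in> {1..n}" for j x y
    using adjoint_op_works(2)[OF closed_csubspace_UNIV bT[OF that]] by simp
  have comm: "T i (T j x) = q i j *\<^sub>C T j (T i x)" if "i \<in> {1..n}" "j \<in> {1..n}" for i j x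
    using T that unfolding brehmer_def q_contractions_def q_commuting_def by blast
  have B: "bounded_op UNIV UNIV (?B j)" if j: "j \<in> {1..n}" for j
    unfolding bounded_op_def
    using adjoint_op_linear[OF closed_csubspace_UNIV bT[OF j]]
      adjoint_op_contraction[OF closed_csubspace_UNIV contr[OF j]] by (auto intro!: exI[of _ 1])
  \<comment> \<open>Taking adjoints reverses the products, which swaps i and j in q, and conjugates
    the phase, which swaps them back.\<close>
  have B_comm: "?B i (?B j x) = q i j *\<^sub>C ?B j (?B i x)" if i: "i \<in> {1..n}" and j: "j \<in> {1..n}" for i j x
  proof (rule adjoint_op_eqI[OF closed_csubspace_UNIV])
    fix z
    have "cinner (T i z) (?B j x) = cinner (q j i *\<^sub>C T i (T j z)) x"
      unfolding adj[OF j, symmetric] comm[OF j i] ..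
    also have "\<dots> = cinner z (cnj (q j i) *\<^sub>C ?B j (?B i x))"
      by (simp add: cinner_scaleC_left cinner_scaleC_right adj[OF i] adj[OF j])
    also have "cnj (q j i) = q i j" using q i j unfolding is_q_def by (metis (no_types))
    finally show "cinner (T i z) (?B j x) = cinner z (q i j *\<^sub>C ?B j (?B i x))" .
  qed simp
  interpret q_tuple n q ?B
    using q B B_comm by unfold_locales
  have "pos [1..<Suc n] (\<lambda>h. (norm h)\<^sup>2)"
  proof (rule posI[OF quadratic_form_norm])
    fix ys and h :: 'a assume ys: "sorted_wrt (<) ys" "set ys \<subseteq> set [1..<Suc n]"
    let ?A = "\<lambda>h. \<Sum>F\<in>Pow (set ys). (-1) ^ card F *\<^sub>C op_set T F (op_set_adj UNIV T F h)"
    have sub: "set ys \<subseteq> {1..n}" using ys by auto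
    then have "positive_op UNIV ?A" using T unfolding brehmer_def by blast
    then have "0 \<le> Re (cinner (?A h) h)" unfolding positive_op_def by blast
    moreover have "cinner (?A h) h
        = complex_of_real (\<Sum>F\<in>Pow (set ys). (-1) ^ card F * (norm (op_set_adj UNIV T F h))\<^sup>2)"
    proof -
      \<comment> \<open>As a form, T_F T_F^* is the squared norm of T_F^* h, so the Brehmer sum is
        an iterated defect of the squared norm.\<close>
      have "cinner (op_set T F (op_set_adj UNIV T F h)) h = complex_of_real ((norm (op_set_adj UNIV T F h))\<^sup>2)"
        if "F \<in> Pow (set ys)" for F
      proof -
        have "finite F" "F \<subseteq> {1..n}" using that sub finite_subset by auto
        then show ?thesis
          using cinner_op_product[of "sorted_list_of_set F" T ?B "op_set_adj UNIV T F h" h] adj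
          unfolding op_set_def by (simp add: op_set_adj_def cinner_same subset_iff)
      qed
      then show ?thesis by (simp add: cinner_sum_left cinner_scaleC_left)
    qed
    ultimately show "0 \<le> foldr defect ys (\<lambda>h. (norm h)\<^sup>2) h"
      unfolding foldr_defect_norm[OF ys(1)] by (simp add: op_set_adj_def)
  qed (auto simp del: upt_Suc)
  then show ?thesis by unfold_locales
qed

text \<open>The scalar \<open>\<Prod>\<^sub>a\<^sub><\<^sub>b s(a,b)\<^bsup>k a * k b\<^esup>\<close> turns the ordered products \<open>B\<^sup>k\<close> into products on which
  each \<open>B\<^sub>i\<close> acts by the rotational weight of \<open>V\<^sub>i\<^sup>*\<close>.\<close>

primrec weyl_phase :: "(nat \<Rightarrow> nat \<Rightarrow> complex) \<Rightarrow> nat \<Rightarrow> (nat \<Rightarrow> nat) \<Rightarrow> complex" where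
  "weyl_phase s 0 k = 1"
| "weyl_phase s (Suc m) k = weyl_phase s m k * (\<Prod>a\<in>{1..m}. s a (Suc m) ^ k a) ^ k (Suc m)"

lemma weyl_phase_cong: "(\<And>t. t \<in> {1..m} \<Longrightarrow> k t = k' t) \<Longrightarrow> weyl_phase s m k = weyl_phase s m k'"
proof (induction m)
  case (Suc m)
  have "(\<Prod>a\<in>{1..m}. s a (Suc m) ^ k a) = (\<Prod>a\<in>{1..m}. s a (Suc m) ^ k' a)"
    by (rule prod.cong) (use Suc.prems in auto)
  then show ?case using Suc by simp
qed simp

text \<open>The pairs a < b that contain i are (t, i) with t < i and (i, t) with t > i. Raising the
  exponent of i adds the exponent of t to the power of the corresponding root.\<close>

lemma weyl_phase_shift_up:
  "i \<in> {1..m} \<Longrightarrow> weyl_phase s m (shift_up i k) =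
    weyl_phase s m k * (\<Prod>t\<in>{1..<i}. s t i ^ k t) * (\<Prod>t\<in>{i<..m}. s i t ^ k t)"
proof (induction m)
  case (Suc m)
  show ?case
  proof (cases "i = Suc m")
    case True
    have "weyl_phase s m (shift_up i k) = weyl_phase s m k" by (rule weyl_phase_cong) (simp add: True)
    moreover have "(\<Prod>a\<in>{1..m}. s a i ^ shift_up i k a) = (\<Prod>a\<in>{1..m}. s a i ^ k a)"
      by (rule prod.cong) (simp_all add: True)
    moreover have "{1..<i} = {1..m}" using True by auto
    ultimately show ?thesis by (simp add: True mult_ac)
  next
    case False
    then have i: "i \<in> {1..m}" using Suc.prems by simp
    have "(\<Prod>a\<in>{1..m} - {i}. s a (Suc m) ^ shift_up i k a) = (\<Prod>a\<in>{1..m} - {i}. s a (Suc m) ^ k a)"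
      by (rule prod.cong) auto
    then have "(\<Prod>a\<in>{1..m}. s a (Suc m) ^ shift_up i k a) = s i (Suc m) * (\<Prod>a\<in>{1..m}. s a (Suc m) ^ k a)"
      unfolding prod.remove[OF finite_atLeastAtMost i] by (simp add: mult_ac)
    moreover have "{i<..Suc m} = insert (Suc m) {i<..m}" using i by auto
    ultimately show ?thesis using False Suc.IH[OF i] by (simp add: power_mult_distrib mult_ac)
  qed
qed simp

lemma cmod_weyl_phase:
  assumes "\<And>a b. a \<in> {1..m} \<Longrightarrow> b \<in> {1..m} \<Longrightarrow> cmod (s a b) = 1"
  shows "cmod (weyl_phase s m k) = 1"
  using assms
proof (induction m)
  case (Suc m)
  have "cmod (\<Prod>a\<in>{1..m}. s a (Suc m) ^ k a) = 1"
    using Suc.prems by (simp add: norm_power flip: prod_norm)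
  then show ?case using Suc by (simp add: norm_mult norm_power)
qed simp

section \<open>The model\<close>

context brehmer_tuple
begin

text \<open>For t < i, absorbing \<open>B i\<close> yields q t i = (s t i)^2: one root is the
  rotational weight, the other is the change of \<open>weyl_phase\<close>. For t > i absorption
  yields nothing, and the factors \<open>s t i\<close> and \<open>s i t\<close> cancel.\<close>

lemma power_intertwines:
  assumes s: "is_sqrt_q n q s" and i: "i \<in> {1..n}"
  shows "weyl_phase s n k *\<^sub>C bpow n k (B i h)
    = ((\<Prod>t\<in>{1..n}. s t i ^ k t) * weyl_phase s n (shift_up i k)) *\<^sub>C bpow n (shift_up i k) h"
proof -
  have s_i: "s i i = 1" and s_inv: "t \<in> {1..n} \<Longrightarrow> s t i * s i t = 1"
    and s_sq: "t \<in> {1..n} \<Longrightarrow> q t i = s t i * s t i" for t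
  proof -
    show "s i i = 1" using s i unfolding is_sqrt_q_def by blast
    assume t: "t \<in> {1..n}"
    have sq: "(s t i)\<^sup>2 = q t i" and cnj: "s i t = cnj (s t i)"
      using s i t unfolding is_sqrt_q_def by blast+
    show "q t i = s t i * s t i" unfolding sq[symmetric] power2_eq_square ..
    have "(cmod (s t i))\<^sup>2 = 1" unfolding norm_power[symmetric] sq using norm_q[OF t i] by simp
    then show "s t i * s i t = 1" unfolding cnj complex_norm_square[symmetric] by simp
  qed
  let ?L = "\<Prod>t\<in>{1..<i}. s t i ^ k t" and ?R = "\<Prod>t\<in>{i<..n}. s t i ^ k t"
    and ?R' = "\<Prod>t\<in>{i<..n}. s i t ^ k t"
  have "{1..n} = {1..<i} \<union> insert i {i<..n}" "{1..<i} \<inter> insert i {i<..n} = {}" using i by auto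
  then have "(\<Prod>t\<in>{1..n}. s t i ^ k t) = ?L * (\<Prod>t\<in>insert i {i<..n}. s t i ^ k t)"
    by (simp only: prod.union_disjoint finite_atLeastLessThan finite_insert finite_greaterThanAtMost)
  then have "(\<Prod>t\<in>{1..n}. s t i ^ k t) = ?L * ?R" by (simp add: s_i)
  moreover have "(\<Prod>t\<in>{1..<i}. q t i ^ k t) = ?L * ?L"
    unfolding prod.distrib[symmetric] power_mult_distrib[symmetric]
    by (rule prod.cong) (use i s_sq in auto)
  moreover have "?R * ?R' = 1"
    unfolding prod.distrib[symmetric] power_mult_distrib[symmetric]
    by (rule prod.neutral) (use i s_inv in auto)
  ultimately have "weyl_phase s n k * (\<Prod>t\<in>{1..<i}. q t i ^ k t)
      = (\<Prod>t\<in>{1..n}. s t i ^ k t) * weyl_phase s n (shift_up i k)"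
    unfolding weyl_phase_shift_up[OF i] by algebra
  then show ?thesis
    by (simp only: bpow_B_absorb[OF order_refl i] scaleC_scaleC flip: shift_up_def)
qed

lemma norm_decomposition_fibre:
  assumes "G \<subseteq> {1..n}"
  shows "((\<lambda>k. Delta G n (bpow n k h)) has_sum (\<Sum>\<^sub>\<infinity>k\<in>exponents G. Delta G n (bpow n k h))) (exponents G)"
  using summable_on_SigmaD1[OF has_sum_imp_summable[OF norm_decomposition[OF order_refl, of h]], of G] assms
  by simp

end

lemma direct_sum_opI:
  assumes "\<And>i. i \<in> I \<Longrightarrow> l2_coeff y i = A i (l2_coeff x i)" "\<And>i. i \<notin> I \<Longrightarrow> l2_coeff y i = 0"
  shows "direct_sum_op I A x = y"
proof -
  have "(\<lambda>i. if i \<in> I then A i (l2_coeff x i) else 0) = l2_coeff y" using assms by auto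
  then show ?thesis by (simp add: direct_sum_op_def l2_coeff_inverse)
qed

theorem theorem3p9:
  fixes n :: nat
    and q s :: "nat \<Rightarrow> nat \<Rightarrow> complex"
    and T :: "nat \<Rightarrow> 'a::chilbert_space \<Rightarrow> 'a"
  assumes "is_q n q"
    and "is_sqrt_q n q s"
    and "brehmer n q UNIV T"
  shows "\<exists>(E :: nat set \<Rightarrow> 'a model_coeff set)
          (V :: nat set \<Rightarrow> nat \<Rightarrow> 'a model_hardy \<Rightarrow> 'a model_hardy)
          (P :: 'a \<Rightarrow> (nat set, 'a model_hardy) l2sum).
      (\<forall>G \<subseteq> {1..n}.
          closed_csubspace (E G) \<and>
          (\<forall>j\<in>{1..n}. isometry_op (hardy G (E G)) (hardy G (E G)) (V G j)) \<and>
          doubly_q_commuting n q (hardy G (E G)) (V G)) \<and>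
      isometry_op UNIV (direct_sum (Pow {1..n}) (\<lambda>G. hardy G (E G))) P \<and>
      (\<forall>j\<in>{1..n}. \<forall>h.
          P (adjoint_op UNIV (T j) h) =
          direct_sum_op (Pow {1..n}) (\<lambda>G. adjoint_op (hardy G (E G)) (V G j)) (P h)) \<and>
      (\<forall>G \<subseteq> {1..n}. \<forall>i\<in>G. \<forall>f \<in> hardy G (E G).
          V G i f = mult_z i (rotation s G i f)) \<and>
      (\<forall>G \<subseteq> {1..n}. \<forall>j\<in>{1..n} - G. unitary_op (hardy G (E G)) (V G j))"
proof -
  define B where "B j = adjoint_op UNIV (T j)" for j
  interpret brehmer_tuple n q B
    unfolding B_def by (rule brehmer_tuple_adjoint[OF assms(1,3)])
  let ?good = "\<lambda>G E S Y U. closed_csubspace E \<and> bounded_op UNIV E (S :: 'a \<Rightarrow> 'a model_coeff) \<and>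
    (\<forall>h. (norm (S h))\<^sup>2 = Delta G n h) \<and>
    (\<forall>j\<in>{1..n} - G. isometry_op E E (Y j) \<and> isometry_op E E (U j) \<and>
       (\<forall>x\<in>E. Y j (U j x) = x) \<and> (\<forall>x\<in>E. U j (Y j x) = x) \<and> (\<forall>h. Y j (S h) = S (B j h))) \<and>
    (\<forall>i\<in>{1..n} - G. \<forall>j\<in>{1..n} - G. \<forall>x\<in>E. Y i (Y j x) = q i j *\<^sub>C Y j (Y i x))"
  have "\<forall>G. \<exists>m. ?good G (fst m) (fst (snd m)) (fst (snd (snd m))) (snd (snd (snd m)))"
  proof
    fix G
    obtain E S Y U where "?good G E S Y U" using model_space[of G] by blast
    then show "\<exists>m. ?good G (fst m) (fst (snd m)) (fst (snd (snd m))) (snd (snd (snd m)))"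
      by (intro exI[of _ "(E, S, Y, U)"], unfold fst_conv snd_conv)
  qed
  from choice[OF this] obtain m
    where m: "\<And>G. ?good G (fst (m G)) (fst (snd (m G))) (fst (snd (snd (m G)))) (snd (snd (snd (m G))))"
    by blast
  define E S Y U where "E G = fst (m G)" and "S G = fst (snd (m G))"
    and "Y G = fst (snd (snd (m G)))" and "U G = snd (snd (snd (m G)))" for G
  have good: "?good G (E G) (S G) (Y G) (U G)" for G
    unfolding E_def S_def Y_def U_def by (rule m)
  have E: "closed_csubspace (E G)" and S: "bounded_op UNIV (E G) (S G)"
    and norm_S: "(norm (S G h))\<^sup>2 = Delta G n h" for G h
    using good[of G] by blast+
  have Y_S: "Y G j (S G h) = S G (B j h)" and Y: "isometry_op (E G) (E G) (Y G j)"
    if "j \<in> {1..n} - G" for G j h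
    using good[of G] that by blast+
  note S_add = bounded_opD(2)[OF S UNIV_I UNIV_I] and S_scale = bounded_opD(3)[OF S UNIV_I]
    and S_E = bounded_opD(1)[OF S UNIV_I]
  have model: "hardy_model n q s G (E G) (U G) (Y G)" if "G \<subseteq> {1..n}" for G
    unfolding hardy_model_def using good[of G] assms(1,2) that by blast
  define V where "V G = hardy_model.V q s G (U G)" for G
  define Va where "Va G = hardy_model.Vadj q s G (Y G)" for G
  define p where "p = weyl_phase s n"
  have norm_p: "cmod (p k) = 1" for k
    unfolding p_def
  proof (rule cmod_weyl_phase)
    fix a b assume ab: "a \<in> {1..n}" "b \<in> {1..n}"
    \<comment> \<open>The choice G = {} is arbitrary; the locale is entered here only for
      \<open>norm_s\<close>.\<close>
    interpret M: hardy_model n q s "{}" "E {}" "U {}" "Y {}" by (rule model) simp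
    show "cmod (s a b) = 1" by (rule M.norm_s[OF ab])
  qed
  \<comment> \<open>The phase p leaves norms alone. Without it the intertwining relation for j in G
    would hold only up to a scalar depending on k.\<close>
  define c where "c G h k = (if k \<in> exponents G then p k *\<^sub>C S G (bpow n k h) else 0)" for G h k
  define x where "x G h = l2_of (c G h)" for G h
  have c_sum: "((\<lambda>k. (norm (c G h k))\<^sup>2) has_sum (\<Sum>\<^sub>\<infinity>k\<in>exponents G. Delta G n (bpow n k h))) UNIV"
    if "G \<subseteq> {1..n}" for G h
  proof -
    have "((\<lambda>k. (norm (c G h k))\<^sup>2) has_sum r) UNIV
        \<longleftrightarrow> ((\<lambda>k. Delta G n (bpow n k h)) has_sum r) (exponents G)" for r
      by (rule has_sum_cong_neutral) (auto simp: c_def norm_scaleC norm_p norm_S)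
    then show ?thesis using norm_decomposition_fibre[OF that] by (rule iffD2)
  qed
  have x_coeff: "l2_coeff (x G h) k = c G h k" if "G \<subseteq> {1..n}" for G h k
    unfolding x_def l2_of_has_sum(1)[OF c_sum[OF that]] ..
  have x_norm: "(norm (x G h))\<^sup>2 = (\<Sum>\<^sub>\<infinity>k\<in>exponents G. Delta G n (bpow n k h))"
    if "G \<subseteq> {1..n}" for G h
    unfolding x_def by (rule l2_of_has_sum(2)[OF c_sum[OF that]])
  define P where "P h = l2_of (\<lambda>G. if G \<in> Pow {1..n} then x G h else 0)" for h
  have P_sum: "((\<lambda>G. (norm (if G \<in> Pow {1..n} then x G h else 0))\<^sup>2) has_sum (norm h)\<^sup>2) UNIV" for h
  proof -
    \<comment> \<open>The expansion of the squared norm is summed first over k, giving the norm of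
      \<open>x G h\<close>, and then over G.\<close>
    have "((\<lambda>G. (norm (x G h))\<^sup>2) has_sum (norm h)\<^sup>2) (Pow {1..n})"
      by (rule has_sum_SigmaD[OF norm_decomposition[OF order_refl]])
        (use norm_decomposition_fibre in \<open>simp add: x_norm\<close>)
    then show ?thesis by (subst has_sum_cong_neutral[where T = "Pow {1..n}"]) auto
  qed
  have P_coeff: "l2_coeff (P h) G = (if G \<in> Pow {1..n} then x G h else 0)" for h G
    unfolding P_def l2_of_has_sum(1)[OF P_sum] ..
  have norm_P: "norm (P h) = norm h" for h
    by (rule power2_eq_imp_eq[OF l2_of_has_sum(2)[OF P_sum, folded P_def]]) simp_all
  have x_H: "x G h \<in> hardy G (E G)" if "G \<subseteq> {1..n}" for G h
    unfolding hardy_def mem_Collect_eq x_coeff[OF that] c_def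
    by (auto simp: exponents_def closed_csubspaceD(1)[OF E] closed_csubspaceD(3)[OF E S_E])
  have P_op: "isometry_op UNIV (direct_sum (Pow {1..n}) (\<lambda>G. hardy G (E G))) P"
    unfolding isometry_op_def bounded_op_def
  proof (intro conjI ballI allI)
    fix h g :: 'a and a
    show "P h \<in> direct_sum (Pow {1..n}) (\<lambda>G. hardy G (E G))"
      using x_H by (auto simp: direct_sum_def P_coeff)
    show "P (h + g) = P h + P g"
    proof (rule l2_eqI)
      have "x G (h + g) = x G h + x G g" if "G \<subseteq> {1..n}" for G
        by (rule l2_eqI) (simp add: x_coeff[OF that] c_def bpow_add S_add scaleC_add_right)
      then show "l2_coeff (P (h + g)) G = l2_coeff (P h + P g) G" for G by (simp add: P_coeff)
    qed
    show "P (a *\<^sub>C h) = a *\<^sub>C P h"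
    proof (rule l2_eqI)
      have "x G (a *\<^sub>C h) = a *\<^sub>C x G h" if "G \<subseteq> {1..n}" for G
        by (rule l2_eqI) (simp add: x_coeff[OF that] c_def bpow_scaleC S_scale scaleC_scaleC mult.commute)
      then show "l2_coeff (P (a *\<^sub>C h)) G = l2_coeff (a *\<^sub>C P h) G" for G by (simp add: P_coeff)
    qed
  qed (use norm_P in \<open>auto intro!: exI[of _ 1]\<close>)
  have Va_x: "Va G j (x G h) = x G (B j h)" if G: "G \<subseteq> {1..n}" and j: "j \<in> {1..n}" for G j h
  proof -
    interpret M: hardy_model n q s G "E G" "U G" "Y G" by (rule model[OF G])
    \<comment> \<open>Exponents vanish off G, so the weights over {1..n} in the intertwining lemmas
      agree with \<open>\<sigma>\<close> and \<open>\<tau>\<close>, which are products over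
      G.\<close>
    have prod_G: "(\<Prod>t\<in>{1..n}. w t ^ k t) = (\<Prod>t\<in>G. w t ^ k t)"
      if "k \<in> exponents G" for w :: "nat \<Rightarrow> complex" and k
      using that G by (intro prod.mono_neutral_right) (auto simp: exponents_def)
    show ?thesis
    proof (rule l2_eqI)
      fix k
      show "l2_coeff (Va G j (x G h)) k = l2_coeff (x G (B j h)) k"
      proof (cases "j \<in> G")
        case True
        have "shift_up j k \<in> exponents G \<longleftrightarrow> k \<in> exponents G"
          using True by (auto simp: exponents_def shift_up_def)
        moreover have "cnj (M.\<sigma> j k) *\<^sub>C p (shift_up j k) *\<^sub>C S G (bpow n (shift_up j k) h)
            = p k *\<^sub>C S G (bpow n k (B j h))" if k: "k \<in> exponents G"
        proof -
          have "cnj (M.\<sigma> j k) = (\<Prod>t\<in>{1..n}. s t j ^ k t)"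
            unfolding M.\<sigma>_def prod_G[OF k] cnj_prod complex_cnj_power
            by (rule prod.cong) (use M.s_cnj[OF j] G in auto)
          then show ?thesis
            unfolding p_def S_scale[symmetric] power_intertwines[OF assms(2) j] scaleC_scaleC by simp
        qed
        ultimately show ?thesis
          unfolding Va_def M.Vadj_coeff_shift[OF True] x_coeff[OF G] c_def by simp
      next
        case False
        then have j': "j \<in> {1..n} - G" using j by simp
        note b = isometry_opD(1)[OF Y[OF j']]
        \<comment> \<open>Here k does not change, so p occurs equally on both sides, and the
          conjugate of \<open>\<tau> j k\<close> is exactly the factor in
          \<open>bpow_B_commute\<close>.\<close>
        have "cnj (M.\<tau> j k) *\<^sub>C Y G j (p k *\<^sub>C S G (bpow n k h)) = p k *\<^sub>C S G (bpow n k (B j h))"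
          if k: "k \<in> exponents G"
        proof -
          have "cnj (M.\<tau> j k) = (\<Prod>t\<in>{1..n}. q t j ^ k t)"
            unfolding M.\<tau>_def prod_G[OF k] cnj_prod complex_cnj_power
            by (rule prod.cong) (use M.q_cnj[OF _ j] G in auto)
          then show ?thesis
            unfolding bounded_opD(3)[OF b S_E] Y_S[OF j'] bpow_B_commute[OF order_refl j] S_scale scaleC_scaleC
            by (simp add: mult.commute)
        qed
        then show ?thesis
          unfolding Va_def M.Vadj_coeff[OF j' x_H[OF G]] x_coeff[OF G] c_def
          by (simp add: bounded_op_zero[OF E b])
      qed
    qed
  qed
  have adj: "adjoint_op (hardy G (E G)) (V G j) f = Va G j f"
    if "G \<subseteq> {1..n}" "j \<in> {1..n}" "f \<in> hardy G (E G)" for G j f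
    unfolding V_def Va_def by (rule hardy_model.adjoint_V[OF model[OF that(1)] that(2,3)])
  have intertwine: "P (adjoint_op UNIV (T j) h)
      = direct_sum_op (Pow {1..n}) (\<lambda>G. adjoint_op (hardy G (E G)) (V G j)) (P h)"
    if j: "j \<in> {1..n}" for j h
    unfolding B_def[symmetric]
    by (rule direct_sum_opI[symmetric]) (simp_all add: P_coeff adj[OF _ j] x_H Va_x[OF _ j])
  show ?thesis
  proof (intro exI[of _ E] exI[of _ V] exI[of _ P] conjI allI impI ballI P_op intertwine E)
    fix G assume G: "G \<subseteq> {1..n}"
    interpret M: hardy_model n q s G "E G" "U G" "Y G" by (rule model[OF G])
    show "isometry_op (hardy G (E G)) (hardy G (E G)) (V G j)" if "j \<in> {1..n}" for j
      unfolding V_def by (rule M.isometry_V[OF that])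
    show "doubly_q_commuting n q (hardy G (E G)) (V G)"
      unfolding V_def by (rule M.doubly_q_commuting_V)
    show "V G i f = mult_z i (rotation s G i f)" if "i \<in> G" for i f
      using that by (simp add: V_def M.V_def)
    show "unitary_op (hardy G (E G)) (V G j)" if "j \<in> {1..n} - G" for j
      unfolding V_def by (rule M.unitary_V[OF that])
  qed
qed

end
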